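(* A third-order ordinary differential equation determines a causal geometry on its space of solutions. That is, let $\mathbb M$ be the three-dimensional space of solutions of a third-order differential equation $y'''=F(x,y,y',y'')$ (localized as described in the context), with the incidence relation in which two solutions $y_1,y_2$ are incident if $y_1(x)=y_2(x)$ and $y_1'(x)=y_2'(x)$ for some $x$, and let $N_P$ and $N_{PQ}$ be the associated incidence cones and curves. Then the following hold in a sufficiently small neighborhood of each $P\in\mathbb M$: 1. $N_P\setminus\{P\}$ is a smooth embedded hypersurface in $\mathbb M$. 2. The singular variety $N_P$ is ruled by a pencil of smooth curves $N_{PQ}$ from $P$ to $Q$, as $Q$ varies over $N_P\setminus\{P\}$. 3. For every $Q\in N_P\setminus\{P\}$, the curve $N_{PQ}$ on $N_P$ coincides with the curve $N_{QP}$ on $N_Q$. 4. Let $C_P$ be the set of tangents at $P$ to the curves $N_{PQ}$ as $Q$ varies over $N_P\setminus\{P\}$. Then $C_P$ is a regular (smooth) curve in the projective tangent space $\mathbb PT_P\mathbb M$ and does not make second-order contact with any of its tangent lines. 5. If $Q,R\in N_P\setminus\{P\}$ are distinct points which are mutually incident, then $T_RN_P=T_RN_Q$.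
   Context: For $P\in\mathbb M$ write $y=f(x;P)$ for the corresponding solution; $f$ depends smoothly on $x$ and $P$. The standing assumption under which $\mathbb M$ is a smooth three-manifold parameterizing solutions is that, in local coordinates $P=(p_1,p_2,p_3)$ on $\mathbb M$, the Wronskian determinant $$\det\begin{bmatrix}\partial f/\partial p_1&\partial f/\partial p_2&\partial f/\partial p_3\\ \partial f_x/\partial p_1&\partial f_x/\partial p_2&\partial f_x/\partial p_3\\ \partial f_{xx}/\partial p_1&\partial f_{xx}/\partial p_2&\partial f_{xx}/\partial p_3\end{bmatrix}$$ is nowhere zero (subscript $x$ denotes $\partial/\partial x$). The first jet space $J^1$ has coordinates $(x,y,p)$, $p=y'$; a solution defines the curve $x\mapsto(x,y(x),y'(x))$ in $J^1$, and two solutions are incident exactly when their curves in $J^1$ meet. For $P\in\mathbb M$, $N_P\subset\mathbb M$ is the set of all solutions incident with $P$. If $Q\in N_P\setminus\{P\}$, then $N_{PQ}$ is the curve of all solutions $R$ incident with $P$ at the same point of $J^1$ as $Q$. Everything is local: the equation is assumed regular and one works near a point of $J^1$ and a point of $\mathbb M$ simultaneously, so that two distinct solutions are incident at most at a single point of $J^1$; the "cone" $N_P$ need not close up. The five properties listed in the claim are the axioms of a causal geometry; $C_P$ is called the indicatrix. *)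

theory Defs
  imports "HOL-Analysis.Analysis"
begin

section \<open>Smooth maps and submanifolds of Euclidean spaces\<close>

text \<open>
  \<open>C_k_on k S f\<close> is the usual notion of a \<open>C\<^sup>k\<close> map when \<open>S\<close> is open (the only case used): all
  iterated directional derivatives up to order \<open>k\<close> exist and are continuous.
\<close>

primrec C_k_on ::
  "nat \<Rightarrow> 'a::euclidean_space set \<Rightarrow> ('a \<Rightarrow> 'b::euclidean_space) \<Rightarrow> bool" where
  "C_k_on 0 S f \<longleftrightarrow> continuous_on S f"
| "C_k_on (Suc k) S f \<longleftrightarrow>
     (\<forall>x\<in>S. f differentiable (at x)) \<and>
     (\<forall>v. C_k_on k S (\<lambda>x. frechet_derivative f (at x) v))"

definition smooth_on ::
  "'a::euclidean_space set \<Rightarrow> ('a \<Rightarrow> 'b::euclidean_space) \<Rightarrow> bool" where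
  "smooth_on S f \<longleftrightarrow> (\<forall>k. C_k_on k S f)"

definition embedded_submanifold :: "nat \<Rightarrow> 'a::euclidean_space set \<Rightarrow> bool" where
  "embedded_submanifold k S \<longleftrightarrow>
     (\<forall>p\<in>S. \<exists>U V \<phi> \<psi> L.
        open U \<and> p \<in> U \<and> open V \<and> homeomorphism U V \<phi> \<psi> \<and>
        smooth_on U \<phi> \<and> smooth_on V \<psi> \<and>
        subspace (L :: 'a set) \<and> dim L = k \<and> \<phi> ` (S \<inter> U) = L \<inter> V)"

definition tangent_space :: "'a::euclidean_space set \<Rightarrow> 'a \<Rightarrow> 'a set" where
  "tangent_space S p =
     {w. \<exists>\<gamma> e. 0 < e \<and> smooth_on {-e<..<e} \<gamma> \<and> \<gamma> ` {-e<..<e} \<subseteq> S \<and> \<gamma> 0 = p \<and>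
               (\<gamma> has_vector_derivative w) (at 0)}"

text \<open>
  A smooth one-parameter family of regular curves: for each parameter \<open>s\<close> in the open interval \<open>J\<close>,
  the map \<open>\<lambda>t. \<Phi> (s, t)\<close> is an injective regular parametrization, by an open interval, of the member
  of the family with parameter \<open>s\<close>; distinct parameters give distinct curves.
\<close>

definition smooth_pencil :: "'a::euclidean_space set set \<Rightarrow> bool" where
  "smooth_pencil \<C> \<longleftrightarrow>
     (\<exists>(J :: real set) (W :: (real \<times> real) set) \<Phi>.
        open J \<and> is_interval J \<and> J \<noteq> {} \<and>
        open W \<and> W \<subseteq> J \<times> UNIV \<and> smooth_on W \<Phi> \<and>
        (\<forall>s\<in>J. is_interval {t. (s, t) \<in> W} \<and> inj_on (\<lambda>t. \<Phi> (s, t)) {t. (s, t) \<in> W}) \<and>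
        (\<forall>s t. (s, t) \<in> W \<longrightarrow> vector_derivative (\<lambda>u. \<Phi> (s, u)) (at t) \<noteq> 0) \<and>
        bij_betw (\<lambda>s. (\<lambda>t. \<Phi> (s, t)) ` {t. (s, t) \<in> W}) J \<C>)"


section \<open>Curves in a projective space\<close>

text \<open>
  Points of the projective space of \<open>'a\<close> are represented by the one-dimensional subspaces
  \<open>span {w}\<close> with \<open>w \<noteq> 0\<close>; the topology is the quotient topology along \<open>w \<mapsto> span {w}\<close>.
\<close>

definition proj_open :: "'a::euclidean_space set set \<Rightarrow> bool" where
  "proj_open \<W> \<longleftrightarrow> \<W> \<subseteq> {span {w} | w. w \<noteq> 0} \<and> open {w. w \<noteq> 0 \<and> span {w} \<in> \<W>}"

definition proj_topology :: "'a::euclidean_space set topology" where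
  "proj_topology = topology proj_open"

lemma istopology_proj_open: "istopology (proj_open :: 'a::euclidean_space set set \<Rightarrow> bool)"
  unfolding istopology_def
proof (intro conjI allI impI)
  fix S T :: "'a set set" assume "proj_open S" "proj_open T"
  moreover have "{w. w \<noteq> 0 \<and> span {w} \<in> S \<inter> T} =
      {w. w \<noteq> 0 \<and> span {w} \<in> S} \<inter> {w. w \<noteq> 0 \<and> span {w} \<in> T}" by auto
  ultimately show "proj_open (S \<inter> T)"
    unfolding proj_open_def by (auto simp only: intro: open_Int)
next
  fix \<K> :: "'a set set set" assume K: "\<forall>K\<in>\<K>. proj_open K"
  have "{w. w \<noteq> 0 \<and> span {w} \<in> \<Union>\<K>} = (\<Union>K\<in>\<K>. {w. w \<noteq> 0 \<and> span {w} \<in> K})" by auto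
  with K show "proj_open (\<Union>\<K>)"
    unfolding proj_open_def by (auto simp only: intro!: open_UN)
qed

lemma openin_proj_topology: "openin proj_topology = proj_open"
  by (simp add: proj_topology_def istopology_proj_open)

text \<open>
  \<open>v\<close> is a smooth lift of a parametrized projective curve. The curve \<open>t \<mapsto> [v(t)]\<close> is an immersion at
  \<open>t\<close> iff \<open>v(t)\<close> and \<open>v'(t)\<close> are linearly independent, which does not depend on the lift.
\<close>

definition regular_proj_curve ::
  "'a::euclidean_space set set \<Rightarrow> real set \<Rightarrow> (real \<Rightarrow> 'a) \<Rightarrow> bool" where
  "regular_proj_curve C J v \<longleftrightarrow>
     open J \<and> is_interval J \<and> J \<noteq> {} \<and> smooth_on J v \<and>
     (\<forall>t\<in>J. dim {v t, vector_derivative v (at t)} = 2) \<and>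
     embedding_map (top_of_set J) proj_topology (\<lambda>t. span {v t}) \<and>
     C = (\<lambda>t. span {v t}) ` J"

text \<open>
  A projective line is given by the linear plane \<open>L\<close> over it. Contact of order \<open>k\<close> at parameter \<open>t\<close>
  means that the equations of the line, restricted to the curve, vanish at \<open>t\<close> together with their
  first \<open>k\<close> derivatives; this does not depend on the lift \<open>v\<close> either.
\<close>

definition line_contact ::
  "nat \<Rightarrow> (real \<Rightarrow> 'a::euclidean_space) \<Rightarrow> real \<Rightarrow> 'a set \<Rightarrow> bool" where
  "line_contact k v t L \<longleftrightarrow>
     (\<forall>a. (\<forall>w\<in>L. a \<bullet> w = 0) \<longrightarrow> (\<forall>j\<le>k. (deriv ^^ j) (\<lambda>s. a \<bullet> v s) t = 0))"

definition proj_tangent_line :: "(real \<Rightarrow> 'a::euclidean_space) \<Rightarrow> real \<Rightarrow> 'a set" where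
  "proj_tangent_line v t = span {v t, vector_derivative v (at t)}"


section \<open>Causal geometries\<close>

text \<open>
  \<open>U\<close> is a three-manifold given in a coordinate chart, so that every tangent space \<open>T\<^sub>P U\<close> is
  \<open>\<real>\<^sup>3\<close>; \<open>N P\<close> is the cone of \<open>P\<close>, and \<open>K P Q\<close> the curve on it determined by \<open>Q\<close>. Both contain the
  vertex \<open>P\<close>. In the last clause of \<open>causal_geometry\<close>, \<open>T\<^sub>R N\<^sub>P\<close> is the tangent space at \<open>R\<close> of the
  hypersurface obtained by removing the vertex.
\<close>

definition indicatrix ::
  "(real^3 \<Rightarrow> (real^3) set) \<Rightarrow> (real^3 \<Rightarrow> real^3 \<Rightarrow> (real^3) set) \<Rightarrow> real^3 \<Rightarrow> (real^3) set set" where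
  "indicatrix N K P = (\<lambda>Q. tangent_space (K P Q) P) ` (N P - {P})"

definition causal_geometry ::
  "(real^3) set \<Rightarrow> (real^3 \<Rightarrow> (real^3) set) \<Rightarrow> (real^3 \<Rightarrow> real^3 \<Rightarrow> (real^3) set) \<Rightarrow> bool" where
  "causal_geometry U N K \<longleftrightarrow>
     open U \<and> (\<forall>P\<in>U. N P \<subseteq> U) \<and>
     (\<forall>P\<in>U. embedded_submanifold 2 (N P - {P})) \<and>
     (\<forall>P\<in>U. (\<forall>Q\<in>N P - {P}. embedded_submanifold 1 (K P Q) \<and> connected (K P Q) \<and>
                             P \<in> K P Q \<and> Q \<in> K P Q) \<and>
             (\<Union>Q\<in>N P - {P}. K P Q) = N P \<and>
             (\<forall>Q\<in>N P - {P}. \<forall>R\<in>N P - {P}. K P Q = K P R \<or> K P Q \<inter> K P R = {P}) \<and>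
             smooth_pencil (K P ` (N P - {P}))) \<and>
     (\<forall>P\<in>U. \<forall>Q\<in>N P - {P}. P \<in> N Q - {Q} \<and> K P Q = K Q P) \<and>
     (\<forall>P\<in>U. \<exists>J v. regular_proj_curve (indicatrix N K P) J v \<and>
                   (\<forall>t\<in>J. \<not> line_contact 2 v t (proj_tangent_line v t))) \<and>
     (\<forall>P\<in>U. \<forall>Q\<in>N P - {P}. \<forall>R\<in>N P - {P}. Q \<noteq> R \<and> R \<in> N Q \<longrightarrow>
        tangent_space (N P - {P}) R = tangent_space (N Q - {Q}) R)"


section \<open>Families of solutions of a third-order equation\<close>

definition xderiv :: "nat \<Rightarrow> (real \<Rightarrow> real^3 \<Rightarrow> real) \<Rightarrow> real \<Rightarrow> real^3 \<Rightarrow> real" where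
  "xderiv k f x P = (deriv ^^ k) (\<lambda>t. f t P) x"

definition pgrad :: "(real^3 \<Rightarrow> real) \<Rightarrow> real^3 \<Rightarrow> real^3" where
  "pgrad g P = (\<chi> j. frechet_derivative g (at P) (axis j 1))"

definition wronskian :: "(real \<Rightarrow> real^3 \<Rightarrow> real) \<Rightarrow> real \<Rightarrow> real^3 \<Rightarrow> real" where
  "wronskian f x P =
     det (vector [pgrad (xderiv 0 f x) P, pgrad (xderiv 1 f x) P, pgrad (xderiv 2 f x) P]
          :: real^3^3)"

definition jet1_curve ::
  "(real \<Rightarrow> real^3 \<Rightarrow> real) \<Rightarrow> real set \<Rightarrow> real^3 \<Rightarrow> (real \<times> real \<times> real) set" where
  "jet1_curve f I P = (\<lambda>x. (x, f x P, xderiv 1 f x P)) ` I"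

definition incident ::
  "(real \<Rightarrow> real^3 \<Rightarrow> real) \<Rightarrow> real set \<Rightarrow> real^3 \<Rightarrow> real^3 \<Rightarrow> bool" where
  "incident f I P Q \<longleftrightarrow> jet1_curve f I P \<inter> jet1_curve f I Q \<noteq> {}"

definition incidence_cone ::
  "(real \<Rightarrow> real^3 \<Rightarrow> real) \<Rightarrow> real set \<Rightarrow> (real^3) set \<Rightarrow> real^3 \<Rightarrow> (real^3) set" where
  "incidence_cone f I U P = {Q\<in>U. incident f I P Q}"

definition incidence_curve ::
  "(real \<Rightarrow> real^3 \<Rightarrow> real) \<Rightarrow> real set \<Rightarrow> (real^3) set \<Rightarrow> real^3 \<Rightarrow> real^3 \<Rightarrow> (real^3) set" where
  "incidence_curve f I U P Q =
     {R\<in>U. \<exists>z. z \<in> jet1_curve f I P \<and> z \<in> jet1_curve f I Q \<and> z \<in> jet1_curve f I R}"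

definition incident_at_most_once ::
  "(real \<Rightarrow> real^3 \<Rightarrow> real) \<Rightarrow> real set \<Rightarrow> (real^3) set \<Rightarrow> bool" where
  "incident_at_most_once f I U \<longleftrightarrow>
     (\<forall>P\<in>U. \<forall>Q\<in>U. P \<noteq> Q \<longrightarrow>
        (\<forall>z\<in>jet1_curve f I P \<inter> jet1_curve f I Q.
         \<forall>z'\<in>jet1_curve f I P \<inter> jet1_curve f I Q. z = z'))"

end

theory Submission
  imports Defs
begin

text \<open>
  Let \<open>u\<close> be the difference of two distinct solutions near \<open>(x\<^sub>0, P\<^sub>0)\<close>. By the mean value theorem the
  values \<open>u(x\<^sub>1)\<close>, \<open>u'(x\<^sub>2)\<close>, \<open>u''(x\<^sub>3)\<close> cannot all vanish, because the Wronskian with rows taken at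
  three different nearby points is still nonzero. Hence if the solutions are incident at \<open>x\<^sub>1\<close>, then
  \<open>u''\<close> has no zero, so \<open>u\<close> is strictly convex or concave and has no other zero. This gives uniqueness
  of the point of incidence, and, comparing the signs of the three differences, that three mutually
  incident solutions are incident at one common point; the tangent space of a cone at \<open>R\<close> is the
  kernel of the parameter gradient of \<open>f\<close> at that point, whence \<open>T\<^sub>R N\<^sub>P = T\<^sub>R N\<^sub>Q\<close>. The same
  monotonicity shows that nearby points of \<open>N\<^sub>P\<close> have nearby points of incidence, so the obvious
  parametrization of \<open>N\<^sub>P - {P}\<close> by the point of incidence and \<open>y''\<close> is an embedding. Its ruling
  through \<open>P\<close> has the direction \<open>\<nabla>f \<times> \<nabla>f\<^sub>x\<close>, whose first two \<open>x\<close>-derivatives are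
  \<open>\<nabla>f \<times> \<nabla>f\<^sub>x\<^sub>x\<close> and \<open>\<nabla>f\<^sub>x \<times> \<nabla>f\<^sub>x\<^sub>x\<close> modulo vectors orthogonal to \<open>\<nabla>f\<close>; the Wronskian
  is the pairing of the last one with \<open>\<nabla>f\<close>, so the contact with the tangent line is only of first order.
\<close>


section \<open>Calculus of smooth maps\<close>

text \<open>The shape of the neighbourhood is dictated by the pencil. Each ruling has to be
  parametrized by one interval, so it must meet \<open>U\<close> in a single arc, which an arbitrary
  small open set does not ensure. A small ball around \<open>P\<^sub>0\<close> does: along a ruling,
  half the squared distance to \<open>P\<^sub>0\<close> has as second derivative the squared speed
  plus a term that vanishes at \<open>P\<^sub>0\<close>, hence is convex nearby, and its sublevel
  sets are intervals. A ball is also convex, as the mean value theorem in the parameters requires.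
  The other analytic conditions of \<open>solution_chart\<close> are open ones at the base point and
  pass to smaller sets, so one choice of \<open>V\<close>, \<open>\<Gamma>\<close>,
  \<open>a\<close>, \<open>b\<close> serves all sizes up to \<epsilon>.

  Charts are wanted smooth, not just C^1. The inverse function theorem is upgraded by viewing the
  derivative of the inverse as the solution of a linear system with smooth coefficients.\<close>

lemma C_k_on_cong:
  assumes "open S" and "\<And>x. x \<in> S \<Longrightarrow> f x = g x" and "C_k_on k S f"
  shows "C_k_on k S g"
  using assms(2,3)
proof (induction k arbitrary: f g)
  case 0
  then show ?case by (simp cong: continuous_on_cong)
next
  case (Suc k)
  have D: "(g has_derivative frechet_derivative f (at x)) (at x)" if "x \<in> S" for x
  proof (rule has_derivative_transform_within_open)
    show "(f has_derivative frechet_derivative f (at x)) (at x)"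
      using Suc.prems(2) that frechet_derivative_works by auto
  qed (use assms(1) that Suc.prems(1) in auto)
  have E: "frechet_derivative f (at x) = frechet_derivative g (at x)" if "x \<in> S" for x
    using frechet_derivative_at[OF D[OF that]] .
  have "C_k_on k S (\<lambda>x. frechet_derivative g (at x) v)" for v
    by (rule Suc.IH[of "\<lambda>x. frechet_derivative f (at x) v"]) (use E Suc.prems(2) in auto)
  moreover have "\<forall>x\<in>S. g differentiable (at x)"
    using D differentiable_def by blast
  ultimately show ?case by simp
qed

text \<open>\<open>frechet_derivative\<close> is defined by choice. Here a derivative is supplied
  explicitly as \<open>D\<close> and identified with the chosen one by uniqueness; the closure
  properties under sums, products and composition are inductions through this rule.\<close>

lemma C_k_on_SucI:
  assumes "open S" and D: "\<And>x. x \<in> S \<Longrightarrow> (f has_derivative D x) (at x)"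
    and "\<And>v. C_k_on k S (\<lambda>x. D x v)"
  shows "C_k_on (Suc k) S f"
proof -
  have "C_k_on k S (\<lambda>x. frechet_derivative f (at x) v)" for v
    by (rule C_k_on_cong[OF assms(1) _ assms(3)[of v]]) (simp add: frechet_derivative_at[OF D])
  moreover have "f differentiable (at x)" if "x \<in> S" for x
    using D[OF that] by (rule differentiableI)
  ultimately show ?thesis by simp
qed

lemma C_k_on_SucD:
  assumes "C_k_on (Suc k) S f" and "x \<in> S"
  shows "(f has_derivative frechet_derivative f (at x)) (at x)"
  using assms frechet_derivative_works by auto

lemma C_k_on_Suc_imp: "C_k_on (Suc k) S f \<Longrightarrow> C_k_on k S f"
proof (induction k arbitrary: f)
  case 0
  then show ?case
    by (auto intro!: continuous_at_imp_continuous_on differentiable_imp_continuous_within)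
next
  case (Suc k)
  show ?case using Suc.prems Suc.IH by (subst C_k_on.simps(2)) (auto simp del: C_k_on.simps(2) simp: C_k_on.simps(2)[of "Suc k" S f])
qed

lemma C_k_on_subset: "C_k_on k S f \<Longrightarrow> T \<subseteq> S \<Longrightarrow> C_k_on k T f"
proof (induction k arbitrary: f)
  case 0
  then show ?case by (auto intro: continuous_on_subset)
qed auto

lemma C_k_on_const [simp]: "C_k_on k S (\<lambda>x. c)"
  by (induction k arbitrary: c) (simp_all add: frechet_derivative_const)

lemma C_k_on_linear:
  assumes "open S" "bounded_linear L"
  shows "C_k_on k S L"
proof (cases k)
  case 0
  then show ?thesis using assms linear_continuous_on by simp
next
  case (Suc n)
  then show ?thesis
    using C_k_on_SucI[OF assms(1), of L "\<lambda>x. L" n] bounded_linear_imp_has_derivative[OF assms(2)] by simp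
qed

lemma C_k_on_bounded_linear:
  assumes "open S" "bounded_linear L" "C_k_on k S f"
  shows "C_k_on k S (\<lambda>x. L (f x))"
  using assms(3)
proof (induction k arbitrary: f)
  case 0
  then show ?case using assms(2) by (simp add: bounded_linear.continuous_on)
next
  case (Suc k)
  show ?case
  proof (rule C_k_on_SucI[OF assms(1)])
    show "((\<lambda>x. L (f x)) has_derivative (\<lambda>v. L (frechet_derivative f (at x) v))) (at x)" if "x \<in> S" for x
      by (rule bounded_linear.has_derivative[OF assms(2) C_k_on_SucD[OF Suc.prems that]])
  qed (use Suc in auto)
qed

lemma C_k_on_add:
  assumes "open S" "C_k_on k S f" "C_k_on k S g"
  shows "C_k_on k S (\<lambda>x. f x + g x)"
  using assms(2,3)
proof (induction k arbitrary: f g)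
  case 0
  then show ?case by (simp add: continuous_on_add)
next
  case (Suc k)
  show ?case
  proof (rule C_k_on_SucI[OF assms(1)])
    show "((\<lambda>x. f x + g x) has_derivative
        (\<lambda>v. frechet_derivative f (at x) v + frechet_derivative g (at x) v)) (at x)" if "x \<in> S" for x
      by (rule has_derivative_add[OF C_k_on_SucD[OF Suc.prems(1) that] C_k_on_SucD[OF Suc.prems(2) that]])
  qed (use Suc in auto)
qed

lemma C_k_on_bilinear:
  assumes "open S" "bounded_bilinear B" "C_k_on k S f" "C_k_on k S g"
  shows "C_k_on k S (\<lambda>x. B (f x) (g x))"
  using assms(3,4)
proof (induction k arbitrary: f g)
  case 0
  then show ?case using assms(2) by (simp add: bounded_bilinear.continuous_on)
next
  case (Suc k)
  show ?case
  proof (rule C_k_on_SucI[OF assms(1)])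
    show "((\<lambda>x. B (f x) (g x)) has_derivative (\<lambda>v. B (f x) (frechet_derivative g (at x) v)
        + B (frechet_derivative f (at x) v) (g x))) (at x)" if "x \<in> S" for x
      by (rule bounded_bilinear.FDERIV[OF assms(2) C_k_on_SucD[OF Suc.prems(1) that] C_k_on_SucD[OF Suc.prems(2) that]])
  next
    have "C_k_on k S f" "C_k_on k S g"
      using Suc.prems C_k_on_Suc_imp by blast+
    then show "C_k_on k S (\<lambda>x. B (f x) (frechet_derivative g (at x) v) + B (frechet_derivative f (at x) v) (g x))" for v
      using Suc.prems by (intro C_k_on_add[OF assms(1)] Suc.IH) auto
  qed
qed

lemma C_k_on_sum:
  assumes "open S" "\<And>i. i \<in> A \<Longrightarrow> C_k_on k S (f i)"
  shows "C_k_on k S (\<lambda>x. \<Sum>i\<in>A. f i x)"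
proof (cases "finite A")
  case True
  then show ?thesis using assms(2)
    by (induction A rule: finite_induct) (auto intro!: C_k_on_add[OF assms(1)])
qed simp

lemma C_k_on_componentwise:
  fixes f :: "'a::euclidean_space \<Rightarrow> 'b::euclidean_space"
  assumes "open S" "\<And>i. i \<in> Basis \<Longrightarrow> C_k_on k S (\<lambda>x. f x \<bullet> i)"
  shows "C_k_on k S f"
proof -
  have "C_k_on k S (\<lambda>x. \<Sum>i\<in>Basis. (f x \<bullet> i) *\<^sub>R i)"
    by (intro C_k_on_sum C_k_on_bounded_linear[OF _ bounded_linear_scaleR_left] assms)
  then show ?thesis by (simp add: euclidean_representation)
qed

lemma linear_basis_expansion:
  fixes x :: "'a::euclidean_space"
  assumes "linear A"
  shows "A x = (\<Sum>i\<in>Basis. (x \<bullet> i) *\<^sub>R A i)"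
proof -
  have "A x = A (\<Sum>i\<in>Basis. (x \<bullet> i) *\<^sub>R i)" by (simp add: euclidean_representation)
  also have "\<dots> = (\<Sum>i\<in>Basis. (x \<bullet> i) *\<^sub>R A i)"
    using assms by (simp add: linear_sum linear_scale)
  finally show ?thesis .
qed

text \<open>The chain rule applies the derivative of \<open>g\<close> at \<open>f x\<close> to a
  vector that itself depends on \<open>x\<close>. Expanding this vector in the basis leaves scalar
  functions times partial derivatives of \<open>g\<close> in fixed directions, composed with
  \<open>f\<close>; to these the induction hypothesis applies, since \<open>g\<close> is arbitrary
  in it.\<close>

lemma C_k_on_compose:
  assumes "open S" "open T" "f ` S \<subseteq> T" "C_k_on k S f" "C_k_on k T g"
  shows "C_k_on k S (\<lambda>x. g (f x))"
  using assms(4,5)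
proof (induction k arbitrary: g)
  case 0
  then show ?case using assms(3) by (auto intro: continuous_on_compose2)
next
  case (Suc k)
  show ?case
  proof (rule C_k_on_SucI[OF assms(1)])
    fix x assume x: "x \<in> S"
    have f: "(f has_derivative frechet_derivative f (at x)) (at x)"
      and g: "(g has_derivative frechet_derivative g (at (f x))) (at (f x))"
      using C_k_on_SucD[OF Suc.prems(1) x] C_k_on_SucD[OF Suc.prems(2)] x assms(3) by auto
    have lin: "linear (frechet_derivative g (at (f x)))"
      using g has_derivative_linear by blast
    show "((\<lambda>x. g (f x)) has_derivative (\<lambda>v. \<Sum>i\<in>Basis. (frechet_derivative f (at x) v \<bullet> i) *\<^sub>R
        frechet_derivative g (at (f x)) i)) (at x)"
      using has_derivative_compose[OF f g] by (subst linear_basis_expansion[OF lin, symmetric])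
  next
    have "C_k_on k S f" using Suc.prems C_k_on_Suc_imp by blast
    then show "C_k_on k S (\<lambda>x. \<Sum>i\<in>Basis. (frechet_derivative f (at x) v \<bullet> i) *\<^sub>R
        frechet_derivative g (at (f x)) i)" for v
      using Suc.prems
      by (intro C_k_on_sum C_k_on_bilinear[OF _ bounded_bilinear_scaleR] Suc.IH
          C_k_on_bounded_linear[OF _ bounded_linear_inner_left] assms) auto
  qed
qed

lemma smooth_onD: "smooth_on S f \<Longrightarrow> C_k_on k S f"
  by (simp add: smooth_on_def)

lemma smooth_on_subset: "smooth_on S f \<Longrightarrow> T \<subseteq> S \<Longrightarrow> smooth_on T f"
  unfolding smooth_on_def using C_k_on_subset by blast

lemma smooth_on_const [simp]: "smooth_on S (\<lambda>x. c)"
  by (simp add: smooth_on_def)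

lemma smooth_on_linear: "open S \<Longrightarrow> bounded_linear L \<Longrightarrow> smooth_on S L"
  by (simp add: smooth_on_def C_k_on_linear)

lemma smooth_on_bounded_linear:
  "open S \<Longrightarrow> bounded_linear L \<Longrightarrow> smooth_on S f \<Longrightarrow> smooth_on S (\<lambda>x. L (f x))"
  by (simp add: smooth_on_def C_k_on_bounded_linear)

lemma smooth_on_add:
  "open S \<Longrightarrow> smooth_on S f \<Longrightarrow> smooth_on S g \<Longrightarrow> smooth_on S (\<lambda>x. f x + g x)"
  by (simp add: smooth_on_def C_k_on_add)

lemma smooth_on_bilinear:
  "open S \<Longrightarrow> bounded_bilinear B \<Longrightarrow> smooth_on S f \<Longrightarrow> smooth_on S g
    \<Longrightarrow> smooth_on S (\<lambda>x. B (f x) (g x))"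
  by (simp add: smooth_on_def C_k_on_bilinear)

lemma smooth_on_diff:
  fixes f g :: "'a::euclidean_space \<Rightarrow> 'b::euclidean_space"
  assumes "open S" "smooth_on S f" "smooth_on S g"
  shows "smooth_on S (\<lambda>x. f x - g x)"
  using smooth_on_add[OF assms(1,2) smooth_on_bounded_linear[OF assms(1) _ assms(3), of uminus]]
  by (simp add: bounded_linear_minus[OF bounded_linear_ident])

lemma smooth_on_componentwise:
  fixes f :: "'a::euclidean_space \<Rightarrow> 'b::euclidean_space"
  shows "open S \<Longrightarrow> (\<And>i. i \<in> Basis \<Longrightarrow> smooth_on S (\<lambda>x. f x \<bullet> i)) \<Longrightarrow> smooth_on S f"
  unfolding smooth_on_def using C_k_on_componentwise by blast

lemma smooth_on_compose:
  "open S \<Longrightarrow> open T \<Longrightarrow> f ` S \<subseteq> T \<Longrightarrow> smooth_on S f \<Longrightarrow> smooth_on T g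
    \<Longrightarrow> smooth_on S (\<lambda>x. g (f x))"
  unfolding smooth_on_def using C_k_on_compose by blast

lemma smooth_on_imp_continuous_on: "smooth_on S f \<Longrightarrow> continuous_on S f"
  using smooth_onD[of S f 0] by simp

lemma smooth_on_has_derivative:
  "smooth_on S f \<Longrightarrow> x \<in> S \<Longrightarrow> (f has_derivative frechet_derivative f (at x)) (at x)"
  using C_k_on_SucD[OF smooth_onD] .

lemma smooth_on_frechet_derivative:
  "smooth_on S f \<Longrightarrow> smooth_on S (\<lambda>x. frechet_derivative f (at x) v)"
  unfolding smooth_on_def by (metis C_k_on.simps(2))

lemma smooth_on_Pair:
  fixes f :: "'a::euclidean_space \<Rightarrow> 'b::euclidean_space" and g :: "'a \<Rightarrow> 'c::euclidean_space"
  assumes "open S" "smooth_on S f" "smooth_on S g"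
  shows "smooth_on S (\<lambda>x. (f x, g x))"
proof -
  have "smooth_on S (\<lambda>x. (f x, 0) + (0, g x))"
    by (intro smooth_on_add smooth_on_bounded_linear[of S "\<lambda>x. (x, 0)"]
        smooth_on_bounded_linear[of S "\<lambda>x. (0, x)"] assms)
      (auto intro!: bounded_linear_Pair bounded_linear_ident bounded_linear_zero)
  then show ?thesis by simp
qed

lemma smooth_on_vector3:
  assumes "open S" "smooth_on S f" "smooth_on S g" "smooth_on S h"
  shows "smooth_on S (\<lambda>x. vector [f x, g x, h x] :: real^3)"
proof (rule smooth_on_componentwise[OF assms(1)])
  fix i :: "real^3" assume "i \<in> Basis"
  then obtain j where "i = axis j 1" by (auto simp: Basis_vec_def)
  then show "smooth_on S (\<lambda>x. (vector [f x, g x, h x] :: real^3) \<bullet> i)"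
    using exhaust_3[of j] assms by (auto simp: inner_axis)
qed


section \<open>The smooth inverse function theorem\<close>

text \<open>The sum over the basis stands in for the operator norm, because regularity of a family
  \<open>A\<close> is only ever assumed of the vectors \<open>A x i\<close>.\<close>

lemma linear_family_diff_bound:
  fixes A :: "'a::euclidean_space \<Rightarrow> 'b::euclidean_space \<Rightarrow> 'c::euclidean_space"
  assumes "linear (A x)" "linear (A y)"
  shows "norm (A x z - A y z) \<le> norm z * (\<Sum>i\<in>Basis. norm (A x i - A y i))"
proof -
  have "A x z - A y z = (\<Sum>i\<in>Basis. (z \<bullet> i) *\<^sub>R (A x i - A y i))"
    using linear_basis_expansion[OF assms(1), of z] linear_basis_expansion[OF assms(2), of z]
    by (simp add: scaleR_diff_right sum_subtractf)
  also have "norm \<dots> \<le> (\<Sum>i\<in>Basis. norm z * norm (A x i - A y i))"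
    by (rule sum_norm_le) (auto intro!: mult_right_mono simp: Basis_le_norm)
  finally show ?thesis by (simp add: sum_distrib_left)
qed

text \<open>Injectivity is stable: if \<open>A x0\<close> is bounded below by \<open>B\<close>, a
  perturbation of size less than \<open>B / 2\<close> leaves the bound \<open>B / 2\<close>,
  uniformly for \<open>x\<close> near \<open>x0\<close>.\<close>

lemma linear_family_bounded_below:
  fixes A :: "'a::euclidean_space \<Rightarrow> 'b::euclidean_space \<Rightarrow> 'b"
  assumes "open S" "x0 \<in> S" and lin: "\<And>x. x \<in> S \<Longrightarrow> linear (A x)"
    and inj: "inj (A x0)" and cont: "\<And>i. continuous_on S (\<lambda>x. A x i)"
  obtains c where "c > 0" "\<forall>\<^sub>F x in at x0. x \<in> S \<and> (\<forall>z. c * norm z \<le> norm (A x z))"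
    "((\<lambda>x. \<Sum>i\<in>Basis. norm (A x i - A x0 i)) \<longlongrightarrow> 0) (at x0)"
proof -
  obtain B where B: "B > 0" "\<And>z. B * norm z \<le> norm (A x0 z)"
    using linear_inj_bounded_below_pos[OF lin[OF assms(2)] inj] by blast
  have "((\<lambda>x. A x i) \<longlongrightarrow> A x0 i) (at x0)" for i
    using cont[of i] assms(1,2) by (simp add: continuous_on_eq_continuous_at isCont_def)
  then have lim: "((\<lambda>x. \<Sum>i\<in>Basis. norm (A x i - A x0 i)) \<longlongrightarrow> 0) (at x0)"
    by (auto intro!: tendsto_eq_intros)
  have "\<forall>\<^sub>F x in at x0. (\<Sum>i\<in>Basis. norm (A x i - A x0 i)) < B / 2"
    using order_tendstoD(2)[OF lim, of "B/2"] B(1) by simp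
  moreover have "\<forall>\<^sub>F x in at x0. x \<in> S"
    using eventually_at_topological assms(1,2) by blast
  ultimately have "\<forall>\<^sub>F x in at x0. x \<in> S \<and> (\<forall>z. B / 2 * norm z \<le> norm (A x z))"
  proof eventually_elim
    case (elim x)
    have "B / 2 * norm z \<le> norm (A x z)" for z
    proof -
      have "norm (A x z - A x0 z) \<le> norm z * (B / 2)"
        using linear_family_diff_bound[OF lin[OF elim(2)] lin[OF assms(2)], of z] elim(1)
        by (smt (verit) mult_left_mono norm_ge_zero)
      then show ?thesis
        using B(2)[of z] norm_triangle_ineq2[of "A x0 z" "A x0 z - A x z"]
        by (simp add: norm_minus_commute algebra_simps)
    qed
    with elim show ?case by blast
  qed
  then show ?thesis using that[of "B/2"] B(1) lim by simp
qed

text \<open>Differentiating \<open>A w = b\<close> gives a linear system with the same matrix for the derivative of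
  \<open>w\<close>; this drives the induction.\<close>

lemma C_k_on_solve:
  fixes A :: "'a::euclidean_space \<Rightarrow> 'b::euclidean_space \<Rightarrow> 'b"
  assumes "open S" and lin: "\<And>x. x \<in> S \<Longrightarrow> linear (A x)"
    and inj: "\<And>x. x \<in> S \<Longrightarrow> inj (A x)" and "\<And>i. C_k_on k S (\<lambda>x. A x i)"
    and "C_k_on k S b" and "\<And>x. x \<in> S \<Longrightarrow> A x (w x) = b x"
  shows "C_k_on k S w"
  using assms(4-6)
proof (induction k arbitrary: b w)
  case 0
  have "isCont w x0" if x0: "x0 \<in> S" for x0
  proof -
    obtain c where c: "c > 0" "\<forall>\<^sub>F x in at x0. x \<in> S \<and> (\<forall>z. c * norm z \<le> norm (A x z))"
      by (rule linear_family_bounded_below[of S x0 A]) (use assms(1) x0 lin inj[OF x0] 0(1) in auto)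
    have "isCont (\<lambda>x. A x (w x0)) x0" "isCont b x0"
      using 0(1,2) assms(1) x0 by (auto simp: continuous_on_eq_continuous_at)
    then have "((\<lambda>x. b x - A x (w x0)) \<longlongrightarrow> b x0 - A x0 (w x0)) (at x0)"
      by (intro tendsto_diff) (auto simp: isCont_def)
    then have "((\<lambda>x. norm (b x - A x (w x0)) / c) \<longlongrightarrow> 0) (at x0)"
      using 0(3)[OF x0] by (intro tendsto_divide_zero tendsto_norm_zero) simp
    moreover have "\<forall>\<^sub>F x in at x0. norm (w x - w x0) \<le> norm (b x - A x (w x0)) / c"
      using c(2)
    proof eventually_elim
      case (elim x)
      have "A x (w x - w x0) = b x - A x (w x0)"
        using linear_diff[OF lin] elim 0(3) by simp
      then show ?case using elim c(1) by (metis mult.commute pos_le_divide_eq)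
    qed
    ultimately have "((\<lambda>x. w x - w x0) \<longlongrightarrow> 0) (at x0)"
      by (rule Lim_null_comparison[rotated])
    then show ?thesis unfolding isCont_def by (rule LIM_zero_cancel)
  qed
  then show ?case by (simp add: continuous_at_imp_continuous_on)
next
  case (Suc k)
  have Ck: "C_k_on k S w"
    using Suc.IH[of b w] Suc.prems C_k_on_Suc_imp by blast
  \<comment> \<open>The derivative of \<open>w\<close> along \<open>u\<close> must satisfy
    \<open>A x (w' u) = b' u - (A' u) (w x)\<close>. This is the right-hand side, with
    \<open>w x\<close> expanded in the basis so that only derivatives of the vectors
    \<open>A x i\<close> occur.\<close>
  define r where "r x u = frechet_derivative b (at x) u -
      (\<Sum>i\<in>Basis. (w x \<bullet> i) *\<^sub>R frechet_derivative (\<lambda>y. A y i) (at x) u)" for x u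
  define D where "D x u = inv (A x) (r x u)" for x u
  have bij: "bij (A x)" if "x \<in> S" for x
    using inj[OF that] lin[OF that] eucl.linear_inj_imp_surj bij_def by blast
  have AD: "A x (D x u) = r x u" if "x \<in> S" for x u
    using bij[OF that] unfolding D_def by (simp add: bij_is_surj surj_f_inv_f)
  show ?case
  proof (rule C_k_on_SucI[OF assms(1)])
    fix x0 assume x0: "x0 \<in> S"
    have contA: "continuous_on S (\<lambda>x. A x i)" for i
      using Suc.prems(1)[of i] by (metis C_k_on.simps(2) continuous_at_imp_continuous_on differentiable_imp_continuous_within)
    obtain c where c: "c > 0" "\<forall>\<^sub>F x in at x0. x \<in> S \<and> (\<forall>z. c * norm z \<le> norm (A x z))"
      and e: "((\<lambda>x. \<Sum>i\<in>Basis. norm (A x i - A x0 i)) \<longlongrightarrow> 0) (at x0)"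
      by (rule linear_family_bounded_below[of S x0 A]) (use assms(1) x0 lin inj[OF x0] contA in auto)
    have dAi: "((\<lambda>x. A x i) has_derivative frechet_derivative (\<lambda>y. A y i) (at x0)) (at x0)" for i
      using C_k_on_SucD[OF Suc.prems(1) x0] .
    have "((\<lambda>x. b x - (\<Sum>i\<in>Basis. (w x0 \<bullet> i) *\<^sub>R A x i)) has_derivative r x0) (at x0)"
      unfolding r_def
      by (intro has_derivative_diff has_derivative_sum has_derivative_scaleR_right dAi
          C_k_on_SucD[OF Suc.prems(2) x0])
    then have dr: "((\<lambda>x. b x - A x (w x0)) has_derivative r x0) (at x0)"
      by (rule has_derivative_transform_within_open[OF _ assms(1) x0])
        (use lin linear_basis_expansion in metis)
    have blr: "bounded_linear (r x0)" using dr has_derivative_bounded_linear by blast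
    have linD: "linear (D x0)"
      unfolding D_def
      using linear_compose[OF bounded_linear.linear[OF blr] inj_linear_imp_inv_linear[OF lin[OF x0] inj[OF x0]]]
      by (simp add: o_def)
    then obtain K where K: "\<And>h. norm (D x0 h) \<le> K * norm h"
      using linear_bounded by blast
    let ?e = "\<lambda>x. \<Sum>i\<in>Basis. norm (A x i - A x0 i)"
    let ?q = "\<lambda>x. norm (b x - A x (w x0) - (b x0 - A x0 (w x0)) - r x0 (x - x0)) / norm (x - x0)"
    have "((\<lambda>x. (?q x + K * ?e x) / c) \<longlongrightarrow> 0) (at x0)"
      using dr e by (intro tendsto_divide_zero tendsto_add_zero tendsto_mult_right_zero)
        (simp_all only: has_derivative_iff_norm)
    moreover have "\<forall>\<^sub>F x in at x0. norm (norm (w x - w x0 - D x0 (x - x0)) / norm (x - x0))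
        \<le> (?q x + K * ?e x) / c"
      using c(2) eventually_neq_at_within[of x0 x0 UNIV]
    proof eventually_elim
      case (elim x)
      have pos: "norm (x - x0) > 0" using elim(2) by auto
      have xS: "x \<in> S" using elim(1) by blast
      let ?h = "x - x0"
      \<comment> \<open>Applying \<open>A x\<close>, not \<open>A x0\<close>, brings in
        \<open>b x\<close> directly and lets the uniform lower bound \<open>c\<close> recover the
        remainder of \<open>w\<close>. The price is \<open>A x - A x0\<close> on
        \<open>D x0 ?h\<close>, which is small compared with \<open>?h\<close>.\<close>
      have "A x (w x - w x0 - D x0 ?h) = (b x - A x (w x0) - (b x0 - A x0 (w x0)) - r x0 ?h)
          - (A x (D x0 ?h) - A x0 (D x0 ?h))"
        using linear_diff[OF lin[OF xS]] Suc.prems(3)[OF xS] Suc.prems(3)[OF x0] AD[OF x0] by simp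
      then have "c * norm (w x - w x0 - D x0 ?h) \<le>
          norm (b x - A x (w x0) - (b x0 - A x0 (w x0)) - r x0 ?h) + norm (A x (D x0 ?h) - A x0 (D x0 ?h))"
        using elim(1) norm_triangle_ineq4 by (metis order_trans)
      also have "norm (A x (D x0 ?h) - A x0 (D x0 ?h)) \<le> norm (D x0 ?h) * ?e x"
        by (rule linear_family_diff_bound[OF lin[OF xS] lin[OF x0]])
      also have "\<dots> \<le> (K * norm ?h) * ?e x"
        by (intro mult_right_mono K sum_nonneg) auto
      finally have "norm (w x - w x0 - D x0 ?h) * c / norm ?h \<le>
         (norm (b x - A x (w x0) - (b x0 - A x0 (w x0)) - r x0 ?h) + K * norm ?h * ?e x) / norm ?h"
        using pos by (intro divide_right_mono) (auto simp: mult.commute)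
      also have "\<dots> = ?q x + K * ?e x"
        using pos by (simp add: add_divide_distrib)
      finally show ?case using c(1) by (simp add: pos_le_divide_eq)
    qed
    ultimately have "((\<lambda>x. norm (w x - w x0 - D x0 (x - x0)) / norm (x - x0)) \<longlongrightarrow> 0) (at x0)"
      by (rule Lim_null_comparison[rotated])
    then show "(w has_derivative D x0) (at x0)"
      using linD by (simp add: has_derivative_iff_norm linear_conv_bounded_linear)
  next
    fix v
    have "C_k_on k S (\<lambda>x. frechet_derivative b (at x) v + (- 1) *\<^sub>R
        (\<Sum>i\<in>Basis. (w x \<bullet> i) *\<^sub>R frechet_derivative (\<lambda>y. A y i) (at x) v))"
      using Suc.prems(1,2)
      by (intro C_k_on_add C_k_on_bounded_linear[OF _ bounded_linear_scaleR_right] C_k_on_sum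
          C_k_on_bilinear[OF _ bounded_bilinear_scaleR] assms(1)
          C_k_on_bounded_linear[OF _ bounded_linear_inner_left] Ck) auto
    then have "C_k_on k S (\<lambda>x. r x v)"
      by (simp add: r_def)
    then show "C_k_on k S (\<lambda>x. D x v)"
      using Suc.IH[of "\<lambda>x. r x v" "\<lambda>x. D x v"] AD Suc.prems(1) C_k_on_Suc_imp by blast
  qed
qed


text \<open>The C^1 theorem gives the inverse \<open>g\<close> with derivative
  \<open>inv (?D (g y))\<close>. The map \<open>x \<mapsto> inv (?D x) v\<close> is C^k for every
  \<open>k\<close> by \<open>C_k_on_solve\<close>, so composing it with a C^k map \<open>g\<close>
  makes the derivative C^k and \<open>g\<close> itself C^(k+1).\<close>

theorem smooth_inverse_function_theorem:
  fixes f :: "'a::euclidean_space \<Rightarrow> 'a"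
  assumes "open S" and sm: "smooth_on S f" and "x0 \<in> S" and inj: "inj (frechet_derivative f (at x0))"
  obtains U V g where "open U" "U \<subseteq> S" "x0 \<in> U" "open V" "f x0 \<in> V" "homeomorphism U V f g"
    "smooth_on V g"
proof -
  let ?D = "\<lambda>x. frechet_derivative f (at x)"
  define f' where "f' x = Blinfun (?D x)" for x
  have D: "(f has_derivative ?D x) (at x)" if "x \<in> S" for x
    using smooth_on_has_derivative[OF sm that] .
  have bl: "bounded_linear (?D x)" if "x \<in> S" for x
    using has_derivative_bounded_linear[OF D[OF that]] .
  have f': "blinfun_apply (f' x) = ?D x" if "x \<in> S" for x
    unfolding f'_def using bl[OF that] by (simp add: bounded_linear_Blinfun_apply)
  have cont: "continuous_on S f'"
  proof (rule continuous_on_blinfun_componentwise)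
    fix i :: 'a
    show "continuous_on S (\<lambda>x. blinfun_apply (f' x) i)"
      using smooth_on_imp_continuous_on[OF smooth_on_frechet_derivative[OF sm, of i]]
      by (simp add: f' cong: continuous_on_cong)
  qed
  have lin0: "linear (?D x0)" using bl[OF assms(3)] bounded_linear.linear by blast
  have blinv: "bounded_linear (inv (?D x0))"
    using inj_linear_imp_inv_linear[OF lin0 inj] linear_conv_bounded_linear by blast
  have "Blinfun (inv (?D x0)) o\<^sub>L f' x0 = id_blinfun"
    by (rule blinfun_eqI) (simp add: f' assms(3) bounded_linear_Blinfun_apply[OF blinv] inv_f_f[OF inj])
  then obtain U V g g' where UV: "open U" "U \<subseteq> S" "x0 \<in> U" "open V" "f x0 \<in> V" "homeomorphism U V f g"
    and g: "\<And>y. y \<in> V \<Longrightarrow> (g has_derivative (g' y)) (at y)"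
      "\<And>y. y \<in> V \<Longrightarrow> g' y = inv (blinfun_apply (f'(g y)))"
      "\<And>y. y \<in> V \<Longrightarrow> bij (blinfun_apply (f'(g y)))"
    using inverse_function_theorem[OF assms(1) _ cont assms(3)] D f' by metis
  have gU: "g ` V \<subseteq> U" and gV: "\<And>x. x \<in> U \<Longrightarrow> f x \<in> V" "\<And>x. x \<in> U \<Longrightarrow> g (f x) = x"
    using UV(6) by (auto simp: homeomorphism_def)
  have bij: "bij (?D x)" if "x \<in> U" for x
    using g(3)[OF gV(1)[OF that]] gV(2)[OF that] f'[of x] that UV(2) by auto
  have s: "C_k_on k U (\<lambda>x. inv (?D x) v)" for k v
  proof (rule C_k_on_solve[where A = ?D and b = "\<lambda>x. v"])
    show "linear (?D x)" if "x \<in> U" for x using bl that UV(2) bounded_linear.linear by blast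
    show "inj (?D x)" if "x \<in> U" for x using bij[OF that] bij_is_inj by blast
    show "C_k_on k U (\<lambda>x. ?D x i)" for i
      using smooth_onD[OF smooth_on_frechet_derivative[OF sm]] C_k_on_subset UV(2) by blast
    show "?D x (inv (?D x) v) = v" if "x \<in> U" for x
      using bij[OF that] by (simp add: bij_is_surj surj_f_inv_f)
  qed (use UV in auto)
  have "C_k_on k V g" for k
  proof (induction k)
    case 0
    show ?case using UV(6) by (simp add: homeomorphism_def)
  next
    case (Suc k)
    have "C_k_on k V (\<lambda>y. g' y v)" for v
    proof (rule C_k_on_cong[OF UV(4)])
      show "C_k_on k V (\<lambda>y. inv (?D (g y)) v)"
        by (rule C_k_on_compose[OF UV(4,1) gU Suc s])
      show "inv (?D (g y)) v = g' y v" if "y \<in> V" for y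
        using g(2)[OF that] f'[of "g y"] gU that UV(2) by (metis image_subset_iff subsetD)
    qed
    then show ?case using C_k_on_SucI[OF UV(4) g(1)] by blast
  qed
  then show ?thesis using that UV by (simp add: smooth_on_def)
qed


section \<open>Symmetry of second derivatives\<close>

lemma has_vector_derivative_along_line:
  fixes G :: "'a::euclidean_space \<Rightarrow> 'b::euclidean_space"
  assumes "(G has_derivative D) (at (z + t *\<^sub>R v))"
  shows "((\<lambda>t. G (z + t *\<^sub>R v)) has_vector_derivative D v) (at t)"
proof -
  have "((\<lambda>t. G (z + t *\<^sub>R v)) has_derivative (\<lambda>h. D (h *\<^sub>R v))) (at t)"
    by (rule has_derivative_compose[of "\<lambda>t. z + t *\<^sub>R v" "\<lambda>h. h *\<^sub>R v" t UNIV G D])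
      (auto intro!: derivative_eq_intros assms)
  then show ?thesis
    using has_derivative_linear[OF assms] by (simp add: has_vector_derivative_def linear_scale)
qed

lemma has_real_derivative_along_line:
  fixes f :: "'a::euclidean_space \<Rightarrow> real"
  assumes "(f has_derivative D) (at (x + s *\<^sub>R v))"
  shows "((\<lambda>s. f (x + s *\<^sub>R v)) has_real_derivative D v) (at s)"
  unfolding has_real_derivative_iff_has_vector_derivative
  by (rule has_vector_derivative_along_line[OF assms])

text \<open>The second difference is symmetric in \<open>v\<close> and \<open>w\<close>, whereas the
  right-hand side differentiates first along \<open>v\<close> and then along \<open>w\<close>.
  Exchanging the two directions will give the symmetry of second derivatives.\<close>

lemma second_difference_mvt:
  fixes f :: "'a::euclidean_space \<Rightarrow> real"
  assumes "smooth_on S f" "h > 0"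
    and S: "\<And>s t. 0 \<le> s \<Longrightarrow> s \<le> h \<Longrightarrow> 0 \<le> t \<Longrightarrow> t \<le> h \<Longrightarrow> x + s *\<^sub>R v + t *\<^sub>R w \<in> S"
  obtains s t where "0 < s" "s < h" "0 < t" "t < h"
    "f (x + h *\<^sub>R v + h *\<^sub>R w) - f (x + h *\<^sub>R v) - f (x + h *\<^sub>R w) + f x
      = h * h * frechet_derivative (\<lambda>y. frechet_derivative f (at y) v) (at (x + s *\<^sub>R v + t *\<^sub>R w)) w"
proof -
  let ?g = "\<lambda>y. frechet_derivative f (at y) v"
  let ?\<phi> = "\<lambda>s. f ((x + h *\<^sub>R w) + s *\<^sub>R v) - f (x + s *\<^sub>R v)"
  have d1: "(?\<phi> has_real_derivative ?g ((x + h *\<^sub>R w) + s *\<^sub>R v) - ?g (x + s *\<^sub>R v)) (at s)"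
    if "0 \<le> s" "s \<le> h" for s
    using S[OF that, of h] S[OF that, of 0] assms(2)
    by (intro DERIV_diff has_real_derivative_along_line smooth_on_has_derivative[OF assms(1)])
      (auto simp: algebra_simps)
  then obtain s where s: "0 < s" "s < h"
    "?\<phi> h - ?\<phi> 0 = (h - 0) * (?g ((x + h *\<^sub>R w) + s *\<^sub>R v) - ?g (x + s *\<^sub>R v))"
    using MVT2[OF assms(2), of ?\<phi> "\<lambda>s. ?g ((x + h *\<^sub>R w) + s *\<^sub>R v) - ?g (x + s *\<^sub>R v)", OF d1] by blast
  have d2: "((\<lambda>t. ?g ((x + s *\<^sub>R v) + t *\<^sub>R w)) has_real_derivative
      frechet_derivative ?g (at ((x + s *\<^sub>R v) + t *\<^sub>R w)) w) (at t)" if "0 \<le> t" "t \<le> h" for t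
    using S[of s t] s that
    by (intro has_real_derivative_along_line
        smooth_on_has_derivative[OF smooth_on_frechet_derivative[OF assms(1)]]) auto
  then obtain t where t: "0 < t" "t < h"
    "?g ((x + s *\<^sub>R v) + h *\<^sub>R w) - ?g ((x + s *\<^sub>R v) + 0 *\<^sub>R w)
      = (h - 0) * frechet_derivative ?g (at ((x + s *\<^sub>R v) + t *\<^sub>R w)) w"
    using MVT2[OF assms(2), of "\<lambda>t. ?g ((x + s *\<^sub>R v) + t *\<^sub>R w)"
        "\<lambda>t. frechet_derivative ?g (at ((x + s *\<^sub>R v) + t *\<^sub>R w)) w", OF d2] by blast
  show ?thesis using that[OF s(1,2) t(1,2)] s(3) t(3) by (simp add: algebra_simps)
qed

lemma smooth_on_second_derivative_symmetric:
  fixes f :: "'a::euclidean_space \<Rightarrow> real"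
  assumes "open S" "smooth_on S f" "x \<in> S"
  shows "frechet_derivative (\<lambda>y. frechet_derivative f (at y) v) (at x) w
    = frechet_derivative (\<lambda>y. frechet_derivative f (at y) w) (at x) v" (is "?A x = ?B x")
proof -
  obtain e where e: "e > 0" "ball x e \<subseteq> S" using assms(1,3) open_contains_ball by blast
  \<comment> \<open>The summand 1 keeps \<open>K\<close> positive when \<open>v\<close> and
    \<open>w\<close> both vanish.\<close>
  define K where "K = norm v + norm w + 1"
  have K: "K > 0" by (simp add: K_def add_nonneg_pos)
  have near: "norm (s *\<^sub>R v + t *\<^sub>R w) \<le> h * K" if "0 \<le> s" "s \<le> h" "0 \<le> t" "t \<le> h" for s t h
  proof -
    have "norm (s *\<^sub>R v + t *\<^sub>R w) \<le> s * norm v + t * norm w"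
      using norm_triangle_ineq[of "s *\<^sub>R v" "t *\<^sub>R w"] that by simp
    also have "\<dots> \<le> h * norm v + h * norm w"
      using that by (intro add_mono mult_right_mono) auto
    finally show ?thesis using that by (simp add: K_def algebra_simps)
  qed
  have "\<exists>p q. dist p x \<le> h * K \<and> dist q x \<le> h * K \<and> ?A p = ?B q" if h: "h > 0" "h * K < e" for h
  proof -
    have S: "x + s *\<^sub>R v + t *\<^sub>R w \<in> S" if "0 \<le> s" "s \<le> h" "0 \<le> t" "t \<le> h" for s t
      using near[OF that] h(2) e(2) by (intro subsetD[OF e(2)]) (auto simp: dist_norm norm_minus_commute add.assoc add.commute)
    obtain s t where 1: "0 < s" "s < h" "0 < t" "t < h"
      "f (x + h *\<^sub>R v + h *\<^sub>R w) - f (x + h *\<^sub>R v) - f (x + h *\<^sub>R w) + f x = h * h * ?A (x + s *\<^sub>R v + t *\<^sub>R w)"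
      using second_difference_mvt[OF assms(2) h(1) S] by blast
    have S': "x + s *\<^sub>R w + t *\<^sub>R v \<in> S" if "0 \<le> s" "s \<le> h" "0 \<le> t" "t \<le> h" for s t
      using S[of t s] that by (simp add: algebra_simps)
    obtain s' t' where 2: "0 < s'" "s' < h" "0 < t'" "t' < h"
      "f (x + h *\<^sub>R w + h *\<^sub>R v) - f (x + h *\<^sub>R w) - f (x + h *\<^sub>R v) + f x = h * h * ?B (x + s' *\<^sub>R w + t' *\<^sub>R v)"
      using second_difference_mvt[OF assms(2) h(1) S'] by blast
    have "h * h * ?A (x + s *\<^sub>R v + t *\<^sub>R w) = h * h * ?B (x + s' *\<^sub>R w + t' *\<^sub>R v)"
      using 1(5) 2(5) by (simp add: algebra_simps)
    then have "?A (x + s *\<^sub>R v + t *\<^sub>R w) = ?B (x + s' *\<^sub>R w + t' *\<^sub>R v)" using h by simp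
    moreover have "dist (x + s *\<^sub>R v + t *\<^sub>R w) x \<le> h * K" "dist (x + s' *\<^sub>R w + t' *\<^sub>R v) x \<le> h * K"
      using near[of s h t] near[of t' h s'] 1 2 by (auto simp: dist_norm add.assoc add.commute)
    ultimately show ?thesis by blast
  qed
  \<comment> \<open>Chosen so that \<open>h n * K\<close> is at most \<open>e / 2\<close> and tends
    to 0: both points produced by the mean value theorem then converge to \<open>x\<close>.\<close>
  moreover define h where "h n = e / (2 * K) * inverse (Suc n)" for n :: nat
  have h: "h n > 0" "h n * K < e" for n
  proof -
    show "h n > 0" using e(1) K by (simp add: h_def)
    have "inverse (real (Suc n)) \<le> 1" by (simp add: field_simps)
    then have "e / 2 * inverse (real (Suc n)) \<le> e / 2 * 1" using e(1) by (intro mult_left_mono) auto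
    then show "h n * K < e" using K e(1) by (simp add: h_def)
  qed
  ultimately have "\<exists>p q. dist p x \<le> h n * K \<and> dist q x \<le> h n * K \<and> ?A p = ?B q" for n by blast
  then obtain p q where pq: "\<And>n. dist (p n) x \<le> h n * K" "\<And>n. dist (q n) x \<le> h n * K"
    "\<And>n. ?A (p n) = ?B (q n)" by metis
  have "h \<longlonglongrightarrow> e / (2 * K) * 0"
    unfolding h_def by (intro tendsto_intros LIMSEQ_inverse_real_of_nat)
  then have hK: "(\<lambda>n. h n * K) \<longlonglongrightarrow> 0"
    using tendsto_mult_right[of h 0 sequentially K] by simp
  have "p \<longlonglongrightarrow> x" "q \<longlonglongrightarrow> x"
    using pq(1,2) by (auto intro!: metric_tendsto_imp_tendsto[OF hK] simp: K h(1) less_imp_le mult_nonneg_nonneg always_eventually)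
  moreover have "isCont ?A x" "isCont ?B x"
    using smooth_on_imp_continuous_on[OF smooth_on_frechet_derivative[OF smooth_on_frechet_derivative[OF assms(2)]]]
      assms(1,3) by (auto simp: continuous_on_eq_continuous_at)
  ultimately have "(\<lambda>n. ?A (p n)) \<longlonglongrightarrow> ?A x" "(\<lambda>n. ?B (q n)) \<longlonglongrightarrow> ?B x"
    using isCont_tendsto_compose by blast+
  then show ?thesis using LIMSEQ_unique pq(3) by simp
qed


section \<open>Tangent spaces of submanifolds\<close>

lemma has_vector_derivative_imp_quotient:
  assumes "(f has_vector_derivative w) (at (0::real))"
  shows "((\<lambda>t. (1 / t) *\<^sub>R (f t - f 0)) \<longlongrightarrow> w) (at 0)"
proof -
  have "((\<lambda>t. norm (f t - f 0 - t *\<^sub>R w) / \<bar>t\<bar>) \<longlongrightarrow> 0) (at 0)"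
    using assms by (simp add: has_vector_derivative_def has_derivative_iff_norm)
  moreover have "\<forall>\<^sub>F t in at (0::real). norm ((1 / t) *\<^sub>R (f t - f 0) - w) \<le> norm (f t - f 0 - t *\<^sub>R w) / \<bar>t\<bar>"
    using eventually_neq_at_within[of 0 0 UNIV]
  proof eventually_elim
    case (elim t)
    then have "(1 / t) *\<^sub>R (f t - f 0) - w = (1 / t) *\<^sub>R (f t - f 0 - t *\<^sub>R w)"
      by (simp add: scaleR_diff_right)
    then show ?case by (simp add: divide_inverse mult.commute)
  qed
  ultimately have "((\<lambda>t. (1 / t) *\<^sub>R (f t - f 0) - w) \<longlongrightarrow> 0) (at 0)"
    by (rule Lim_null_comparison[rotated])
  then show ?thesis by (rule LIM_zero_cancel)
qed

text \<open>A velocity of a curve in \<open>S\<close> is, in the chart, a limit of difference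
  quotients lying in the closed set \<open>L\<close>. Conversely, a straight line in
  \<open>L\<close> through \<open>\<phi> p\<close> is carried back by \<open>\<psi>\<close> to a
  curve in \<open>S\<close> with the prescribed velocity.\<close>

lemma tangent_space_chart:
  assumes U: "open U" "p \<in> U" and V: "open V" and hom: "homeomorphism U V \<phi> \<psi>"
    and sm: "smooth_on U \<phi>" "smooth_on V \<psi>"
    and L: "subspace L" "\<phi> ` (S \<inter> U) = L \<inter> V" and p: "p \<in> S"
  shows "tangent_space S p = {w. frechet_derivative \<phi> (at p) w \<in> L}"
proof -
  let ?D = "frechet_derivative \<phi> (at p)"
  have D\<phi>: "(\<phi> has_derivative ?D) (at p)" using smooth_on_has_derivative[OF sm(1) U(2)] .
  have \<phi>V: "\<phi> x \<in> V" "\<psi> (\<phi> x) = x" if "x \<in> U" for x using hom that by (auto simp: homeomorphism_def)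
  have \<psi>U: "\<psi> y \<in> U" "\<phi> (\<psi> y) = y" if "y \<in> V" for y using hom that by (auto simp: homeomorphism_def)
  have D\<psi>: "(\<psi> has_derivative frechet_derivative \<psi> (at (\<phi> p))) (at (\<phi> p))"
    using smooth_on_has_derivative[OF sm(2)] \<phi>V U by blast
  have inv: "frechet_derivative \<psi> (at (\<phi> p)) (?D w) = w" for w
  proof -
    have "((\<lambda>x. \<psi> (\<phi> x)) has_derivative (\<lambda>w. frechet_derivative \<psi> (at (\<phi> p)) (?D w))) (at p)"
      by (rule has_derivative_compose[OF D\<phi> D\<psi>])
    moreover have "((\<lambda>x. \<psi> (\<phi> x)) has_derivative (\<lambda>w. w)) (at p)"
      by (rule has_derivative_transform_within_open[OF has_derivative_ident U]) (simp add: \<phi>V)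
    ultimately show ?thesis using has_derivative_unique by metis
  qed
  show ?thesis
  proof (intro equalityI subsetI CollectI)
    fix w assume "w \<in> tangent_space S p"
    then obtain \<gamma> e where \<gamma>: "0 < e" "smooth_on {-e<..<e} \<gamma>" "\<gamma> ` {-e<..<e} \<subseteq> S" "\<gamma> 0 = p"
      "(\<gamma> has_vector_derivative w) (at 0)" unfolding tangent_space_def by blast
    have "isCont \<gamma> 0" using \<gamma>(5) has_vector_derivative_continuous by blast
    then have "\<forall>\<^sub>F t in at 0. \<gamma> t \<in> U"
      using U \<gamma>(4) by (auto simp: isCont_def intro: topological_tendstoD)
    moreover have "\<forall>\<^sub>F t in at 0. t \<in> {-e<..<e}"
      using \<gamma>(1) by (intro eventually_at_in_open') auto
    ultimately have ev: "\<forall>\<^sub>F t in at 0. (1 / t) *\<^sub>R (\<phi> (\<gamma> t) - \<phi> p) \<in> L"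
    proof eventually_elim
      case (elim t)
      have "\<phi> (\<gamma> t) \<in> L" "\<phi> p \<in> L" using L(2) elim \<gamma>(3) p U(2) by blast+
      then show ?case using L(1) by (simp add: subspace_diff subspace_scale)
    qed
    have "((\<lambda>t. \<phi> (\<gamma> t)) has_derivative (\<lambda>h. ?D (h *\<^sub>R w))) (at 0)"
      using has_derivative_compose[of \<gamma> "\<lambda>h. h *\<^sub>R w" 0 UNIV \<phi> ?D] \<gamma>(4,5) D\<phi>
      by (simp add: has_vector_derivative_def)
    then have "((\<lambda>t. \<phi> (\<gamma> t)) has_vector_derivative ?D w) (at 0)"
      using has_derivative_linear[OF D\<phi>] by (simp add: has_vector_derivative_def linear_scale)
    then have "((\<lambda>t. (1 / t) *\<^sub>R (\<phi> (\<gamma> t) - \<phi> p)) \<longlongrightarrow> ?D w) (at 0)"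
      using \<gamma>(4) by (auto dest: has_vector_derivative_imp_quotient)
    then show "?D w \<in> L"
      using Lim_in_closed_set[OF closed_subspace[OF L(1)] ev] by simp
  next
    fix w assume "w \<in> {w. ?D w \<in> L}"
    then have w: "?D w \<in> L" by simp
    let ?l = "\<lambda>t::real. \<phi> p + t *\<^sub>R ?D w"
    have "open (?l -` V)"
      by (intro open_vimage V continuous_intros)
    moreover have "0 \<in> ?l -` V" using \<phi>V U by simp
    ultimately obtain e where e: "e > 0" "ball 0 e \<subseteq> ?l -` V" using open_contains_ball by blast
    then have eV: "?l t \<in> V" if "t \<in> {-e<..<e}" for t
      using that by (auto simp: subset_eq dist_real_def)
    have "smooth_on {-e<..<e} ?l"
      by (intro smooth_on_add smooth_on_const smooth_on_linear bounded_linear_scaleR_left) auto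
    then have 1: "smooth_on {-e<..<e} (\<lambda>t. \<psi> (?l t))"
      using eV by (intro smooth_on_compose[OF _ V _ _ sm(2)]) auto
    have "\<phi> p \<in> L" using L(2) p U(2) by blast
    then have "?l t \<in> L" for t using w L(1) by (simp add: subspace_add subspace_scale)
    then have 2: "\<psi> (?l t) \<in> S" if "t \<in> {-e<..<e}" for t
    proof -
      have "?l t \<in> \<phi> ` (S \<inter> U)" using eV[OF that] \<open>?l t \<in> L\<close> L(2) by blast
      then show ?thesis using \<phi>V by auto
    qed
    have "(?l has_derivative (\<lambda>h. h *\<^sub>R ?D w)) (at 0)"
      by (auto intro!: derivative_eq_intros)
    then have "((\<lambda>t. \<psi> (?l t)) has_derivative (\<lambda>h. frechet_derivative \<psi> (at (\<phi> p)) (h *\<^sub>R ?D w))) (at 0)"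
      by (rule has_derivative_compose) (use D\<psi> in simp)
    then have "((\<lambda>t. \<psi> (?l t)) has_vector_derivative w) (at 0)"
      using has_derivative_linear[OF D\<psi>] by (simp add: has_vector_derivative_def linear_scale inv)
    then show "w \<in> tangent_space S p"
      unfolding tangent_space_def using 1 2 e(1) \<phi>V U
      by (auto intro!: exI[of _ "\<lambda>t. \<psi> (?l t)"] exI[of _ e])
  qed
qed


section \<open>Smooth families of functions with three parameters\<close>

definition parameter_gradient :: "(real \<times> (real^3) \<Rightarrow> real) \<Rightarrow> real \<times> (real^3) \<Rightarrow> real^3" where
  "parameter_gradient g z = (\<chi> j. frechet_derivative g (at z) (0, axis j 1))"

lemma bounded_bilinear_cross3: "bounded_bilinear cross3"
  using bilinear_cross by (simp add: bilinear_conv_bounded_bilinear)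

text \<open>Cramer's rule: the triple product is the determinant with rows \<open>A\<close>,
  \<open>B\<close>, \<open>C\<close>, and the identity expands \<open>w\<close> in the cross
  products of pairs of rows.\<close>

lemma triple_product_eq_0:
  fixes w :: "real^3"
  assumes "A \<bullet> cross3 B C \<noteq> 0" "A \<bullet> w = 0" "B \<bullet> w = 0" "C \<bullet> w = 0"
  shows "w = 0"
proof -
  have "(A \<bullet> cross3 B C) *\<^sub>R w =
      (A \<bullet> w) *\<^sub>R cross3 B C + (B \<bullet> w) *\<^sub>R cross3 C A + (C \<bullet> w) *\<^sub>R cross3 A B"
    by (simp add: cross3_simps forall_3)
  with assms show ?thesis by simp
qed

lemma span_cross3:
  fixes A B :: "real^3"
  assumes "cross3 A B \<noteq> 0"
  shows "{w. A \<bullet> w = 0 \<and> B \<bullet> w = 0} = span {cross3 A B}"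
proof (intro equalityI subsetI CollectI)
  fix w assume "w \<in> {w. A \<bullet> w = 0 \<and> B \<bullet> w = 0}"
  then have w: "A \<bullet> w = 0" "B \<bullet> w = 0" by auto
  let ?n = "cross3 A B"
  \<comment> \<open>The same Cramer identity with rows \<open>A\<close>, \<open>B\<close>,
    \<open>?n\<close>, whose determinant is \<open>?n \<bullet> ?n\<close>.\<close>
  have "(?n \<bullet> ?n) *\<^sub>R w = (A \<bullet> w) *\<^sub>R cross3 B ?n + (B \<bullet> w) *\<^sub>R cross3 ?n A + (?n \<bullet> w) *\<^sub>R ?n"
    by (simp add: cross3_simps forall_3)
  then have "(?n \<bullet> ?n) *\<^sub>R w = (?n \<bullet> w) *\<^sub>R ?n" using w by simp
  then have "w = ((?n \<bullet> w) / (?n \<bullet> ?n)) *\<^sub>R ?n"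
    using assms by (metis (no_types, lifting) divideR_right divide_inverse inner_eq_zero_iff mult.commute scaleR_scaleR)
  then show "w \<in> span {?n}" by (metis span_base span_mul insertI1)
next
  fix w assume "w \<in> span {cross3 A B}"
  then obtain k where "w = k *\<^sub>R cross3 A B" by (auto simp: span_singleton)
  then show "A \<bullet> w = 0 \<and> B \<bullet> w = 0" by (simp add: dot_cross_self)
qed

text \<open>The sequence \<open>u k\<close> holds the successive \<open>x\<close>-derivatives as
  functions of \<open>x\<close> and the parameters jointly. Stating this by a differential relation,
  not by iterating \<open>deriv\<close>, lets every mixed derivative be taken of one smooth map and
  lets the domain shrink freely.\<close>

locale solution_family =
  fixes u :: "nat \<Rightarrow> real \<times> (real^3) \<Rightarrow> real" and J :: "real set" and U :: "(real^3) set"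
  assumes open_J: "open J" and open_U: "open U"
    and smooth_u: "\<And>k. smooth_on (J \<times> U) (u k)"
    and deriv_u: "\<And>k z. z \<in> J \<times> U \<Longrightarrow> frechet_derivative (u k) (at z) (1, 0) = u (Suc k) z"
begin

abbreviation \<gamma> :: "nat \<Rightarrow> real \<times> (real^3) \<Rightarrow> real^3" where
  "\<gamma> k \<equiv> parameter_gradient (u k)"

definition jet2 :: "real \<times> (real^3) \<Rightarrow> real^3" where
  "jet2 z = vector [u 0 z, u 1 z, u 2 z]"

definition ruling :: "real \<times> (real^3) \<Rightarrow> real^3" where
  "ruling z = cross3 (\<gamma> 0 z) (\<gamma> 1 z)"

text \<open>The \<open>x\<close>-derivative of \<open>ruling\<close>: the other term of the product
  rule is the cross product of \<open>\<gamma> 1\<close> with itself.\<close>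

definition ruling' :: "real \<times> (real^3) \<Rightarrow> real^3" where
  "ruling' z = cross3 (\<gamma> 0 z) (\<gamma> 2 z)"

lemma open_JU: "open (J \<times> U)"
  using open_J open_U by (rule open_Times)

lemma frechet_derivative_u:
  assumes "z \<in> J \<times> U"
  shows "frechet_derivative (u k) (at z) (s, w) = s * u (Suc k) z + \<gamma> k z \<bullet> w"
proof -
  let ?D = "frechet_derivative (u k) (at z)"
  have lin: "linear ?D"
    using smooth_on_has_derivative[OF smooth_u assms] has_derivative_linear by blast
  have "w = (\<Sum>j\<in>UNIV. w $ j *\<^sub>R axis j 1)"
    by (simp add: basis_expansion scalar_mult_eq_scaleR[symmetric])
  then have "(0::real, w) = (\<Sum>j\<in>UNIV. w $ j *\<^sub>R (0, axis j 1))"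
    by (simp add: sum_prod scaleR_Pair)
  then have "?D (0, w) = (\<Sum>j\<in>UNIV. w $ j *\<^sub>R ?D (0, axis j 1))"
    using lin by (simp only: linear_sum linear_scale real_scaleR_def)
  also have "\<dots> = \<gamma> k z \<bullet> w"
    by (simp add: parameter_gradient_def inner_vec_def mult.commute)
  finally have 1: "?D (0, w) = \<gamma> k z \<bullet> w" .
  have "?D (s, w) = ?D (s *\<^sub>R (1, 0) + (0, w))" by simp
  also have "\<dots> = s *\<^sub>R ?D (1, 0) + ?D (0, w)"
    using lin by (simp only: linear_add linear_scale)
  finally show ?thesis using 1 deriv_u[OF assms] by simp
qed

lemma has_derivative_u:
  assumes "z \<in> J \<times> U"
  shows "(u k has_derivative (\<lambda>(s, w). s * u (Suc k) z + \<gamma> k z \<bullet> w)) (at z)"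
proof -
  have "frechet_derivative (u k) (at z) = (\<lambda>(s, w). s * u (Suc k) z + \<gamma> k z \<bullet> w)"
    using frechet_derivative_u[OF assms] by auto
  then show ?thesis using smooth_on_has_derivative[OF smooth_u[of k] assms] by simp
qed

lemma has_derivative_u_compose:
  assumes "(h has_derivative h') (at q)" "(g has_derivative g') (at q)" "h q \<in> J" "g q \<in> U"
  shows "((\<lambda>q. u k (h q, g q)) has_derivative
    (\<lambda>v. h' v * u (Suc k) (h q, g q) + \<gamma> k (h q, g q) \<bullet> g' v)) (at q)"
  using has_derivative_compose[OF has_derivative_Pair[OF assms(1,2)] has_derivative_u[of "(h q, g q)" k]] assms(3,4)
  by simp

lemma DERIV_u:
  assumes "x \<in> J" "P \<in> U"
  shows "((\<lambda>x. u k (x, P)) has_real_derivative u (Suc k) (x, P)) (at x)"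
  using has_derivative_u_compose[OF has_derivative_ident has_derivative_const, of x P k] assms
  by (simp add: has_field_derivative_def mult_commute_abs)

lemma has_derivative_u_parameter:
  assumes "x \<in> J" "P \<in> U"
  shows "((\<lambda>P. u k (x, P)) has_derivative (\<lambda>w. \<gamma> k (x, P) \<bullet> w)) (at P)"
  using has_derivative_u_compose[OF has_derivative_const has_derivative_ident, of x P k] assms
  by simp

lemma smooth_gradient: "smooth_on (J \<times> U) (\<gamma> k)"
proof (rule smooth_on_componentwise[OF open_JU])
  fix i :: "real^3" assume "i \<in> Basis"
  then obtain j where "i = axis j 1" by (auto simp: Basis_vec_def)
  then show "smooth_on (J \<times> U) (\<lambda>z. \<gamma> k z \<bullet> i)"
    using smooth_on_frechet_derivative[OF smooth_u[of k]]
    by (simp add: parameter_gradient_def inner_axis)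
qed

text \<open>Differentiation in \<open>x\<close> commutes with each parameter derivative by the
  symmetry of second derivatives, so it merely raises the index of the gradient.\<close>

lemma gradient_has_vector_derivative:
  assumes "x \<in> J" "P \<in> U"
  shows "((\<lambda>x. \<gamma> k (x, P)) has_vector_derivative \<gamma> (Suc k) (x, P)) (at x)"
proof -
  have z: "(x, P) \<in> J \<times> U" using assms by simp
  let ?D = "\<lambda>v z. frechet_derivative (u k) (at z) v"
  have "frechet_derivative (\<gamma> k) (at (x, P)) (1, 0) = \<gamma> (Suc k) (x, P)"
  proof -
    have "frechet_derivative (\<gamma> k) (at (x, P)) (1, 0) $ j = \<gamma> (Suc k) (x, P) $ j" for j
    proof -
      have "((\<lambda>z. \<gamma> k z $ j) has_derivative (\<lambda>v. frechet_derivative (\<gamma> k) (at (x, P)) v $ j)) (at (x, P))"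
        using bounded_linear.has_derivative[OF bounded_linear_vec_nth smooth_on_has_derivative[OF smooth_gradient z]] .
      then have "(?D (0, axis j 1) has_derivative (\<lambda>v. frechet_derivative (\<gamma> k) (at (x, P)) v $ j)) (at (x, P))"
        by (simp add: parameter_gradient_def)
      then have "frechet_derivative (\<gamma> k) (at (x, P)) (1, 0) $ j = frechet_derivative (?D (0, axis j 1)) (at (x, P)) (1, 0)"
        by (metis frechet_derivative_at)
      also have "\<dots> = frechet_derivative (?D (1, 0)) (at (x, P)) (0, axis j 1)"
        by (rule smooth_on_second_derivative_symmetric[OF open_JU smooth_u z])
      also have "\<dots> = frechet_derivative (u (Suc k)) (at (x, P)) (0, axis j 1)"
      proof -
        have "(?D (1, 0) has_derivative frechet_derivative (u (Suc k)) (at (x, P))) (at (x, P))"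
          by (rule has_derivative_transform_within_open[OF smooth_on_has_derivative[OF smooth_u z] open_JU z])
            (simp add: deriv_u)
        then show ?thesis using frechet_derivative_at by metis
      qed
      finally show ?thesis by (simp add: parameter_gradient_def)
    qed
    then show ?thesis by (simp add: vec_eq_iff)
  qed
  moreover have "((\<lambda>x. \<gamma> k (x, P)) has_derivative (\<lambda>h. frechet_derivative (\<gamma> k) (at (x, P)) (h, 0))) (at x)"
    by (rule has_derivative_compose[of "\<lambda>x. (x, P)" "\<lambda>h. (h, 0)" x UNIV "\<gamma> k"])
      (auto intro!: derivative_eq_intros smooth_on_has_derivative[OF smooth_gradient z])
  moreover have "linear (frechet_derivative (\<gamma> k) (at (x, P)))"
    using smooth_on_has_derivative[OF smooth_gradient z] has_derivative_linear by blast
  then have "frechet_derivative (\<gamma> k) (at (x, P)) (h *\<^sub>R (1, 0)) = h *\<^sub>R frechet_derivative (\<gamma> k) (at (x, P)) (1, 0)" for h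
    by (rule linear_scale)
  ultimately show ?thesis by (simp add: has_vector_derivative_def)
qed

lemma ruling_has_vector_derivative:
  assumes "x \<in> J" "P \<in> U"
  shows "((\<lambda>x. ruling (x, P)) has_vector_derivative ruling' (x, P)) (at x)"
    and "((\<lambda>x. ruling' (x, P)) has_vector_derivative
      cross3 (\<gamma> 1 (x, P)) (\<gamma> 2 (x, P)) + cross3 (\<gamma> 0 (x, P)) (\<gamma> 3 (x, P))) (at x)"
  using bounded_bilinear.has_vector_derivative[OF bounded_bilinear_cross3
      gradient_has_vector_derivative[OF assms, of 0] gradient_has_vector_derivative[OF assms, of 1]]
    bounded_bilinear.has_vector_derivative[OF bounded_bilinear_cross3
      gradient_has_vector_derivative[OF assms, of 0] gradient_has_vector_derivative[OF assms, of 2]]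
  by (simp_all add: ruling_def ruling'_def numeral_2_eq_2 numeral_3_eq_3 add.commute)

lemma smooth_ruling: "smooth_on (J \<times> U) ruling"
  unfolding ruling_def
  by (intro smooth_on_bilinear[OF open_JU bounded_bilinear_cross3] smooth_gradient)

lemma smooth_ruling': "smooth_on (J \<times> U) ruling'"
  unfolding ruling'_def
  by (intro smooth_on_bilinear[OF open_JU bounded_bilinear_cross3] smooth_gradient)

lemma smooth_jet2: "smooth_on (J \<times> U) jet2"
  unfolding jet2_def by (intro smooth_on_vector3 open_JU smooth_u)

lemma smooth_on_fixed_parameter:
  assumes "smooth_on (J \<times> U) g" "P \<in> U"
  shows "smooth_on J (\<lambda>x. g (x, P))"
proof (rule smooth_on_compose[OF open_J open_JU _ _ assms(1)])
  show "smooth_on J (\<lambda>x. (x, P))"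
    by (intro smooth_on_Pair smooth_on_linear open_J smooth_on_const) (rule bounded_linear_ident)
qed (use assms in auto)

lemma smooth_on_fixed_point:
  assumes "smooth_on (J \<times> U) g" "x \<in> J"
  shows "smooth_on U (\<lambda>P. g (x, P))"
proof (rule smooth_on_compose[OF open_U open_JU _ _ assms(1)])
  show "smooth_on U (\<lambda>P. (x, P))"
    by (intro smooth_on_Pair smooth_on_linear open_U smooth_on_const) (rule bounded_linear_ident)
qed (use assms in auto)

end


section \<open>Incidence of solutions\<close>

text \<open>\<open>\<Gamma>\<close> recovers a solution from its 2-jet at a point. The vectors \<open>a\<close> and \<open>b\<close> define an affine
  coordinate \<open>[w] \<mapsto> (b \<bullet> w) / (a \<bullet> w)\<close> on the projective plane that increases along every indicatrix.\<close>

locale solution_chart = solution_family +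
  fixes V :: "(real \<times> (real^3)) set" and \<Gamma> :: "real \<times> (real^3) \<Rightarrow> real^3" and a b :: "real^3"
  assumes interval_J: "is_interval J" and J_nonempty: "J \<noteq> {}" and convex_U: "convex U"
    and mixed_wronskian: "\<And>x\<^sub>1 x\<^sub>2 x\<^sub>3 P\<^sub>1 P\<^sub>2 P\<^sub>3. \<lbrakk>x\<^sub>1 \<in> J; x\<^sub>2 \<in> J; x\<^sub>3 \<in> J; P\<^sub>1 \<in> U; P\<^sub>2 \<in> U; P\<^sub>3 \<in> U\<rbrakk>
      \<Longrightarrow> \<gamma> 0 (x\<^sub>1, P\<^sub>1) \<bullet> cross3 (\<gamma> 1 (x\<^sub>2, P\<^sub>2)) (\<gamma> 2 (x\<^sub>3, P\<^sub>3)) \<noteq> 0"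
    and open_V: "open V" and smooth_\<Gamma>: "smooth_on V \<Gamma>"
    and \<Gamma>_jet2: "\<And>x P. \<lbrakk>x \<in> J; P \<in> U\<rbrakk> \<Longrightarrow> (x, jet2 (x, P)) \<in> V \<and> \<Gamma> (x, jet2 (x, P)) = P"
    and jet2_\<Gamma>: "\<And>x y. \<lbrakk>x \<in> J; (x, y) \<in> V; \<Gamma> (x, y) \<in> U\<rbrakk> \<Longrightarrow> jet2 (x, \<Gamma> (x, y)) = y"
    and interval_fibre: "\<And>x p q. x \<in> J \<Longrightarrow>
      is_interval {t. (x, vector [p, q, t]) \<in> V \<and> \<Gamma> (x, vector [p, q, t]) \<in> U}"
    and ruling_a: "\<And>z. z \<in> J \<times> U \<Longrightarrow> a \<bullet> ruling z \<noteq> 0"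
    and ruling_slope: "\<And>z. z \<in> J \<times> U \<Longrightarrow>
      (b \<bullet> ruling' z) * (a \<bullet> ruling z) - (b \<bullet> ruling z) * (a \<bullet> ruling' z) > 0"
begin

definition contact :: "real \<Rightarrow> real^3 \<Rightarrow> real^3 \<Rightarrow> bool" where
  "contact x P Q \<longleftrightarrow> u 0 (x, P) = u 0 (x, Q) \<and> u 1 (x, P) = u 1 (x, Q)"

definition cone :: "real^3 \<Rightarrow> (real^3) set" where
  "cone P = {Q \<in> U. \<exists>x\<in>J. contact x P Q}"

definition fibre :: "real \<Rightarrow> real^3 \<Rightarrow> (real^3) set" where
  "fibre x P = {Q \<in> U. contact x P Q}"

definition diff_u :: "nat \<Rightarrow> real^3 \<Rightarrow> real^3 \<Rightarrow> real \<Rightarrow> real" where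
  "diff_u k P Q x = u k (x, Q) - u k (x, P)"

lemma contact_iff_diff: "contact x P Q \<longleftrightarrow> diff_u 0 P Q x = 0 \<and> diff_u 1 P Q x = 0"
  by (auto simp: contact_def diff_u_def)

lemma contact_sym: "contact x P Q \<Longrightarrow> contact x Q P"
  by (simp add: contact_def)

text \<open>Mean value theorem on the segment from \<open>P\<close> to \<open>Q\<close>, which lies
  in the convex \<open>U\<close>. The intermediate \<open>R\<close> depends on \<open>k\<close> and
  \<open>x\<close>; hence \<open>mixed_wronskian\<close> has to allow its three rows at unrelated
  points.\<close>

lemma diff_u_mvt:
  assumes "P \<in> U" "Q \<in> U" "x \<in> J"
  obtains R where "R \<in> U" "diff_u k P Q x = \<gamma> k (x, R) \<bullet> (Q - P)"
proof -
  have seg: "P + s *\<^sub>R (Q - P) \<in> U" if "0 \<le> s" "s \<le> 1" for s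
    using convexD_alt[OF convex_U assms(1,2) that] by (simp add: algebra_simps)
  have D: "((\<lambda>s. u k (x, P + s *\<^sub>R (Q - P))) has_real_derivative \<gamma> k (x, P + s *\<^sub>R (Q - P)) \<bullet> (Q - P)) (at s)"
    if "0 \<le> s" "s \<le> 1" for s
    by (rule has_real_derivative_along_line[OF has_derivative_u_parameter[OF assms(3) seg[OF that]]])
  obtain s where "0 < s" "s < 1"
    "u k (x, P + 1 *\<^sub>R (Q - P)) - u k (x, P + 0 *\<^sub>R (Q - P)) = (1 - 0) * (\<gamma> k (x, P + s *\<^sub>R (Q - P)) \<bullet> (Q - P))"
    using MVT2[OF zero_less_one, of "\<lambda>s. u k (x, P + s *\<^sub>R (Q - P))" "\<lambda>s. \<gamma> k (x, P + s *\<^sub>R (Q - P)) \<bullet> (Q - P)", OF D] by blast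
  then show ?thesis using that[OF seg[of s]] by (simp add: diff_u_def)
qed

lemma diff_u_eq_0_imp_eq:
  assumes "P \<in> U" "Q \<in> U" "x \<in> J" "y \<in> J" "z \<in> J"
    and "diff_u 0 P Q x = 0" "diff_u 1 P Q y = 0" "diff_u 2 P Q z = 0"
  shows "P = Q"
proof -
  obtain A where A: "A \<in> U" "diff_u 0 P Q x = \<gamma> 0 (x, A) \<bullet> (Q - P)" using diff_u_mvt assms by metis
  obtain B where B: "B \<in> U" "diff_u 1 P Q y = \<gamma> 1 (y, B) \<bullet> (Q - P)" using diff_u_mvt assms by metis
  obtain C where C: "C \<in> U" "diff_u 2 P Q z = \<gamma> 2 (z, C) \<bullet> (Q - P)" using diff_u_mvt assms by metis
  have "Q - P = 0"
    by (rule triple_product_eq_0[OF mixed_wronskian[OF assms(3-5) A(1) B(1) C(1)]])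
      (use A B C assms(6-8) in auto)
  then show ?thesis by simp
qed

lemma DERIV_diff_u:
  assumes "P \<in> U" "Q \<in> U" "x \<in> J"
  shows "(diff_u k P Q has_real_derivative diff_u (Suc k) P Q x) (at x)"
  unfolding diff_u_def by (intro DERIV_diff DERIV_u assms)

lemma interval_J_between: "x \<in> J \<Longrightarrow> y \<in> J \<Longrightarrow> x \<le> t \<Longrightarrow> t \<le> y \<Longrightarrow> t \<in> J"
  using interval_J unfolding is_interval_1 by blast

text \<open>If two solutions touch at \<open>x\<close>, the second derivative of their difference has no zero, so the
  difference is strictly convex or strictly concave.\<close>

lemma contact_sign:
  assumes PQ: "P \<in> U" "Q \<in> U" "P \<noteq> Q" and x: "x \<in> J" "contact x P Q"
  obtains \<sigma> :: real where "\<sigma> = 1 \<or> \<sigma> = -1" "\<And>y. y \<in> J \<Longrightarrow> \<sigma> * diff_u 2 P Q y > 0"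
    "\<And>y. y \<in> J \<Longrightarrow> y < x \<Longrightarrow> \<sigma> * diff_u 1 P Q y < 0"
    "\<And>y. y \<in> J \<Longrightarrow> x < y \<Longrightarrow> \<sigma> * diff_u 1 P Q y > 0"
    "\<And>y. y \<in> J \<Longrightarrow> y \<noteq> x \<Longrightarrow> \<sigma> * diff_u 0 P Q y > 0"
proof -
  define \<sigma> where "\<sigma> = sgn (diff_u 2 P Q x)"
  have zero: "diff_u 0 P Q x = 0" "diff_u 1 P Q x = 0" using x(2) contact_iff_diff by auto
  have nz: "diff_u 2 P Q y \<noteq> 0" if "y \<in> J" for y
    using diff_u_eq_0_imp_eq[OF PQ(1,2) x(1) x(1) that zero] PQ(3) by blast
  have D: "((\<lambda>y. \<sigma> * diff_u k P Q y) has_real_derivative \<sigma> * diff_u (Suc k) P Q y) (at y)" if "y \<in> J" for k y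
    by (intro DERIV_cmult DERIV_diff_u PQ that)
  have cont: "continuous_on J (\<lambda>y. \<sigma> * diff_u 2 P Q y)"
    using D by (meson DERIV_isCont continuous_at_imp_continuous_on)
  have pm: "\<sigma> = 1 \<or> \<sigma> = -1" using nz[OF x(1)] by (auto simp: \<sigma>_def sgn_if)
  have posx: "\<sigma> * diff_u 2 P Q x > 0" using nz[OF x(1)] by (auto simp: \<sigma>_def sgn_if)
  have pos: "\<sigma> * diff_u 2 P Q y > 0" if y: "y \<in> J" for y
  proof (rule ccontr)
    assume "\<not> \<sigma> * diff_u 2 P Q y > 0"
    moreover have "connected ((\<lambda>y. \<sigma> * diff_u 2 P Q y) ` J)"
      by (intro connected_continuous_image cont is_interval_connected interval_J)
    ultimately have "0 \<in> (\<lambda>y. \<sigma> * diff_u 2 P Q y) ` J"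
      using x(1) y posx connectedD_interval[of "(\<lambda>y. \<sigma> * diff_u 2 P Q y) ` J" "\<sigma> * diff_u 2 P Q y" "\<sigma> * diff_u 2 P Q x" 0]
      by auto
    then show False using nz pm by auto
  qed
  have inc1: "\<sigma> * diff_u 1 P Q s < \<sigma> * diff_u 1 P Q t" if "s \<in> J" "t \<in> J" "s < t" for s t
    by (rule DERIV_pos_imp_increasing[OF that(3)])
      (metis D One_nat_def Suc_1 interval_J_between pos that(1,2))
  have neg: "\<sigma> * diff_u 1 P Q y < 0" if "y \<in> J" "y < x" for y
    using inc1[OF that(1) x(1) that(2)] zero by simp
  have pos1: "\<sigma> * diff_u 1 P Q y > 0" if "y \<in> J" "x < y" for y
    using inc1[OF x(1) that] zero by simp
  have "\<sigma> * diff_u 0 P Q y > 0" if y: "y \<in> J" "y \<noteq> x" for y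
  proof (cases "y < x")
    case True
    have "\<exists>z. y < z \<and> z < x \<and> \<sigma> * diff_u 0 P Q x - \<sigma> * diff_u 0 P Q y = (x - y) * (\<sigma> * diff_u 1 P Q z)"
      by (rule MVT2[OF True]) (metis D One_nat_def interval_J_between x(1) y(1))
    then obtain z where z: "y < z" "z < x" "\<sigma> * diff_u 0 P Q x - \<sigma> * diff_u 0 P Q y = (x - y) * (\<sigma> * diff_u 1 P Q z)"
      by blast
    have "(x - y) * (\<sigma> * diff_u 1 P Q z) < 0"
      using neg[of z] z interval_J_between[OF y(1) x(1), of z] True by (intro mult_pos_neg[of "x - y" "\<sigma> * diff_u 1 P Q z"]) (auto simp del: One_nat_def)
    then show ?thesis using z(3) zero by simp
  next
    case False
    then have lt: "x < y" using y(2) by simp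
    have "\<exists>z. x < z \<and> z < y \<and> \<sigma> * diff_u 0 P Q y - \<sigma> * diff_u 0 P Q x = (y - x) * (\<sigma> * diff_u 1 P Q z)"
      by (rule MVT2[OF lt]) (metis D One_nat_def interval_J_between x(1) y(1))
    then obtain z where z: "x < z" "z < y" "\<sigma> * diff_u 0 P Q y - \<sigma> * diff_u 0 P Q x = (y - x) * (\<sigma> * diff_u 1 P Q z)"
      by blast
    have "(y - x) * (\<sigma> * diff_u 1 P Q z) > 0"
      using pos1[of z] z interval_J_between[OF x(1) y(1), of z] lt by (intro mult_pos_pos[of "y - x" "\<sigma> * diff_u 1 P Q z"]) (auto simp del: One_nat_def)
    then show ?thesis using z(3) zero(1) by (metis diff_zero mult_zero_right)
  qed
  then show ?thesis using that[OF pm pos neg pos1] by blast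
qed

lemma contact_unique:
  assumes "P \<in> U" "Q \<in> U" "P \<noteq> Q" "x \<in> J" "contact x P Q" "y \<in> J" "contact y P Q"
  shows "x = y"
proof (rule ccontr)
  assume "x \<noteq> y"
  obtain \<sigma> where "\<And>y. y \<in> J \<Longrightarrow> y \<noteq> x \<Longrightarrow> \<sigma> * diff_u 0 P Q y > 0"
    using contact_sign[OF assms(1-5)] by metis
  then have "\<sigma> * diff_u 0 P Q y > 0" using \<open>x \<noteq> y\<close> assms(6) by auto
  then show False using assms(7) by (simp add: contact_iff_diff)
qed

text \<open>The three differences have definite signs and the difference of \<open>P\<close> and \<open>R\<close> is the sum of the
  other two. After moving one term to the other side, this is a vanishing sum of two terms of equal
  sign at the zero of the third.\<close>

lemma mutual_contact_unique:
  assumes U: "P \<in> U" "Q \<in> U" "R \<in> U" and ne: "P \<noteq> Q" "Q \<noteq> R" "P \<noteq> R"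
    and J: "x \<in> J" "y \<in> J" "z \<in> J"
    and c: "contact x P Q" "contact y Q R" "contact z P R"
  shows "x = z" "y = z"
proof -
  obtain \<rho> where \<rho>: "\<rho> = 1 \<or> \<rho> = -1" "\<And>t. t \<in> J \<Longrightarrow> t \<noteq> x \<Longrightarrow> \<rho> * diff_u 0 P Q t > 0"
    using contact_sign[OF U(1,2) ne(1) J(1) c(1)] by metis
  obtain \<sigma> where \<sigma>: "\<sigma> = 1 \<or> \<sigma> = -1" "\<And>t. t \<in> J \<Longrightarrow> t \<noteq> y \<Longrightarrow> \<sigma> * diff_u 0 Q R t > 0"
    using contact_sign[OF U(2,3) ne(2) J(2) c(2)] by metis
  obtain \<tau> where \<tau>: "\<tau> = 1 \<or> \<tau> = -1" "\<And>t. t \<in> J \<Longrightarrow> t \<noteq> z \<Longrightarrow> \<tau> * diff_u 0 P R t > 0"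
    using contact_sign[OF U(1,3) ne(3) J(3) c(3)] by metis
  have sum: "diff_u 0 P R t = diff_u 0 P Q t + diff_u 0 Q R t" for t by (simp add: diff_u_def)
  have zero: "diff_u 0 P Q x = 0" "diff_u 0 Q R y = 0" "diff_u 0 P R z = 0"
    using c by (auto simp: contact_iff_diff)
  have "x = z \<and> y = z"
  proof (cases "\<rho> = \<sigma>")
    case True
    then show ?thesis
      using \<rho>(2)[OF J(3)] \<sigma>(2)[OF J(3)] zero sum[of z] \<rho>(1) by (cases "z = x"; cases "z = y") auto
  next
    case False
    show ?thesis
    \<comment> \<open>Now \<open>\<rho>\<close> is opposite to \<open>\<sigma>\<close>. If
      \<open>\<tau> = \<sigma>\<close>, the differences PR and -PQ have equal sign and their sum QR
      vanishes at \<open>y\<close>; otherwise PR and -QR have equal sign and their sum PQ vanishes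
      at \<open>x\<close>.\<close>
    proof (cases "\<tau> = \<sigma>")
      case True
      then show ?thesis
        using False \<tau>(2)[OF J(1)] \<sigma>(2)[OF J(1)] \<rho>(2)[OF J(2)] \<tau>(2)[OF J(2)] zero sum[of y] sum[of x] \<rho>(1) \<sigma>(1)
        by (cases "x = z"; cases "x = y"; cases "y = z") auto
    next
      case False
      then show ?thesis
        using \<open>\<rho> \<noteq> \<sigma>\<close> \<tau>(2)[OF J(1)] \<sigma>(2)[OF J(1)] \<rho>(2)[OF J(2)] \<tau>(2)[OF J(2)] zero sum[of y] sum[of x] \<rho>(1) \<sigma>(1) \<tau>(1)
        by (cases "x = z"; cases "x = y"; cases "y = z") auto
    qed
  qed
  then show "x = z" "y = z" by auto
qed


section \<open>The curves of the pencil\<close>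

text \<open>The first argument is the point of contact with \<open>P\<close>, the second the free
  value of y'' there.\<close>

definition fibre_param :: "real^3 \<Rightarrow> real \<times> real \<Rightarrow> real^3" where
  "fibre_param P z = \<Gamma> (fst z, vector [u 0 (fst z, P), u 1 (fst z, P), snd z])"

definition fibre_domain :: "real^3 \<Rightarrow> (real \<times> real) set" where
  "fibre_domain P = {z. fst z \<in> J \<and> (fst z, vector [u 0 (fst z, P), u 1 (fst z, P), snd z]) \<in> V
    \<and> fibre_param P z \<in> U}"

lemma jet2_fibre_param:
  assumes "(x, t) \<in> fibre_domain P"
  shows "u 0 (x, fibre_param P (x, t)) = u 0 (x, P)" "u 1 (x, fibre_param P (x, t)) = u 1 (x, P)"
    "u 2 (x, fibre_param P (x, t)) = t"
proof -
  have "jet2 (x, fibre_param P (x, t)) = vector [u 0 (x, P), u 1 (x, P), t]"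
    unfolding fibre_param_def using assms
    by (simp add: jet2_\<Gamma> fibre_domain_def fibre_param_def)
  then show "u 0 (x, fibre_param P (x, t)) = u 0 (x, P)" "u 1 (x, fibre_param P (x, t)) = u 1 (x, P)"
    "u 2 (x, fibre_param P (x, t)) = t"
    by (simp_all add: jet2_def vec_eq_iff forall_3)
qed

lemma fibre_param_contact:
  assumes "x \<in> J" "R \<in> U" "contact x P R"
  shows "(x, u 2 (x, R)) \<in> fibre_domain P" "fibre_param P (x, u 2 (x, R)) = R"
proof -
  have "(x, vector [u 0 (x, P), u 1 (x, P), u 2 (x, R)]) = (x, jet2 (x, R))"
    using assms(3) by (simp add: jet2_def contact_def)
  then show "(x, u 2 (x, R)) \<in> fibre_domain P" "fibre_param P (x, u 2 (x, R)) = R"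
    using \<Gamma>_jet2[OF assms(1,2)] assms by (simp_all add: fibre_domain_def fibre_param_def)
qed

lemma fibre_eq_image:
  assumes "x \<in> J"
  shows "fibre x P = (\<lambda>t. fibre_param P (x, t)) ` {t. (x, t) \<in> fibre_domain P}"
proof (intro equalityI subsetI)
  fix R assume "R \<in> fibre x P"
  then show "R \<in> (\<lambda>t. fibre_param P (x, t)) ` {t. (x, t) \<in> fibre_domain P}"
    using fibre_param_contact[OF assms, of R P] by (force simp: fibre_def image_iff)
next
  fix R assume "R \<in> (\<lambda>t. fibre_param P (x, t)) ` {t. (x, t) \<in> fibre_domain P}"
  then obtain t where t: "(x, t) \<in> fibre_domain P" "R = fibre_param P (x, t)" by auto
  then show "R \<in> fibre x P"
    using jet2_fibre_param[OF t(1)] by (simp add: fibre_def contact_def fibre_domain_def)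
qed

lemma smooth_vector_arg:
  assumes "P \<in> U"
  shows "smooth_on (J \<times> (UNIV::real set)) (\<lambda>z. (fst z, vector [u 0 (fst z, P), u 1 (fst z, P), snd z] :: real^3))"
proof -
  have o: "open (J \<times> (UNIV::real set))" by (intro open_Times open_J open_UNIV)
  have f: "smooth_on (J \<times> (UNIV::real set)) fst" "smooth_on (J \<times> (UNIV::real set)) snd"
    by (intro smooth_on_linear o bounded_linear_fst bounded_linear_snd)+
  have "smooth_on (J \<times> (UNIV::real set)) (\<lambda>z. u k (fst z, P))" for k
    by (rule smooth_on_compose[OF o open_J _ f(1) smooth_on_fixed_parameter[OF smooth_u assms]]) auto
  then show ?thesis by (intro smooth_on_Pair smooth_on_vector3 o f)
qed

lemma open_fibre_domain:
  assumes "P \<in> U" shows "open (fibre_domain P)"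
proof -
  let ?h = "\<lambda>z::real\<times>real. (fst z, vector [u 0 (fst z, P), u 1 (fst z, P), snd z] :: real^3)"
  have "open (V \<inter> \<Gamma> -` U)"
    using continuous_open_preimage[OF smooth_on_imp_continuous_on[OF smooth_\<Gamma>] open_V open_U] .
  then have "open ((J \<times> UNIV) \<inter> ?h -` (V \<inter> \<Gamma> -` U))"
    by (intro continuous_open_preimage[OF smooth_on_imp_continuous_on[OF smooth_vector_arg[OF assms]]]
        open_Times open_J open_UNIV)
  moreover have "(J \<times> UNIV) \<inter> ?h -` (V \<inter> \<Gamma> -` U) = fibre_domain P"
    by (auto simp: fibre_domain_def fibre_param_def)
  ultimately show ?thesis by simp
qed

lemma smooth_fibre_param:
  assumes "P \<in> U" shows "smooth_on (fibre_domain P) (fibre_param P)"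
proof -
  let ?h = "\<lambda>z::real\<times>real. (fst z, vector [u 0 (fst z, P), u 1 (fst z, P), snd z] :: real^3)"
  have "smooth_on (fibre_domain P) (\<lambda>z. \<Gamma> (?h z))"
    by (rule smooth_on_compose[OF open_fibre_domain[OF assms] open_V _
          smooth_on_subset[OF smooth_vector_arg[OF assms]] smooth_\<Gamma>])
      (auto simp: fibre_domain_def)
  then show ?thesis unfolding fibre_param_def[abs_def] .
qed

lemma interval_fibre_domain: "x \<in> J \<Longrightarrow> is_interval {t. (x, t) \<in> fibre_domain P}"
  using interval_fibre[of x "u 0 (x, P)" "u 1 (x, P)"] by (simp add: fibre_domain_def fibre_param_def)

lemma open_fibre_section:
  assumes "P \<in> U" shows "open {t. (x, t) \<in> fibre_domain P}"
  using open_vimage[OF open_fibre_domain[OF assms], of "\<lambda>t. (x, t)"]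
  by (simp add: vimage_def continuous_intros)

lemma inj_fibre_param: "inj_on (\<lambda>t. fibre_param P (x, t)) {t. (x, t) \<in> fibre_domain P}"
  by (rule inj_onI) (metis jet2_fibre_param(3) mem_Collect_eq)

text \<open>Along the curve \<open>u 2\<close> inverts the parametrization. Differentiating that
  identity shows that the velocity pairs with \<open>\<gamma> 2\<close> to 1, so it cannot
  vanish.\<close>

lemma fibre_param_vector_derivative:
  assumes "P \<in> U" "(x, t) \<in> fibre_domain P"
  shows "((\<lambda>t. fibre_param P (x, t)) has_vector_derivative vector_derivative (\<lambda>t. fibre_param P (x, t)) (at t)) (at t)"
    and "vector_derivative (\<lambda>t. fibre_param P (x, t)) (at t) \<noteq> 0"
proof -
  let ?E = "\<lambda>t. fibre_param P (x, t)"
  let ?w = "vector_derivative ?E (at t)"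
  have "(?E has_derivative (\<lambda>h. frechet_derivative (fibre_param P) (at (x, t)) (0, h))) (at t)"
    by (rule has_derivative_compose[of "\<lambda>t. (x, t)" "\<lambda>h. (0, h)" t UNIV "fibre_param P"])
      (auto intro!: derivative_eq_intros smooth_on_has_derivative[OF smooth_fibre_param[OF assms(1)] assms(2)])
  then have "?E differentiable (at t)" by (rule differentiableI)
  then show E: "(?E has_vector_derivative ?w) (at t)"
    using vector_derivative_works by blast
  have x: "x \<in> J" "?E t \<in> U" using assms(2) by (auto simp: fibre_domain_def)
  have "((\<lambda>t. u 2 (x, ?E t)) has_derivative (\<lambda>h. 0 * u (Suc 2) (x, ?E t) + \<gamma> 2 (x, ?E t) \<bullet> (h *\<^sub>R ?w))) (at t)"
    using E x by (intro has_derivative_u_compose) (auto simp: has_vector_derivative_def)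
  moreover have "((\<lambda>t. u 2 (x, ?E t)) has_derivative (\<lambda>h. h)) (at t)"
    by (rule has_derivative_transform_within_open[OF has_derivative_ident open_fibre_section[OF assms(1), of x]])
      (use assms(2) jet2_fibre_param(3) in auto)
  ultimately have "(\<lambda>h. 0 * u (Suc 2) (x, ?E t) + \<gamma> 2 (x, ?E t) \<bullet> (h *\<^sub>R ?w)) = (\<lambda>h. h)"
    by (rule has_derivative_unique)
  then have "\<gamma> 2 (x, ?E t) \<bullet> ?w = 1" by (metis (no_types, lifting) add_0 mult_zero_left scaleR_one)
  then show "?w \<noteq> 0" by auto
qed

lemma connected_fibre:
  assumes "x \<in> J" "P \<in> U" shows "connected (fibre x P)"
proof -
  have "continuous_on {t. (x, t) \<in> fibre_domain P} (\<lambda>t. fibre_param P (x, t))"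
    using fibre_param_vector_derivative(1)[OF assms(2)]
    by (auto intro!: continuous_at_imp_continuous_on has_vector_derivative_continuous)
  then show ?thesis
    unfolding fibre_eq_image[OF assms(1)]
    by (intro connected_continuous_image is_interval_connected interval_fibre_domain assms(1))
qed

lemma vertex_in_fibre: "P \<in> U \<Longrightarrow> P \<in> fibre x P"
  by (simp add: fibre_def contact_def)

text \<open>Another value of y'' close to that of \<open>P\<close> gives a second point. With it,
  every \<open>x\<close> in \<open>J\<close> is the point of contact of some member of the punctured
  cone, and fibres at different \<open>x\<close> are different sets.\<close>

lemma fibre_nontrivial:
  assumes "x \<in> J" "P \<in> U"
  obtains Q where "Q \<in> fibre x P" "Q \<noteq> P"
proof -
  let ?T = "{t. (x, t) \<in> fibre_domain P}"
  have "u 2 (x, P) \<in> ?T" using fibre_param_contact(1)[OF assms, of P] by (simp add: contact_def)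
  then obtain e where e: "e > 0" "ball (u 2 (x, P)) e \<subseteq> ?T"
    using open_fibre_section[OF assms(2), of x] open_contains_ball by blast
  let ?t = "u 2 (x, P) + e / 2"
  have "?t \<in> ball (u 2 (x, P)) e" using e(1) by (simp add: dist_real_def)
  then have t: "(x, ?t) \<in> fibre_domain P" using e(2) by blast
  then have "fibre_param P (x, ?t) \<noteq> P"
    using jet2_fibre_param(3)[OF t] e(1) by (metis add.right_neutral add_left_cancel divide_eq_0_iff less_irrefl zero_neq_numeral)
  then show ?thesis using that[of "fibre_param P (x, ?t)"] t fibre_eq_image[OF assms(1)] by blast
qed

end


section \<open>Submanifolds flattened onto coordinate subspaces, and the rulings among them\<close>

lemma embedded_submanifoldI:
  fixes L S :: "'a::euclidean_space set"
  assumes "subspace L" "dim L = k"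
    and "\<And>p. p \<in> S \<Longrightarrow> \<exists>U V \<phi> \<psi>. open U \<and> p \<in> U \<and> open V \<and> homeomorphism U V \<phi> \<psi> \<and>
        smooth_on U \<phi> \<and> smooth_on V \<psi> \<and> \<phi> ` (S \<inter> U) = L \<inter> V"
  shows "embedded_submanifold k S"
  unfolding embedded_submanifold_def
proof
  fix p assume "p \<in> S"
  then obtain U V \<phi> \<psi> where "open U \<and> p \<in> U \<and> open V \<and> homeomorphism U V \<phi> \<psi> \<and>
        smooth_on U \<phi> \<and> smooth_on V \<psi> \<and> \<phi> ` (S \<inter> U) = L \<inter> V" using assms(3)[OF \<open>p \<in> S\<close>] by (elim exE) (rule that)
  then show "\<exists>U V \<phi> \<psi> L. open U \<and> p \<in> U \<and> open V \<and> homeomorphism U V \<phi> \<psi> \<and>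
        smooth_on U \<phi> \<and> smooth_on V \<psi> \<and> subspace (L :: 'a set) \<and> dim L = k \<and> \<phi> ` (S \<inter> U) = L \<inter> V"
    using assms(1,2) by - (rule exI[of _ U], rule exI[of _ V], rule exI[of _ \<phi>], rule exI[of _ \<psi>], rule exI[of _ L], simp)
qed

definition coordinate_subspace :: "3 set \<Rightarrow> (real^3) set" where
  "coordinate_subspace d = {w. \<forall>i. i \<notin> d \<longrightarrow> w $ i = 0}"

lemma subspace_coordinate_subspace: "subspace (coordinate_subspace d)"
  by (auto simp: coordinate_subspace_def subspace_def)

lemma dim_coordinate_subspace: "dim (coordinate_subspace d) = card d"
  unfolding coordinate_subspace_def
  using dim_substandard_cart[where 'a = real, of d] by (simp add: dim_vec_eq)

lemma coordinate_subspace_simps: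
  "w \<in> coordinate_subspace {3} \<longleftrightarrow> w $ 1 = 0 \<and> w $ 2 = 0"
  "w \<in> coordinate_subspace {1, 3} \<longleftrightarrow> w $ 2 = 0"
  by (auto simp: coordinate_subspace_def forall_3)

lemma smooth_on_vec_nth: "open S \<Longrightarrow> smooth_on S (\<lambda>y. y $ i)"
  by (intro smooth_on_linear bounded_linear_vec_nth)

context solution_chart
begin

definition fibre_chart :: "real \<Rightarrow> real^3 \<Rightarrow> real^3 \<Rightarrow> real^3" where
  "fibre_chart x P R = vector [diff_u 0 P R x, diff_u 1 P R x, u 2 (x, R)]"

text \<open>The chart is the 2-jet at \<open>x\<close>, translated by the 1-jet of \<open>P\<close>;
  its inverse is therefore \<open>\<Gamma>\<close> at fixed \<open>x\<close> after undoing the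
  translation. A single chart, defined on all of \<open>U\<close>, flattens the whole fibre.\<close>

lemma fibre_chart_homeomorphism:
  assumes "x \<in> J" "P \<in> U"
  obtains W \<psi> where "open W" "homeomorphism U W (fibre_chart x P) \<psi>"
    "smooth_on U (fibre_chart x P)" "smooth_on W \<psi>"
    "fibre_chart x P ` (fibre x P \<inter> U) = coordinate_subspace {3} \<inter> W"
proof -
  let ?c = "vector [u 0 (x, P), u 1 (x, P), 0] :: real^3"
  let ?h = "\<lambda>y::real^3. (x, y + ?c)"
  define W where "W = {y. ?h y \<in> V \<and> \<Gamma> (?h y) \<in> U}"
  define \<psi> where "\<psi> y = \<Gamma> (?h y)" for y
  have sh: "smooth_on UNIV ?h"
    by (intro smooth_on_Pair smooth_on_add smooth_on_const smooth_on_linear bounded_linear_ident) auto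
  have "open (V \<inter> \<Gamma> -` U)"
    using continuous_open_preimage[OF smooth_on_imp_continuous_on[OF smooth_\<Gamma>] open_V open_U] .
  then have "open (UNIV \<inter> ?h -` (V \<inter> \<Gamma> -` U))"
    by (intro continuous_open_preimage[OF smooth_on_imp_continuous_on[OF sh]] open_UNIV)
  moreover have "UNIV \<inter> ?h -` (V \<inter> \<Gamma> -` U) = W" by (auto simp: W_def)
  ultimately have W: "open W" by simp
  have s\<psi>: "smooth_on W \<psi>"
    unfolding \<psi>_def
    by (rule smooth_on_compose[OF W open_V _ smooth_on_subset[OF sh] smooth_\<Gamma>]) (auto simp: W_def)
  have s\<phi>: "smooth_on U (fibre_chart x P)"
    unfolding fibre_chart_def diff_u_def
    by (intro smooth_on_vector3 smooth_on_diff smooth_on_const open_U smooth_on_fixed_point[OF smooth_u assms(1)])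
  have chart: "fibre_chart x P R = jet2 (x, R) - ?c" for R
    by (simp add: fibre_chart_def diff_u_def jet2_def vec_eq_iff forall_3)
  have 1: "\<psi> (fibre_chart x P R) = R" "fibre_chart x P R \<in> W" if "R \<in> U" for R
    using \<Gamma>_jet2[OF assms(1) that] that by (simp_all add: \<psi>_def W_def chart)
  have 2: "fibre_chart x P (\<psi> y) = y" "\<psi> y \<in> U" if "y \<in> W" for y
    using jet2_\<Gamma>[OF assms(1), of "y + ?c"] that by (simp_all add: \<psi>_def W_def chart)
  have hom: "homeomorphism U W (fibre_chart x P) \<psi>"
    by (rule homeomorphismI)
      (use 1 2 smooth_on_imp_continuous_on[OF s\<phi>] smooth_on_imp_continuous_on[OF s\<psi>] in auto)
  have iff: "R \<in> fibre x P \<longleftrightarrow> fibre_chart x P R \<in> coordinate_subspace {3}" if "R \<in> U" for R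
    using that by (auto simp: fibre_def coordinate_subspace_simps fibre_chart_def contact_iff_diff)
  have "fibre_chart x P ` (fibre x P \<inter> U) = coordinate_subspace {3} \<inter> W"
    using iff 1 2 by (auto simp: image_iff) (metis IntI)
  then show ?thesis using that W hom s\<phi> s\<psi> by blast
qed

lemma embedded_fibre:
  assumes "x \<in> J" "P \<in> U" shows "embedded_submanifold 1 (fibre x P)"
proof (rule embedded_submanifoldI[OF subspace_coordinate_subspace, of "{3}"])
  fix p assume p: "p \<in> fibre x P"
  obtain W \<psi> where "open W" "homeomorphism U W (fibre_chart x P) \<psi>"
    "smooth_on U (fibre_chart x P)" "smooth_on W \<psi>"
    "fibre_chart x P ` (fibre x P \<inter> U) = coordinate_subspace {3} \<inter> W"
    using fibre_chart_homeomorphism[OF assms] by blast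
  moreover have "p \<in> U" using p by (simp add: fibre_def)
  ultimately show "\<exists>U V \<phi> \<psi>. open U \<and> p \<in> U \<and> open V \<and> homeomorphism U V \<phi> \<psi> \<and>
        smooth_on U \<phi> \<and> smooth_on V \<psi> \<and> \<phi> ` (fibre x P \<inter> U) = coordinate_subspace {3} \<inter> V"
    using open_U by blast
qed (simp add: dim_coordinate_subspace)

lemma ruling_nonzero: "z \<in> J \<times> U \<Longrightarrow> ruling z \<noteq> 0"
  using ruling_a by fastforce

text \<open>In the chart, tangency to the fibre means that \<open>w\<close> is orthogonal to
  \<open>\<gamma> 0\<close> and \<open>\<gamma> 1\<close>; in three dimensions these two conditions
  leave the line of their cross product.\<close>

lemma tangent_fibre:
  assumes "x \<in> J" "P \<in> U" shows "tangent_space (fibre x P) P = span {ruling (x, P)}"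
proof -
  obtain W \<psi> where W: "open W" "homeomorphism U W (fibre_chart x P) \<psi>"
    "smooth_on U (fibre_chart x P)" "smooth_on W \<psi>"
    "fibre_chart x P ` (fibre x P \<inter> U) = coordinate_subspace {3} \<inter> W"
    using fibre_chart_homeomorphism[OF assms] by blast
  let ?D = "frechet_derivative (fibre_chart x P) (at P)"
  have D: "(fibre_chart x P has_derivative ?D) (at P)"
    using smooth_on_has_derivative[OF W(3) assms(2)] .
  have 1: "?D w $ 1 = \<gamma> 0 (x, P) \<bullet> w" for w
  proof -
    have "((\<lambda>R. fibre_chart x P R $ 1) has_derivative (\<lambda>w. ?D w $ 1)) (at P)"
      using bounded_linear.has_derivative[OF bounded_linear_vec_nth D] .
    moreover have "((\<lambda>R. fibre_chart x P R $ 1) has_derivative (\<lambda>w. \<gamma> 0 (x, P) \<bullet> w - 0)) (at P)"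
      unfolding fibre_chart_def diff_u_def vector_3
      by (intro has_derivative_diff has_derivative_u_parameter assms has_derivative_const)
    ultimately show ?thesis by (metis (no_types, lifting) diff_zero has_derivative_unique)
  qed
  have 2: "?D w $ 2 = \<gamma> 1 (x, P) \<bullet> w" for w
  proof -
    have "((\<lambda>R. fibre_chart x P R $ 2) has_derivative (\<lambda>w. ?D w $ 2)) (at P)"
      using bounded_linear.has_derivative[OF bounded_linear_vec_nth D] .
    moreover have "((\<lambda>R. fibre_chart x P R $ 2) has_derivative (\<lambda>w. \<gamma> 1 (x, P) \<bullet> w - 0)) (at P)"
      unfolding fibre_chart_def diff_u_def vector_3
      by (intro has_derivative_diff has_derivative_u_parameter assms has_derivative_const)
    ultimately show ?thesis by (metis (no_types, lifting) diff_zero has_derivative_unique)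
  qed
  have "tangent_space (fibre x P) P = {w. ?D w \<in> coordinate_subspace {3}}"
    by (rule tangent_space_chart[OF open_U assms(2) W(1-4) subspace_coordinate_subspace W(5) vertex_in_fibre[OF assms(2)]])
  also have "\<dots> = span {ruling (x, P)}"
    using span_cross3[of "\<gamma> 0 (x, P)" "\<gamma> 1 (x, P)"] ruling_nonzero[of "(x, P)"] assms
    by (simp add: coordinate_subspace_simps 1 2 ruling_def)
  finally show ?thesis .
qed


section \<open>The cones\<close>

text \<open>The first coordinate is the point of contact with \<open>P\<close>; the cone is the slice where the second
  coordinate vanishes.\<close>

definition cone_param :: "real^3 \<Rightarrow> real^3 \<Rightarrow> real^3" where
  "cone_param P z = \<Gamma> (z $ 1, vector [u 0 (z $ 1, P) + z $ 2, u 1 (z $ 1, P), z $ 3])"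

text \<open>The last clause removes the vertex: on the slice where the second coordinate is 0,
  equality of y'' would mean that the solution has the 2-jet of \<open>P\<close>. It is also what
  makes the parametrization nondegenerate.\<close>

definition cone_domain :: "real^3 \<Rightarrow> (real^3) set" where
  "cone_domain P = {z. z $ 1 \<in> J \<and> (z $ 1, vector [u 0 (z $ 1, P) + z $ 2, u 1 (z $ 1, P), z $ 3]) \<in> V
    \<and> cone_param P z \<in> U \<and> z $ 3 \<noteq> u 2 (z $ 1, P)}"

lemma
  assumes "P \<in> U"
  shows open_cone_domain: "open (cone_domain P)"
    and smooth_cone_param: "smooth_on (cone_domain P) (cone_param P)"
proof -
  let ?S = "{z::real^3. z $ 1 \<in> J}"
  let ?h = "\<lambda>z::real^3. (z $ 1, vector [u 0 (z $ 1, P) + z $ 2, u 1 (z $ 1, P), z $ 3] :: real^3)"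
  have S: "open ?S" using open_vimage[OF open_J, of "\<lambda>z::real^3. z $ 1"]
    by (simp add: vimage_def continuous_intros)
  have u: "smooth_on ?S (\<lambda>z. u k (z $ 1, P))" for k
    by (rule smooth_on_compose[OF S open_J _ smooth_on_vec_nth[OF S] smooth_on_fixed_parameter[OF smooth_u assms]]) auto
  have h: "smooth_on ?S ?h"
    by (intro smooth_on_Pair smooth_on_vector3 smooth_on_add smooth_on_vec_nth S u)
  have "open (V \<inter> \<Gamma> -` U)"
    using continuous_open_preimage[OF smooth_on_imp_continuous_on[OF smooth_\<Gamma>] open_V open_U] .
  then have "open (?S \<inter> ?h -` (V \<inter> \<Gamma> -` U))"
    by (intro continuous_open_preimage[OF smooth_on_imp_continuous_on[OF h]] S)
  moreover have "open (?S \<inter> (\<lambda>z. z $ 3 - u 2 (z $ 1, P)) -` (- {0}))"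
    by (intro continuous_open_preimage[OF smooth_on_imp_continuous_on] smooth_on_diff smooth_on_vec_nth S u) auto
  ultimately have "open ((?S \<inter> ?h -` (V \<inter> \<Gamma> -` U)) \<inter> (?S \<inter> (\<lambda>z. z $ 3 - u 2 (z $ 1, P)) -` (- {0})))"
    by (rule open_Int)
  moreover have "(?S \<inter> ?h -` (V \<inter> \<Gamma> -` U)) \<inter> (?S \<inter> (\<lambda>z. z $ 3 - u 2 (z $ 1, P)) -` (- {0})) = cone_domain P"
    by (auto simp: cone_domain_def cone_param_def)
  ultimately show o: "open (cone_domain P)" by simp
  show "smooth_on (cone_domain P) (cone_param P)"
    unfolding cone_param_def[abs_def]
    by (rule smooth_on_compose[OF o open_V _ smooth_on_subset[OF h] smooth_\<Gamma>]) (auto simp: cone_domain_def)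
qed

lemma u_cone_param:
  assumes "z \<in> cone_domain P"
  shows "u 0 (z $ 1, cone_param P z) = u 0 (z $ 1, P) + z $ 2"
    "u 1 (z $ 1, cone_param P z) = u 1 (z $ 1, P)" "u 2 (z $ 1, cone_param P z) = z $ 3"
proof -
  have "jet2 (z $ 1, cone_param P z) = vector [u 0 (z $ 1, P) + z $ 2, u 1 (z $ 1, P), z $ 3]"
    unfolding cone_param_def using assms
    by (simp add: jet2_\<Gamma> cone_domain_def cone_param_def)
  then show "u 0 (z $ 1, cone_param P z) = u 0 (z $ 1, P) + z $ 2"
    "u 1 (z $ 1, cone_param P z) = u 1 (z $ 1, P)" "u 2 (z $ 1, cone_param P z) = z $ 3"
    by (simp_all add: jet2_def vec_eq_iff forall_3)
qed

text \<open>Differentiate the three jet identities. On a kernel vector \<open>w\<close>, the one for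
  y' says that \<open>w $ 1\<close> times the difference of the values of y'' is 0, so
  \<open>w $ 1 = 0\<close>; the other two then give \<open>w $ 2 = 0\<close> and
  \<open>w $ 3 = 0\<close>.\<close>

lemma cone_param_derivative_injective:
  assumes "P \<in> U" and z: "z \<in> cone_domain P"
  shows "inj (frechet_derivative (cone_param P) (at z))"
proof -
  let ?D = "frechet_derivative (cone_param P) (at z)"
  let ?Q = "cone_param P z"
  have J: "z $ 1 \<in> J" "?Q \<in> U" using z by (auto simp: cone_domain_def)
  have D: "(cone_param P has_derivative ?D) (at z)"
    using smooth_on_has_derivative[OF smooth_cone_param[OF assms(1)] z] .
  have nth: "((\<lambda>z::real^3. z $ i) has_derivative (\<lambda>w. w $ i)) (at z)" for i
    using bounded_linear_imp_has_derivative[OF bounded_linear_vec_nth] .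
  have uQ: "((\<lambda>z. u k (z $ 1, cone_param P z)) has_derivative
      (\<lambda>w. w $ 1 * u (Suc k) (z $ 1, ?Q) + \<gamma> k (z $ 1, ?Q) \<bullet> ?D w)) (at z)" for k
    by (rule has_derivative_u_compose[OF nth D J])
  have uP: "((\<lambda>z. u k (z $ 1, P)) has_derivative (\<lambda>w. w $ 1 * u (Suc k) (z $ 1, P))) (at z)" for k
    using has_derivative_u_compose[OF nth has_derivative_const J(1) assms(1), of k] by simp
  note transform = has_derivative_transform_within_open[OF _ open_cone_domain[OF assms(1)] z]
  have "((\<lambda>z. u 0 (z $ 1, P) + z $ 2) has_derivative
      (\<lambda>w. w $ 1 * u (Suc 0) (z $ 1, ?Q) + \<gamma> 0 (z $ 1, ?Q) \<bullet> ?D w)) (at z)"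
    by (rule transform[OF uQ]) (rule u_cone_param)
  then have e0: "(\<lambda>w. w $ 1 * u (Suc 0) (z $ 1, ?Q) + \<gamma> 0 (z $ 1, ?Q) \<bullet> ?D w)
      = (\<lambda>w. w $ 1 * u (Suc 0) (z $ 1, P) + w $ 2)"
    by (rule has_derivative_unique) (intro has_derivative_add uP nth)
  have "((\<lambda>z. u 1 (z $ 1, P)) has_derivative
      (\<lambda>w. w $ 1 * u (Suc 1) (z $ 1, ?Q) + \<gamma> 1 (z $ 1, ?Q) \<bullet> ?D w)) (at z)"
    by (rule transform[OF uQ]) (rule u_cone_param)
  then have e1: "(\<lambda>w. w $ 1 * u (Suc 1) (z $ 1, ?Q) + \<gamma> 1 (z $ 1, ?Q) \<bullet> ?D w)
      = (\<lambda>w. w $ 1 * u (Suc 1) (z $ 1, P))"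
    by (rule has_derivative_unique) (intro uP)
  have "((\<lambda>z. z $ 3) has_derivative
      (\<lambda>w. w $ 1 * u (Suc 2) (z $ 1, ?Q) + \<gamma> 2 (z $ 1, ?Q) \<bullet> ?D w)) (at z)"
    by (rule transform[OF uQ]) (rule u_cone_param)
  then have e2: "(\<lambda>w. w $ 1 * u (Suc 2) (z $ 1, ?Q) + \<gamma> 2 (z $ 1, ?Q) \<bullet> ?D w) = (\<lambda>w. w $ 3)"
    by (rule has_derivative_unique) (intro nth)
  have ne: "u (Suc 1) (z $ 1, ?Q) \<noteq> u (Suc 1) (z $ 1, P)"
    using u_cone_param(3)[OF z] z by (simp add: cone_domain_def numeral_2_eq_2)
  show ?thesis
    unfolding linear_injective_0[OF has_derivative_linear[OF D]]
  proof (intro allI impI)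
    fix w assume w: "?D w = 0"
    have "w $ 1 * u (Suc 1) (z $ 1, ?Q) = w $ 1 * u (Suc 1) (z $ 1, P)"
      using fun_cong[OF e1, of w] w by simp
    then have 1: "w $ 1 = 0" using ne by simp
    then show "w = 0" using fun_cong[OF e0, of w] fun_cong[OF e2, of w] w
      by (simp add: vec_eq_iff forall_3)
  qed
qed

text \<open>A local inverse of \<open>cone_param\<close> only sees cone points whose contact with
  \<open>P\<close> is near \<open>x\<close>. To be a chart of the cone it has to be restricted to a
  \<open>B\<close> in which no cone point touches \<open>P\<close> elsewhere.\<close>

lemma cone_chart:
  assumes P: "P \<in> U" and Q: "Q \<in> U" "Q \<noteq> P" and x: "x \<in> J" "contact x P Q"
  obtains B W \<phi> where "open B" "Q \<in> B" "open W" "homeomorphism B W \<phi> (cone_param P)"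
    "smooth_on B \<phi>" "smooth_on W (cone_param P)"
    "\<phi> ` ((cone P - {P}) \<inter> B) = coordinate_subspace {1, 3} \<inter> W"
    "\<And>w. frechet_derivative \<phi> (at Q) w \<in> coordinate_subspace {1, 3} \<longleftrightarrow> \<gamma> 0 (x, Q) \<bullet> w = 0"
proof -
  define z where "z = (vector [x, 0, u 2 (x, Q)] :: real^3)"
  have zQ: "cone_param P z = Q" and zV: "(x, vector [u 0 (x, P), u 1 (x, P), u 2 (x, Q)]) \<in> V"
    using \<Gamma>_jet2[OF x(1) Q(1)] x(2) by (simp_all add: cone_param_def z_def contact_def jet2_def)
  obtain \<sigma> where \<sigma>: "\<sigma> = 1 \<or> \<sigma> = -1" "\<And>y. y \<in> J \<Longrightarrow> \<sigma> * diff_u 2 P Q y > 0"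
    "\<And>y. y \<in> J \<Longrightarrow> y < x \<Longrightarrow> \<sigma> * diff_u 1 P Q y < 0"
    "\<And>y. y \<in> J \<Longrightarrow> x < y \<Longrightarrow> \<sigma> * diff_u 1 P Q y > 0"
    by (rule contact_sign[OF P Q(1) Q(2)[symmetric] x]) (rule that)
  have "u 2 (x, Q) \<noteq> u 2 (x, P)" using \<sigma>(2)[OF x(1)] by (auto simp: diff_u_def)
  then have z: "z \<in> cone_domain P" using zV zQ x Q by (simp add: cone_domain_def z_def)
  obtain A N \<phi> where A: "open A" "A \<subseteq> cone_domain P" "z \<in> A" "open N" "cone_param P z \<in> N"
    "homeomorphism A N (cone_param P) \<phi>" "smooth_on N \<phi>"
    by (rule smooth_inverse_function_theorem[OF open_cone_domain[OF P] smooth_cone_param[OF P] z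
        cone_param_derivative_injective[OF P z]]) (rule that)
  have QN: "Q \<in> N" using A(5) zQ by simp
  have \<phi>N: "\<phi> R \<in> A" "cone_param P (\<phi> R) = R" if "R \<in> N" for R
    using A(6) that by (auto simp: homeomorphism_def)
  have \<phi>A: "\<phi> (cone_param P z) = z" "cone_param P z \<in> N" if "z \<in> A" for z
    using A(6) that by (auto simp: homeomorphism_def)
  \<comment> \<open>The coordinates that a solution should receive when it touches \<open>P\<close>
    at \<open>fst q\<close>. On \<open>X \<times> Y\<close> they fall into \<open>A\<close>, where
    \<open>\<phi>\<close> is a genuine inverse.\<close>
  let ?lift = "\<lambda>q::real \<times> (real^3). vector [fst q, 0, u 2 q] :: real^3"
  have "smooth_on (J \<times> U) ?lift"
    by (intro smooth_on_vector3 open_JU smooth_on_linear smooth_u smooth_on_const bounded_linear_fst)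
  then have "open ((J \<times> U) \<inter> ?lift -` A)"
    by (intro continuous_open_preimage[OF smooth_on_imp_continuous_on] open_JU A)
  moreover have "(x, Q) \<in> (J \<times> U) \<inter> ?lift -` A" using x Q A(3) by (simp add: z_def)
  ultimately obtain X Y where XY: "open X" "open Y" "x \<in> X" "Q \<in> Y" "X \<times> Y \<subseteq> (J \<times> U) \<inter> ?lift -` A"
    by (rule open_prod_elim) (auto simp: mem_Times_iff)
  have XJ: "X \<subseteq> J" and YU: "Y \<subseteq> U" using XY by blast+
  \<comment> \<open>A closed ball, so that the endpoints \<open>x - e\<close> and
    \<open>x + e\<close>, where signs will be tested, belong to \<open>X\<close> and hence to
    \<open>J\<close>.\<close>
  obtain e where e: "e > 0" "cball x e \<subseteq> X" using XY(1,3) open_contains_cball by blast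
  then have eX: "t \<in> X" if "x - e \<le> t" "t \<le> x + e" for t
    using that by (auto simp: subset_eq dist_real_def)
  have eJ: "x - e \<in> J" "x + e \<in> J" using eX[of "x - e"] eX[of "x + e"] e(1) XJ by auto
  \<comment> \<open>The sign of y'' at \<open>x\<close> fixes whether a cone point \<open>R\<close>
    lies on the same side of \<open>P\<close> as \<open>Q\<close>. Given that,
    \<open>diff_u 1 P R\<close> changes sign in a known direction at the contact, so its signs at
    \<open>x - e\<close> and \<open>x + e\<close> confine the contact between them. All three
    conditions are open and hold at \<open>Q\<close>.\<close>
  define B where "B = (N \<inter> Y) \<inter> (U \<inter> (\<lambda>R. \<sigma> * diff_u 1 P R (x - e)) -` {..<0})
      \<inter> (U \<inter> (\<lambda>R. \<sigma> * diff_u 1 P R (x + e)) -` {0<..}) \<inter> (U \<inter> (\<lambda>R. \<sigma> * diff_u 2 P R x) -` {0<..})"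
  have cont: "continuous_on U (\<lambda>R. \<sigma> * diff_u k P R y)" if "y \<in> J" for k y
    unfolding diff_u_def
    by (intro continuous_intros smooth_on_imp_continuous_on smooth_on_fixed_point[OF smooth_u that])
  have B: "open B"
    unfolding B_def by (intro open_Int A XY continuous_open_preimage cont eJ x open_U) auto
  have QB: "Q \<in> B" using QN XY(4) Q \<sigma>(2)[OF x(1)] \<sigma>(3)[OF eJ(1)] \<sigma>(4)[OF eJ(2)] e(1)
    by (auto simp: B_def)
  define W where "W = A \<inter> cone_param P -` B"
  have "continuous_on A (cone_param P)" using A(6) by (simp add: homeomorphism_def)
  then have W: "open W"
    unfolding W_def by (intro continuous_open_preimage A B)
  have \<phi>BW: "\<phi> ` B = W"
  proof (intro equalityI subsetI)
    fix y assume "y \<in> \<phi> ` B"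
    then obtain R where "R \<in> B" "y = \<phi> R" by blast
    then show "y \<in> W" using \<phi>N[of R] by (simp add: W_def B_def)
  next
    fix y assume "y \<in> W"
    then have "y \<in> A" "cone_param P y \<in> B" by (auto simp: W_def)
    then show "y \<in> \<phi> ` B" using \<phi>A(1) by (metis imageI)
  qed
  have hom: "homeomorphism B W \<phi> (cone_param P)"
    by (rule homeomorphism_of_subsets[OF homeomorphism_symD[OF A(6)] _ empty_subsetI \<phi>BW])
      (auto simp: B_def)
  show ?thesis
  proof (rule that[OF B QB W hom])
    show "smooth_on B \<phi>" using A(7) by (rule smooth_on_subset) (auto simp: B_def)
    show "smooth_on W (cone_param P)"
      by (rule smooth_on_subset[OF smooth_cone_param[OF P]]) (use A(2) in \<open>auto simp: W_def\<close>)
    show "\<phi> ` ((cone P - {P}) \<inter> B) = coordinate_subspace {1, 3} \<inter> W"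
    proof (intro equalityI subsetI)
      fix y assume "y \<in> \<phi> ` ((cone P - {P}) \<inter> B)"
      then obtain R where R: "R \<in> cone P" "R \<noteq> P" "R \<in> B" "y = \<phi> R" by blast
      then obtain t where t: "t \<in> J" "contact t P R" "R \<in> U" by (auto simp: cone_def)
      obtain \<tau> where \<tau>: "\<tau> = 1 \<or> \<tau> = -1" "\<And>y. y \<in> J \<Longrightarrow> \<tau> * diff_u 2 P R y > 0"
        "\<And>y. y \<in> J \<Longrightarrow> y < t \<Longrightarrow> \<tau> * diff_u 1 P R y < 0"
        "\<And>y. y \<in> J \<Longrightarrow> t < y \<Longrightarrow> \<tau> * diff_u 1 P R y > 0"
        by (rule contact_sign[OF P t(3) R(2)[symmetric] t(1,2)]) (rule that)
      have B': "\<sigma> * diff_u 1 P R (x - e) < 0" "\<sigma> * diff_u 1 P R (x + e) > 0" "\<sigma> * diff_u 2 P R x > 0"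
        using R(3) by (auto simp: B_def)
      have "\<tau> = \<sigma>" using \<tau>(1) \<sigma>(1) \<tau>(2)[OF x(1)] B'(3) by auto
      have "\<not> t < x - e" using \<tau>(4)[OF eJ(1)] B'(1) \<open>\<tau> = \<sigma>\<close> by auto
      moreover have "\<not> t > x + e" using \<tau>(3)[OF eJ(2)] B'(2) \<open>\<tau> = \<sigma>\<close> by auto
      ultimately have "t \<in> X" using eX by simp
      moreover have "R \<in> Y" using R(3) by (simp add: B_def)
      ultimately have l: "?lift (t, R) \<in> A" using XY(5) by auto
      have "cone_param P (?lift (t, R)) = R"
        using \<Gamma>_jet2[OF t(1,3)] t(2) by (simp add: cone_param_def contact_def jet2_def)
      then have "y = ?lift (t, R)" using \<phi>A(1)[OF l] R(4) by simp
      then show "y \<in> coordinate_subspace {1, 3} \<inter> W"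
        using imageI[OF R(3), of \<phi>] by (simp add: coordinate_subspace_simps \<phi>BW flip: R(4))
    next
      fix y assume y: "y \<in> coordinate_subspace {1, 3} \<inter> W"
      then have yA: "y \<in> A" "cone_param P y \<in> B" "y $ 2 = 0" by (auto simp: W_def coordinate_subspace_simps)
      then have yd: "y \<in> cone_domain P" using A(2) by blast
      have "contact (y $ 1) P (cone_param P y)"
        using u_cone_param[OF yd] yA(3) by (simp add: contact_def)
      moreover have "cone_param P y \<noteq> P" using u_cone_param(3)[OF yd] yd by (auto simp: cone_domain_def)
      ultimately have "cone_param P y \<in> cone P - {P}"
        using yd by (auto simp: cone_def cone_domain_def)
      then show "y \<in> \<phi> ` ((cone P - {P}) \<inter> B)"
        using yA(2) \<phi>A(1)[OF yA(1)] by (metis IntI imageI)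
    qed
  next
    fix w
    let ?D = "frechet_derivative \<phi> (at Q)"
    have D: "(\<phi> has_derivative ?D) (at Q)" using smooth_on_has_derivative[OF A(7) QN] .
    have Dn: "((\<lambda>R. \<phi> R $ i) has_derivative (\<lambda>w. ?D w $ i)) (at Q)" for i
      using bounded_linear.has_derivative[OF bounded_linear_vec_nth D] .
    have \<phi>Q: "\<phi> Q = z" using \<phi>A(1)[OF A(3)] zQ by simp
    have c: "\<phi> Q $ 1 = x" by (simp add: \<phi>Q z_def)
    have "((\<lambda>R. u 0 (\<phi> R $ 1, R) - u 0 (\<phi> R $ 1, P)) has_derivative
       (\<lambda>w. (?D w $ 1 * u (Suc 0) (\<phi> Q $ 1, Q) + \<gamma> 0 (\<phi> Q $ 1, Q) \<bullet> w)
          - (?D w $ 1 * u (Suc 0) (\<phi> Q $ 1, P) + \<gamma> 0 (\<phi> Q $ 1, P) \<bullet> 0))) (at Q)"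
      by (intro has_derivative_diff has_derivative_u_compose Dn has_derivative_ident has_derivative_const)
        (use c x P Q in auto)
    moreover have "u 0 (\<phi> R $ 1, R) - u 0 (\<phi> R $ 1, P) = \<phi> R $ 2" if "R \<in> N" for R
      using u_cone_param(1)[of "\<phi> R" P] \<phi>N[OF that] A(2) by auto
    ultimately have "((\<lambda>R. \<phi> R $ 2) has_derivative
       (\<lambda>w. (?D w $ 1 * u (Suc 0) (\<phi> Q $ 1, Q) + \<gamma> 0 (\<phi> Q $ 1, Q) \<bullet> w)
          - (?D w $ 1 * u (Suc 0) (\<phi> Q $ 1, P) + \<gamma> 0 (\<phi> Q $ 1, P) \<bullet> 0))) (at Q)"
      by (rule has_derivative_transform_within_open[OF _ A(4) QN])
    from has_derivative_unique[OF Dn this] have "?D w $ 2 = (?D w $ 1 * u (Suc 0) (x, Q) + \<gamma> 0 (x, Q) \<bullet> w)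
          - (?D w $ 1 * u (Suc 0) (x, P) + \<gamma> 0 (x, P) \<bullet> 0)"
      unfolding c by (rule fun_cong)
    \<comment> \<open>The variation \<open>?D w $ 1\<close> of the point of contact is multiplied by
      the difference of the first derivatives of \<open>Q\<close> and \<open>P\<close>, which is 0
      at the contact.\<close>
    also have "\<dots> = \<gamma> 0 (x, Q) \<bullet> w" using x(2) by (simp add: contact_def)
    finally show "?D w \<in> coordinate_subspace {1, 3} \<longleftrightarrow> \<gamma> 0 (x, Q) \<bullet> w = 0"
      by (simp add: coordinate_subspace_simps)
  qed
qed

lemma embedded_cone:
  assumes "P \<in> U" shows "embedded_submanifold 2 (cone P - {P})"
proof (rule embedded_submanifoldI[OF subspace_coordinate_subspace, of "{1, 3}"])
  fix Q assume "Q \<in> cone P - {P}"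
  then obtain x where x: "Q \<in> U" "Q \<noteq> P" "x \<in> J" "contact x P Q" by (auto simp: cone_def)
  show "\<exists>U V \<phi> \<psi>. open U \<and> Q \<in> U \<and> open V \<and> homeomorphism U V \<phi> \<psi> \<and>
        smooth_on U \<phi> \<and> smooth_on V \<psi> \<and> \<phi> ` ((cone P - {P}) \<inter> U) = coordinate_subspace {1, 3} \<inter> V"
    by (rule cone_chart[OF assms x]) blast
qed (simp add: dim_coordinate_subspace)

lemma tangent_cone:
  assumes "P \<in> U" "Q \<in> U" "Q \<noteq> P" "x \<in> J" "contact x P Q"
  shows "tangent_space (cone P - {P}) Q = {w. \<gamma> 0 (x, Q) \<bullet> w = 0}"
proof -
  have Q: "Q \<in> cone P - {P}" using assms by (auto simp: cone_def)
  show ?thesis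
  proof (rule cone_chart[OF assms])
    fix B W \<phi>
    assume h: "open B" "Q \<in> B" "open W" "homeomorphism B W \<phi> (cone_param P)"
      "smooth_on B \<phi>" "smooth_on W (cone_param P)"
      "\<phi> ` ((cone P - {P}) \<inter> B) = coordinate_subspace {1, 3} \<inter> W"
      "\<And>w. frechet_derivative \<phi> (at Q) w \<in> coordinate_subspace {1, 3} \<longleftrightarrow> \<gamma> 0 (x, Q) \<bullet> w = 0"
    show ?thesis
      using tangent_space_chart[OF h(1-6) subspace_coordinate_subspace h(7) Q] h(8) by simp
  qed
qed

end


section \<open>The indicatrix\<close>

lemma dim_pair_cross3:
  fixes v w :: "real^3"
  assumes "cross3 v w \<noteq> 0" shows "dim {v, w} = 2"
proof -
  have "v \<notin> span {w}"
  proof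
    assume "v \<in> span {w}"
    then obtain k where "v = k *\<^sub>R w" by (auto simp: span_singleton)
    then show False using assms by (simp add: cross_mult_left)
  qed
  moreover have "w \<noteq> 0" using assms by auto
  ultimately have "independent {v, w}" by (auto simp: independent_insert)
  moreover have "v \<noteq> w" using assms by auto
  ultimately show ?thesis by (simp add: dim_eq_card_independent)
qed

text \<open>For \<open>A = \<gamma> 0\<close> this says that \<open>ruling\<close> and
  \<open>ruling'\<close> have as cross product the Wronskian times \<open>\<gamma> 0\<close>: they
  are independent, and the tangent line of the indicatrix is the plane orthogonal to
  \<open>\<gamma> 0\<close>.\<close>

lemma cross3_cross3_common:
  "cross3 (cross3 A B) (cross3 A C) = (A \<bullet> cross3 B C) *\<^sub>R A"
  by (simp add: cross3_simps forall_3)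

text \<open>Invariance under nonzero scaling makes \<open>X\<close> the full preimage of its image,
  so openness in the quotient is openness of \<open>X\<close>.\<close>

lemma proj_open_span_image:
  fixes X :: "'a::euclidean_space set"
  assumes "open X" "0 \<notin> X" and scale: "\<And>w k. w \<in> X \<Longrightarrow> k \<noteq> 0 \<Longrightarrow> k *\<^sub>R w \<in> X"
  shows "proj_open ((\<lambda>w. span {w}) ` X)"
proof -
  have "w \<in> X" if "w \<noteq> 0" "span {w} = span {w'}" "w' \<in> X" for w w'
  proof -
    have "w \<in> span {w'}" using that(2) span_base by blast
    then obtain k where "w = k *\<^sub>R w'" by (auto simp: span_singleton)
    then show ?thesis using that scale by auto
  qed
  then have "{w. w \<noteq> 0 \<and> span {w} \<in> (\<lambda>w. span {w}) ` X} = X"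
    using assms(2) by auto
  then show ?thesis using assms(1,2) by (auto simp: proj_open_def)
qed

lemma continuous_map_span:
  fixes v :: "real \<Rightarrow> 'a::euclidean_space"
  assumes "continuous_on J v" "\<And>t. t \<in> J \<Longrightarrow> v t \<noteq> 0"
  shows "continuous_map (top_of_set J) proj_topology (\<lambda>t. span {v t})"
proof -
  \<comment> \<open>The \<open>topspace\<close> is the union of the open sets, so identifying it
    requires that the set of all lines be open.\<close>
  have top: "topspace (proj_topology :: 'a set topology) = {span {w} | w. w \<noteq> 0}"
  proof -
    have "{w::'a. w \<noteq> 0 \<and> span {w} \<in> {span {w} | w. w \<noteq> 0}} = - {0}" by auto
    then have "proj_open {span {w} | w::'a. w \<noteq> 0}" by (simp add: proj_open_def open_Compl)
    then have "{span {w} | w::'a. w \<noteq> 0} \<subseteq> topspace proj_topology"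
      using openin_subset[of "proj_topology :: 'a set topology"] by (simp add: openin_proj_topology)
    moreover have "proj_open (topspace (proj_topology :: 'a set topology))"
      using openin_topspace[of "proj_topology :: 'a set topology"] by (simp only: openin_proj_topology)
    ultimately show ?thesis by (simp add: proj_open_def)
  qed
  have "openin (top_of_set J) {t \<in> J. span {v t} \<in> \<W>}" if "proj_open \<W>" for \<W>
  proof -
    have eq: "{t \<in> J. span {v t} \<in> \<W>} = J \<inter> v -` {w. w \<noteq> 0 \<and> span {w} \<in> \<W>}" using assms(2) by auto
    have "open {w. w \<noteq> 0 \<and> span {w} \<in> \<W>}" using that by (simp add: proj_open_def)
    then show ?thesis
      unfolding eq by (rule continuous_openin_preimage_gen[OF assms(1)])
  qed
  then show ?thesis
    using assms(2) by (auto simp: continuous_map_def top openin_proj_topology)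
qed

context solution_chart
begin

lemma inner_ruling_derivative:
  assumes "P \<in> U" "x \<in> J"
  shows "((\<lambda>x. c \<bullet> ruling (x, P)) has_real_derivative c \<bullet> ruling' (x, P)) (at x)"
    "((\<lambda>x. c \<bullet> ruling' (x, P)) has_real_derivative
      c \<bullet> (cross3 (\<gamma> 1 (x, P)) (\<gamma> 2 (x, P)) + cross3 (\<gamma> 0 (x, P)) (\<gamma> 3 (x, P)))) (at x)"
  unfolding has_real_derivative_iff_has_vector_derivative
  by (intro bounded_linear.has_vector_derivative[OF bounded_linear_inner_right]
      ruling_has_vector_derivative assms)+

definition slope :: "real^3 \<Rightarrow> real" where
  "slope w = (b \<bullet> w) / (a \<bullet> w)"

text \<open>The expression in \<open>ruling_slope\<close> is the numerator of the quotient
  rule.\<close>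

lemma slope_increasing:
  assumes P: "P \<in> U" and st: "s \<in> J" "t \<in> J" "s < t"
  shows "slope (ruling (s, P)) < slope (ruling (t, P))"
proof (rule DERIV_pos_imp_increasing[OF st(3)])
  fix x assume "s \<le> x" "x \<le> t"
  then have x: "x \<in> J" using interval_J_between st by blast
  let ?d = "((b \<bullet> ruling' (x, P)) * (a \<bullet> ruling (x, P)) - (b \<bullet> ruling (x, P)) * (a \<bullet> ruling' (x, P)))
      / ((a \<bullet> ruling (x, P)) * (a \<bullet> ruling (x, P)))"
  have "((\<lambda>x. slope (ruling (x, P))) has_real_derivative ?d) (at x)"
    unfolding slope_def
    by (intro DERIV_divide inner_ruling_derivative P x) (use ruling_a P x in auto)
  moreover have "?d > 0"
    using ruling_slope[of "(x, P)"] ruling_a[of "(x, P)"] P x by (intro divide_pos_pos) (auto simp: not_square_less_zero zero_less_mult_iff)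
  ultimately show "\<exists>y. ((\<lambda>x. slope (ruling (x, P))) has_real_derivative y) (at x) \<and> 0 < y" by blast
qed

lemma inj_slope: "P \<in> U \<Longrightarrow> inj_on (\<lambda>t. slope (ruling (t, P))) J"
  by (rule inj_onI) (metis less_irrefl linorder_neqE slope_increasing)

lemma slope_scale: "k \<noteq> 0 \<Longrightarrow> slope (k *\<^sub>R w) = slope w"
  by (simp add: slope_def)

lemma continuous_ruling: "P \<in> U \<Longrightarrow> continuous_on J (\<lambda>t. ruling (t, P))"
  by (rule smooth_on_imp_continuous_on[OF smooth_on_fixed_parameter[OF smooth_ruling]])

lemma slope_eq_if_span_eq:
  assumes "P \<in> U" "t \<in> J" "span {ruling (t, P)} = span {w}"
  shows "slope (ruling (t, P)) = slope w"
proof -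
  have "ruling (t, P) \<in> span {w}" using assms(3) span_base by blast
  then obtain k where "ruling (t, P) = k *\<^sub>R w" by (auto simp: span_singleton)
  moreover have "ruling (t, P) \<noteq> 0" using ruling_nonzero assms by auto
  ultimately show ?thesis using slope_scale by force
qed

lemma open_slope_image:
  assumes P: "P \<in> U" and S: "open S" "S \<subseteq> J"
  shows "open ((\<lambda>t. slope (ruling (t, P))) ` S)"
proof -
  have "continuous_on J (\<lambda>t. slope (ruling (t, P)))"
    unfolding slope_def using ruling_a P by (intro continuous_intros continuous_ruling) auto
  then show ?thesis
    using injective_eq_1d_open_map_UNIV[OF _ interval_J] inj_slope[OF P] S by metis
qed

text \<open>The affine coordinate \<open>slope\<close> detects the parameter. An open
  \<open>S\<close> in \<open>J\<close> has an open image \<open>T\<close> under it, by strict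
  monotonicity and continuity, and the open set of lines with slope in \<open>T\<close> cuts the
  curve exactly in the image of \<open>S\<close>.\<close>

lemma embedding_ruling:
  assumes P: "P \<in> U"
  shows "embedding_map (top_of_set J) proj_topology (\<lambda>t. span {ruling (t, P)})"
proof -
  let ?f = "\<lambda>t. span {ruling (t, P)}"
  have inj: "inj_on ?f J"
    by (rule inj_onI) (metis P inj_onD inj_slope slope_eq_if_span_eq)
  have cont: "continuous_map (top_of_set J) proj_topology ?f"
    by (rule continuous_map_span[OF continuous_ruling[OF P]]) (use ruling_nonzero P in auto)
  have "open_map (top_of_set J) (subtopology proj_topology (?f ` J)) ?f"
    unfolding open_map_def
  proof (intro allI impI)
    fix S assume "openin (top_of_set J) S"
    then have S: "open S" "S \<subseteq> J" using open_J by (auto simp: openin_open_eq)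
    define T where "T = (\<lambda>t. slope (ruling (t, P))) ` S"
    have T: "open T" unfolding T_def by (rule open_slope_image[OF P S])
    define X where "X = {w. a \<bullet> w \<noteq> 0} \<inter> slope -` T"
    have "open {w. a \<bullet> w \<noteq> 0}"
      by (intro open_Collect_neq continuous_intros)
    then have "open X"
      unfolding X_def slope_def by (intro continuous_open_preimage T continuous_intros) auto
    then have "proj_open ((\<lambda>w. span {w}) ` X)"
      by (rule proj_open_span_image) (auto simp: X_def slope_scale)
    moreover have "?f ` S = (\<lambda>w. span {w}) ` X \<inter> ?f ` J"
    proof (intro equalityI subsetI IntI)
      fix l assume "l \<in> ?f ` S"
      then obtain t where t: "t \<in> S" "l = ?f t" by blast
      then show "l \<in> ?f ` J" using S(2) by blast
      have "ruling (t, P) \<in> X" using t S(2) ruling_a[of "(t, P)"] P by (auto simp: X_def T_def)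
      then show "l \<in> (\<lambda>w. span {w}) ` X" using t(2) by blast
    next
      fix l assume "l \<in> (\<lambda>w. span {w}) ` X \<inter> ?f ` J"
      then obtain w t where w: "w \<in> X" "t \<in> J" "?f t = span {w}" "l = ?f t" by auto
      then have "slope (ruling (t, P)) \<in> T" using slope_eq_if_span_eq[OF P w(2,3)] by (simp add: X_def)
      then obtain s where "s \<in> S" "slope (ruling (t, P)) = slope (ruling (s, P))" by (auto simp: T_def)
      then have "t \<in> S" using inj_onD[OF inj_slope[OF P]] w(2) S(2) by blast
      then show "l \<in> ?f ` S" using w(4) by blast
    qed
    ultimately show "openin (subtopology proj_topology (?f ` J)) (?f ` S)"
      by (auto simp: openin_subtopology openin_proj_topology)
  qed
  then have "homeomorphic_map (top_of_set J) (subtopology proj_topology (?f ` J)) ?f"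
    using inj cont continuous_map_image_subset_topspace[OF cont]
    by (intro bijective_open_imp_homeomorphic_map)
      (auto simp: continuous_map_in_subtopology inf.absorb2)
  then show ?thesis by (simp add: embedding_map_def)
qed

lemma ruling_vector_derivative:
  "P \<in> U \<Longrightarrow> t \<in> J \<Longrightarrow> vector_derivative (\<lambda>t. ruling (t, P)) (at t) = ruling' (t, P)"
  using ruling_has_vector_derivative(1) vector_derivative_at by blast

lemma dim_ruling:
  assumes "P \<in> U" "t \<in> J"
  shows "dim {ruling (t, P), ruling' (t, P)} = 2"
proof (rule dim_pair_cross3)
  have m: "\<gamma> 0 (t, P) \<bullet> cross3 (\<gamma> 1 (t, P)) (\<gamma> 2 (t, P)) \<noteq> 0"
    using mixed_wronskian assms by blast
  then have "\<gamma> 0 (t, P) \<noteq> 0" by auto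
  then show "cross3 (ruling (t, P)) (ruling' (t, P)) \<noteq> 0"
    using m by (simp add: ruling_def ruling'_def cross3_cross3_common)
qed

lemma regular_ruling:
  assumes P: "P \<in> U"
  shows "regular_proj_curve ((\<lambda>t. span {ruling (t, P)}) ` J) J (\<lambda>t. ruling (t, P))"
  unfolding regular_proj_curve_def
  by (intro conjI ballI open_J interval_J J_nonempty smooth_on_fixed_parameter[OF smooth_ruling P]
      embedding_ruling[OF P] refl) (simp add: ruling_vector_derivative[OF P] dim_ruling[OF P])

lemma no_second_order_contact:
  assumes P: "P \<in> U" and t: "t \<in> J"
  shows "\<not> line_contact 2 (\<lambda>t. ruling (t, P)) t (proj_tangent_line (\<lambda>t. ruling (t, P)) t)"
proof
  \<comment> \<open>The equation of the tangent line, frozen at \<open>t\<close>: both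
    \<open>ruling\<close> and \<open>ruling'\<close> are cross products with this vector.\<close>
  let ?c = "\<gamma> 0 (t, P)"
  assume contact: "line_contact 2 (\<lambda>t. ruling (t, P)) t (proj_tangent_line (\<lambda>t. ruling (t, P)) t)"
  have "?c \<bullet> w = 0" if "w \<in> proj_tangent_line (\<lambda>t. ruling (t, P)) t" for w
  proof -
    have "w \<in> span {ruling (t, P), ruling' (t, P)}"
      using that by (simp add: proj_tangent_line_def ruling_vector_derivative[OF P t])
    then obtain k l where "w = k *\<^sub>R ruling (t, P) + l *\<^sub>R ruling' (t, P)"
      by (auto simp: span_insert span_singleton algebra_simps)
    then show ?thesis by (simp add: inner_add_right ruling_def ruling'_def dot_cross_self)
  qed
  then have "(deriv ^^ 2) (\<lambda>s. ?c \<bullet> ruling (s, P)) t = 0"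
    using contact unfolding line_contact_def by blast
  moreover have "(deriv ^^ 2) (\<lambda>s. ?c \<bullet> ruling (s, P)) t
      = ?c \<bullet> (cross3 (\<gamma> 1 (t, P)) (\<gamma> 2 (t, P)) + cross3 (\<gamma> 0 (t, P)) (\<gamma> 3 (t, P)))"
  proof -
    have "deriv (\<lambda>s. ?c \<bullet> ruling (s, P)) s = ?c \<bullet> ruling' (s, P)" if "s \<in> J" for s
      by (rule DERIV_imp_deriv[OF inner_ruling_derivative(1)[OF P that]])
    then have "(deriv (\<lambda>s. ?c \<bullet> ruling (s, P)) has_real_derivative
        ?c \<bullet> (cross3 (\<gamma> 1 (t, P)) (\<gamma> 2 (t, P)) + cross3 (\<gamma> 0 (t, P)) (\<gamma> 3 (t, P)))) (at t)"
      by (intro has_field_derivative_transform_within_open[OF inner_ruling_derivative(2)[OF P t] open_J t]) simp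
    then show ?thesis by (simp add: numeral_2_eq_2 DERIV_imp_deriv)
  qed
  \<comment> \<open>The term with \<open>\<gamma> 3\<close> is again a cross product with
    \<open>?c\<close> and drops out.\<close>
  ultimately have "?c \<bullet> cross3 (\<gamma> 1 (t, P)) (\<gamma> 2 (t, P)) = 0"
    by (simp add: inner_add_right dot_cross_self)
  then show False using mixed_wronskian P t by blast
qed


section \<open>The causal geometry\<close>

lemma fibre_domain_subset: "fibre_domain P \<subseteq> J \<times> UNIV"
  by (auto simp: fibre_domain_def)

lemma smooth_pencil_fibres:
  assumes P: "P \<in> U"
  shows "smooth_pencil ((\<lambda>x. fibre x P) ` J)"
  unfolding smooth_pencil_def
proof (rule exI[of _ J], rule exI[of _ "fibre_domain P"], rule exI[of _ "fibre_param P"], intro conjI ballI allI impI)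
  have "fibre x P \<noteq> fibre y P" if h: "x \<in> J" "y \<in> J" "x \<noteq> y" for x y
  proof
    assume eq: "fibre x P = fibre y P"
    obtain Q where "Q \<in> fibre x P" "Q \<noteq> P" using fibre_nontrivial[OF h(1) P] .
    then show False using contact_unique[OF P, of Q x y] eq h by (auto simp: fibre_def)
  qed
  then have "inj_on (\<lambda>x. fibre x P) J" unfolding inj_on_def by blast
  then have "bij_betw (\<lambda>x. fibre x P) J ((\<lambda>x. fibre x P) ` J)" by (rule inj_on_imp_bij_betw)
  then show "bij_betw (\<lambda>s. (\<lambda>t. fibre_param P (s, t)) ` {t. (s, t) \<in> fibre_domain P}) J ((\<lambda>x. fibre x P) ` J)"
    by (simp add: fibre_eq_image cong: bij_betw_cong)
qed (use open_J interval_J J_nonempty open_fibre_domain smooth_fibre_param interval_fibre_domain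
    inj_fibre_param fibre_param_vector_derivative(2) fibre_domain_subset P in auto)

theorem causal_geometry_of_chart:
  assumes f: "\<And>x P. x \<in> J \<Longrightarrow> P \<in> U \<Longrightarrow> f x P = u 0 (x, P) \<and> xderiv 1 f x P = u 1 (x, P)"
  shows "incident_at_most_once f J U"
    and "causal_geometry U (incidence_cone f J U) (incidence_curve f J U)"
proof -
  let ?N = "incidence_cone f J U" and ?K = "incidence_curve f J U"
  have common: "z \<in> jet1_curve f J P \<and> z \<in> jet1_curve f J Q \<longleftrightarrow>
      (\<exists>x\<in>J. z = (x, f x P, xderiv 1 f x P) \<and> contact x P Q)" if "P \<in> U" "Q \<in> U" for P Q z
    using f that by (auto simp: jet1_curve_def contact_def image_iff)
  have N: "?N P = cone P" if "P \<in> U" for P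
  proof -
    have "incident f J P Q \<longleftrightarrow> (\<exists>x\<in>J. contact x P Q)" if "Q \<in> U" for Q
      unfolding incident_def ex_in_conv[symmetric] Int_iff common[OF \<open>P \<in> U\<close> that] by blast
    then show ?thesis by (auto simp: incidence_cone_def cone_def)
  qed
  have K: "?K P Q = fibre x P" if h: "P \<in> U" "Q \<in> U" "Q \<noteq> P" "x \<in> J" "contact x P Q" for P Q x
  proof -
    have "?K P Q = {R \<in> U. \<exists>y\<in>J. contact y P Q \<and> contact y P R}"
      unfolding incidence_curve_def using common[OF h(1,2)] common[OF h(1)] by fastforce
    also have "\<dots> = fibre x P"
      using contact_unique[OF h(1,2) h(3)[symmetric] h(4,5)] h(4,5)
      unfolding fibre_def by blast
    finally show ?thesis .
  qed
  have coneE: "\<exists>x\<in>J. Q \<in> U \<and> contact x P Q \<and> ?K P Q = fibre x P" if "P \<in> U" "Q \<in> ?N P - {P}" for P Q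
    using that K N by (auto simp: cone_def)
  show "incident_at_most_once f J U"
    unfolding incident_at_most_once_def
  proof (intro ballI impI)
    fix P Q z z' assume "P \<in> U" "Q \<in> U" "P \<noteq> Q" "z \<in> jet1_curve f J P \<inter> jet1_curve f J Q"
      "z' \<in> jet1_curve f J P \<inter> jet1_curve f J Q"
    then show "z = z'" using common[of P Q] contact_unique[of P Q] by (metis IntD1 IntD2)
  qed
  \<comment> \<open>Replaces the index \<open>Q\<close> by the point of contact. The union of the
    rulings, the pencil and the indicatrix are all read off from this reindexing.\<close>
  have family: "?K P ` (?N P - {P}) = (\<lambda>x. fibre x P) ` J" if P: "P \<in> U" for P
  proof (intro equalityI subsetI)
    fix C assume "C \<in> ?K P ` (?N P - {P})"
    then show "C \<in> (\<lambda>x. fibre x P) ` J" using coneE[OF P] by blast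
  next
    fix C assume "C \<in> (\<lambda>x. fibre x P) ` J"
    then obtain x where x: "x \<in> J" "C = fibre x P" by blast
    obtain Q where Q: "Q \<in> fibre x P" "Q \<noteq> P" using fibre_nontrivial[OF x(1) P] .
    then have "Q \<in> ?N P - {P}" "?K P Q = C"
      using N[OF P] K[OF P, of Q x] x by (auto simp: cone_def fibre_def)
    then show "C \<in> ?K P ` (?N P - {P})" by blast
  qed
  have meet: "fibre x P \<inter> fibre y P = {P}" if "P \<in> U" "x \<in> J" "y \<in> J" "x \<noteq> y" for P x y
    using contact_unique[of P _ x y] that vertex_in_fibre[OF that(1)] by (auto simp: fibre_def)
  show "causal_geometry U ?N ?K"
    unfolding causal_geometry_def
  proof (intro conjI ballI)
    show "open U" by (rule open_U)
    fix P assume P: "P \<in> U"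
    show NU: "?N P \<subseteq> U" by (auto simp: incidence_cone_def)
    show "embedded_submanifold 2 (?N P - {P})" using embedded_cone[OF P] N[OF P] by simp
    show "smooth_pencil (?K P ` (?N P - {P}))" using smooth_pencil_fibres[OF P] family[OF P] by simp
    have "(\<Union>x\<in>J. fibre x P) = cone P" by (auto simp: fibre_def cone_def)
    then show "(\<Union>Q\<in>?N P - {P}. ?K P Q) = ?N P" using family[OF P] N[OF P] by simp
    have "indicatrix ?N ?K P = (\<lambda>C. tangent_space C P) ` (?K P ` (?N P - {P}))"
      by (simp add: indicatrix_def image_image)
    also have "\<dots> = (\<lambda>t. span {ruling (t, P)}) ` J"
      unfolding family[OF P] image_image by (intro image_cong) (auto simp: tangent_fibre P)
    finally show "\<exists>I v. regular_proj_curve (indicatrix ?N ?K P) I v \<and>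
        (\<forall>t\<in>I. \<not> line_contact 2 v t (proj_tangent_line v t))"
      using regular_ruling[OF P] no_second_order_contact[OF P] by metis
    fix Q assume Q: "Q \<in> ?N P - {P}"
    then obtain x where x: "x \<in> J" "Q \<in> U" "contact x P Q" "?K P Q = fibre x P" using coneE[OF P] by blast
    show "embedded_submanifold 1 (?K P Q)" "connected (?K P Q)" "P \<in> ?K P Q" "Q \<in> ?K P Q"
      using embedded_fibre connected_fibre vertex_in_fibre P x by (simp_all add: fibre_def)
    show "P \<in> ?N Q - {Q}" using Q N[OF x(2)] P x(1) contact_sym[OF x(3)] by (auto simp: cone_def)
    show "?K P Q = ?K Q P" unfolding incidence_curve_def by blast
    fix R assume R: "R \<in> ?N P - {P}"
    then obtain y where y: "y \<in> J" "R \<in> U" "contact y P R" "?K P R = fibre y P" using coneE[OF P] by blast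
    show "?K P Q = ?K P R \<or> ?K P Q \<inter> ?K P R = {P}"
      using meet[OF P x(1) y(1)] x(4) y(4) by auto
    show "Q \<noteq> R \<and> R \<in> ?N Q \<longrightarrow> tangent_space (?N P - {P}) R = tangent_space (?N Q - {Q}) R"
    proof
      assume QR: "Q \<noteq> R \<and> R \<in> ?N Q"
      then obtain z where z: "z \<in> J" "contact z Q R" using N[OF x(2)] by (auto simp: cone_def)
      have "z = y"
        using mutual_contact_unique(2)[OF P x(2) y(2) _ _ _ x(1) z(1) y(1) x(3) z(2) y(3)] Q R QR by auto
      then show "tangent_space (?N P - {P}) R = tangent_space (?N Q - {Q}) R"
        using tangent_cone[OF P y(2) _ y(1,3)] tangent_cone[OF x(2) y(2) _ z] R QR N[OF P] N[OF x(2)] by auto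
    qed
  qed
qed

end


section \<open>Choice of the neighbourhood\<close>

lemma convex_sublevel_interval:
  fixes h :: "real \<Rightarrow> real"
  assumes "convex_on T h"
  shows "is_interval {t \<in> T. h t < c}"
  unfolding is_interval_convex_1
proof (rule convexI)
  fix s t p q :: real
  assume st: "s \<in> {t \<in> T. h t < c}" "t \<in> {t \<in> T. h t < c}" and pq: "0 \<le> p" "0 \<le> q" "p + q = 1"
  have "convex T" using assms by (simp add: convex_on_def)
  then have "p *\<^sub>R s + q *\<^sub>R t \<in> T" using st pq by (intro convexD) auto
  moreover have "h (p *\<^sub>R s + q *\<^sub>R t) \<le> max (h s) (h t)"
    by (rule convex_lower[OF assms]) (use st pq in auto)
  ultimately show "p *\<^sub>R s + q *\<^sub>R t \<in> {t \<in> T. h t < c}" using st by auto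
qed

text \<open>The hypothesis says that the squared distance to \<open>P\<close> is convex along the curve.\<close>

lemma curve_meets_ball_in_interval:
  fixes G :: "'a::euclidean_space \<Rightarrow> 'b::euclidean_space"
  defines "D v z \<equiv> frechet_derivative G (at z) v"
  assumes G: "smooth_on N G" and V: "V \<subseteq> N" "convex V"
    and pos: "\<And>z. z \<in> V \<Longrightarrow> D v z \<bullet> D v z + (G z - P) \<bullet> frechet_derivative (D v) (at z) v \<ge> 0"
  shows "is_interval {t. z + t *\<^sub>R v \<in> V \<and> G (z + t *\<^sub>R v) \<in> ball P r}"
proof (cases "r > 0")
  case False
  then show ?thesis by (simp add: ball_empty)
next
  case True
  let ?l = "\<lambda>t. z + t *\<^sub>R v"
  define T where "T = {t. ?l t \<in> V}"
  define h where "h t = (G (?l t) - P) \<bullet> (G (?l t) - P)" for t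
  define h1 where "h1 t = 2 * ((G (?l t) - P) \<bullet> D v (?l t))" for t
  define h2 where "h2 t = 2 * (D v (?l t) \<bullet> D v (?l t) + (G (?l t) - P) \<bullet> frechet_derivative (D v) (at (?l t)) v)" for t
  have "convex T"
  proof (rule convexI)
    fix s t p q :: real
    assume st: "s \<in> T" "t \<in> T" and pq: "0 \<le> p" "0 \<le> q" "p + q = 1"
    have "p *\<^sub>R ?l s + q *\<^sub>R ?l t \<in> V" using st pq V(2) by (intro convexD) (auto simp: T_def)
    moreover have "p *\<^sub>R ?l s + q *\<^sub>R ?l t = (p + q) *\<^sub>R z + (p * s + q * t) *\<^sub>R v"
      by (simp add: algebra_simps)
    ultimately show "p *\<^sub>R s + q *\<^sub>R t \<in> T" using pq by (simp add: T_def)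
  qed
  moreover have dG: "((\<lambda>t. G (?l t) - P) has_vector_derivative D v (?l t)) (at t)" if "t \<in> T" for t
    unfolding D_def has_vector_derivative_diff_const
    by (rule has_vector_derivative_along_line[OF smooth_on_has_derivative[OF G]])
      (use that V in \<open>auto simp: T_def\<close>)
  have dD: "((\<lambda>t. D v (?l t)) has_vector_derivative frechet_derivative (D v) (at (?l t)) v) (at t)" if "t \<in> T" for t
  proof (rule has_vector_derivative_along_line[OF smooth_on_has_derivative])
    show "smooth_on N (D v)" unfolding D_def by (rule smooth_on_frechet_derivative[OF G])
  qed (use that V in \<open>auto simp: T_def\<close>)
  have "(h has_real_derivative h1 t) (at t)" if "t \<in> T" for t
    using bounded_bilinear.has_vector_derivative[OF bounded_bilinear_inner dG[OF that] dG[OF that]]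
    unfolding has_real_derivative_iff_has_vector_derivative h_def h1_def by (simp add: inner_commute)
  moreover have "(h1 has_real_derivative h2 t) (at t)" if "t \<in> T" for t
    using has_vector_derivative_mult_right[OF
        bounded_bilinear.has_vector_derivative[OF bounded_bilinear_inner dG[OF that] dD[OF that]], of 2]
    unfolding has_real_derivative_iff_has_vector_derivative h1_def h2_def by (simp add: add.commute)
  moreover have "h2 t \<ge> 0" if "t \<in> T" for t
    using pos[of "?l t"] that by (simp add: T_def h2_def)
  ultimately have "convex_on T h" by (rule f''_ge0_imp_convex)
  then have "is_interval {t \<in> T. h t < r\<^sup>2}" by (rule convex_sublevel_interval)
  moreover have "h t < r\<^sup>2 \<longleftrightarrow> G (?l t) \<in> ball P r" for t
  proof -
    have "h t = (norm (G (?l t) - P))\<^sup>2" by (simp add: h_def power2_norm_eq_inner)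
    then show ?thesis using True by (auto simp: dist_norm norm_minus_commute intro: power2_less_imp_less power_strict_mono)
  qed
  ultimately show ?thesis by (simp add: T_def)
qed

text \<open>One number serves both as half-width in \<open>x\<close> and as radius in the
  parameters.\<close>

lemma open_product_neighbourhood:
  fixes x\<^sub>0 :: real and P\<^sub>0 :: "'a::metric_space"
  assumes "open G" "(x\<^sub>0, P\<^sub>0) \<in> G"
  obtains e where "e > 0" "{x\<^sub>0 - e<..<x\<^sub>0 + e} \<times> ball P\<^sub>0 e \<subseteq> G"
proof -
  obtain A B where AB: "open A" "open B" "x\<^sub>0 \<in> A" "P\<^sub>0 \<in> B" "A \<times> B \<subseteq> G"
    by (rule open_prod_elim[OF assms]) (auto simp: mem_Times_iff)
  obtain d where d: "d > 0" "ball x\<^sub>0 d \<subseteq> A" using AB(1,3) open_contains_ball by blast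
  obtain r where r: "r > 0" "ball P\<^sub>0 r \<subseteq> B" using AB(2,4) open_contains_ball by blast
  have "{x\<^sub>0 - min d r<..<x\<^sub>0 + min d r} \<subseteq> ball x\<^sub>0 d" by (auto simp: dist_real_def)
  moreover have "ball P\<^sub>0 (min d r) \<subseteq> ball P\<^sub>0 r" by auto
  ultimately show ?thesis using that[of "min d r"] d r AB(5) by fastforce
qed

section \<open>Local inverses and open conditions at the base point\<close>

context solution_family
begin

lemma restrict:
  assumes "open J'" "open U'" "J' \<subseteq> J" "U' \<subseteq> U"
  shows "solution_family u J' U'"
proof
  show "smooth_on (J' \<times> U') (u k)" for k
    using smooth_on_subset[OF smooth_u] assms by (metis Sigma_mono)
  show "frechet_derivative (u k) (at z) (1, 0) = u (Suc k) z" if "z \<in> J' \<times> U'" for k z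
    using that assms(3,4) by (intro deriv_u) auto
qed (rule assms(1,2))+

lemma xderiv_eq:
  assumes f: "\<And>x P. x \<in> J \<Longrightarrow> P \<in> U \<Longrightarrow> f x P = u 0 (x, P)" and "x \<in> J" and P: "P \<in> U"
  shows "xderiv k f x P = u k (x, P)"
  using assms(2)
proof (induction k arbitrary: x)
  case 0
  then show ?case using f P by (simp add: xderiv_def)
next
  case (Suc k)
  have "((\<lambda>t. xderiv k f t P) has_real_derivative u (Suc k) (x, P)) (at x)"
    by (rule has_field_derivative_transform_within_open[OF DERIV_u[OF Suc.prems P] open_J Suc.prems])
      (simp add: Suc.IH)
  then show ?case using DERIV_imp_deriv unfolding xderiv_def by fastforce
qed

lemma wronskian_eq:
  assumes f: "\<And>x P. x \<in> J \<Longrightarrow> P \<in> U \<Longrightarrow> f x P = u 0 (x, P)" and x: "x \<in> J" and P: "P \<in> U"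
  shows "wronskian f x P = \<gamma> 0 (x, P) \<bullet> cross3 (\<gamma> 1 (x, P)) (\<gamma> 2 (x, P))"
proof -
  have "pgrad (xderiv k f x) P = \<gamma> k (x, P)" for k
  proof -
    have "(xderiv k f x has_derivative (\<lambda>w. \<gamma> k (x, P) \<bullet> w)) (at P)"
      by (rule has_derivative_transform_within_open[OF has_derivative_u_parameter[OF x P] open_U P])
        (simp add: xderiv_eq[OF f x])
    then have "frechet_derivative (xderiv k f x) (at P) = (\<lambda>w. \<gamma> k (x, P) \<bullet> w)"
      using frechet_derivative_at by metis
    then show ?thesis by (simp add: pgrad_def vec_eq_iff inner_axis)
  qed
  then show ?thesis by (simp add: wronskian_def dot_cross_det)
qed

text \<open>The map sending a point and a solution to the point and the 2-jet there has a block
  triangular derivative, with the Wronskian matrix as its parameter block. Its inverse keeps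
  \<open>x\<close>, and the second component of the inverse is \<open>\<Gamma>\<close>.\<close>

lemma jet2_local_inverse:
  assumes z: "z \<in> J \<times> U" and w: "\<gamma> 0 z \<bullet> cross3 (\<gamma> 1 z) (\<gamma> 2 z) \<noteq> 0"
  obtains A N \<Gamma> where "open A" "z \<in> A" "A \<subseteq> J \<times> U" "open N" "smooth_on N \<Gamma>"
    "\<And>z. z \<in> A \<Longrightarrow> (fst z, jet2 z) \<in> N \<and> \<Gamma> (fst z, jet2 z) = snd z"
    "\<And>x y. (x, y) \<in> N \<Longrightarrow> (x, \<Gamma> (x, y)) \<in> A \<and> jet2 (x, \<Gamma> (x, y)) = y"
proof -
  let ?H = "\<lambda>z. (fst z, jet2 z)"
  have H: "smooth_on (J \<times> U) ?H"
    by (intro smooth_on_Pair open_JU smooth_on_linear smooth_jet2 bounded_linear_fst)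
  let ?D = "frechet_derivative ?H (at z)"
  have D: "(?H has_derivative ?D) (at z)" using smooth_on_has_derivative[OF H z] .
  have fst: "fst (?D v) = fst v" for v
  proof -
    have d: "((\<lambda>z. fst (?H z)) has_derivative (\<lambda>v. fst (?D v))) (at z)"
      by (rule has_derivative_fst[OF D])
    have "((\<lambda>z. fst (?H z)) has_derivative fst) (at z)"
      by (simp add: bounded_linear_imp_has_derivative bounded_linear_fst)
    from fun_cong[OF has_derivative_unique[OF d this]] show ?thesis .
  qed
  have nth: "snd (?D v) $ i = frechet_derivative (\<lambda>z. jet2 z $ i) (at z) v" for v i
  proof -
    have "((\<lambda>z. snd (?H z) $ i) has_derivative (\<lambda>v. snd (?D v) $ i)) (at z)"
      by (rule bounded_linear.has_derivative[OF bounded_linear_vec_nth has_derivative_snd[OF D]])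
    then have "((\<lambda>z. jet2 z $ i) has_derivative (\<lambda>v. snd (?D v) $ i)) (at z)" by simp
    from fun_cong[OF frechet_derivative_at[OF this]] show ?thesis .
  qed
  have "inj ?D"
    unfolding linear_injective_0[OF has_derivative_linear[OF D]]
  proof (intro allI impI)
    fix v assume v: "?D v = 0"
    then have s: "fst v = 0" using fst[of v] by simp
    have "frechet_derivative (\<lambda>z. jet2 z $ i) (at z) v = 0" for i
      using nth[of v i] v by simp
    from this[of 1] this[of 2] this[of 3]
    have "frechet_derivative (u 0) (at z) v = 0" "frechet_derivative (u 1) (at z) v = 0"
      "frechet_derivative (u 2) (at z) v = 0"
      by (simp_all add: jet2_def)
    moreover have "frechet_derivative (u k) (at z) v = \<gamma> k z \<bullet> snd v" for k
      using frechet_derivative_u[OF z, of k "fst v" "snd v"] s by (metis add_0 mult_zero_left prod.collapse)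
    ultimately have "\<gamma> 0 z \<bullet> snd v = 0" "\<gamma> 1 z \<bullet> snd v = 0" "\<gamma> 2 z \<bullet> snd v = 0"
      by metis+
    then have "snd v = 0" by (rule triple_product_eq_0[OF w])
    then show "v = 0" using s by (simp add: prod_eq_iff)
  qed
  then obtain A N g where A: "open A" "A \<subseteq> J \<times> U" "z \<in> A" "open N" "?H z \<in> N" "homeomorphism A N ?H g"
    "smooth_on N g"
    by (rule smooth_inverse_function_theorem[OF open_JU H z]) (rule that)
  have g: "g q \<in> A" "?H (g q) = q" if "q \<in> N" for q
    using A(6) that by (auto simp: homeomorphism_def)
  have gH: "?H q \<in> N" "g (?H q) = q" if "q \<in> A" for q
    using A(6) that by (auto simp: homeomorphism_def)
  show ?thesis
  proof (rule that[OF A(1,3,2,4)])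
    show "smooth_on N (\<lambda>q. snd (g q))"
      by (rule smooth_on_bounded_linear[OF A(4) bounded_linear_snd A(7)])
    show "(fst z, jet2 z) \<in> N \<and> snd (g (fst z, jet2 z)) = snd z" if "z \<in> A" for z
      using gH[OF that] by simp
    show "(x, snd (g (x, y))) \<in> A \<and> jet2 (x, snd (g (x, y))) = y" if "(x, y) \<in> N" for x y
    proof -
      have "g (x, y) = (x, snd (g (x, y)))" using g(2)[OF that] by (simp add: prod_eq_iff)
      then show ?thesis using g[OF that] by simp
    qed
  qed
qed

text \<open>The determinant with rows at \<open>p\<close>, \<open>q\<close>, \<open>r\<close> is
  continuous in the triple and nonzero at the diagonal point \<open>(z, z, z)\<close>, hence on a
  cube around it.\<close>

lemma mixed_wronskian_neighbourhood:
  assumes z: "z \<in> J \<times> U" and w: "\<gamma> 0 z \<bullet> cross3 (\<gamma> 1 z) (\<gamma> 2 z) \<noteq> 0"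
  obtains Z where "open Z" "z \<in> Z"
    "\<And>p q r. p \<in> Z \<Longrightarrow> q \<in> Z \<Longrightarrow> r \<in> Z \<Longrightarrow> \<gamma> 0 p \<bullet> cross3 (\<gamma> 1 q) (\<gamma> 2 r) \<noteq> 0"
proof -
  let ?S = "J \<times> U"
  let ?m = "\<lambda>t. \<gamma> 0 (fst t) \<bullet> cross3 (\<gamma> 1 (fst (snd t))) (\<gamma> 2 (snd (snd t)))"
  have g: "continuous_on ?S (\<gamma> k)" for k by (rule smooth_on_imp_continuous_on[OF smooth_gradient])
  have "continuous_on (?S \<times> ?S \<times> ?S) ?m"
    by (intro continuous_on_inner continuous_on_cross continuous_on_compose2[OF g] continuous_intros) auto
  then have "open ((?S \<times> ?S \<times> ?S) \<inter> ?m -` (- {0}))"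
    by (intro continuous_open_preimage open_Times open_JU) auto
  moreover have "(z, z, z) \<in> (?S \<times> ?S \<times> ?S) \<inter> ?m -` (- {0})" using z w by simp
  ultimately obtain X Y where XY: "open X" "open Y" "z \<in> X" "(z, z) \<in> Y" "X \<times> Y \<subseteq> (?S \<times> ?S \<times> ?S) \<inter> ?m -` (- {0})"
    by (rule open_prod_elim) (auto simp: mem_Times_iff)
  obtain X' X'' where X': "open X'" "open X''" "z \<in> X'" "z \<in> X''" "X' \<times> X'' \<subseteq> Y"
    by (rule open_prod_elim[OF XY(2,4)]) (auto simp: mem_Times_iff)
  show ?thesis
  proof (rule that[of "X \<inter> X' \<inter> X''"])
    fix p q r assume "p \<in> X \<inter> X' \<inter> X''" "q \<in> X \<inter> X' \<inter> X''" "r \<in> X \<inter> X' \<inter> X''"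
    then have "(p, q, r) \<in> X \<times> Y" using X'(5) by auto
    then show "\<gamma> 0 p \<bullet> cross3 (\<gamma> 1 q) (\<gamma> 2 r) \<noteq> 0" using XY(5) by auto
  qed (use XY X' in auto)
qed

lemma slope_neighbourhood:
  assumes z: "z \<in> J \<times> U" and w: "\<gamma> 0 z \<bullet> cross3 (\<gamma> 1 z) (\<gamma> 2 z) \<noteq> 0"
  obtains Z a b where "open Z" "z \<in> Z" "\<And>p. p \<in> Z \<Longrightarrow> a \<bullet> ruling p \<noteq> 0"
    "\<And>p. p \<in> Z \<Longrightarrow> (b \<bullet> ruling' p) * (a \<bullet> ruling p) - (b \<bullet> ruling p) * (a \<bullet> ruling' p) > 0"
proof -
  \<comment> \<open>With \<open>n\<close> normal to the plane of \<open>ruling z\<close> and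
    \<open>ruling' z\<close>, the vector \<open>b\<close> lies in that plane and is orthogonal to
    \<open>a\<close>. At \<open>z\<close> the slope numerator becomes
    \<open>(n \<bullet> n) * (a \<bullet> a)\<close>, and positivity persists nearby.\<close>
  define a where "a = ruling z"
  define n where "n = cross3 a (ruling' z)"
  define b where "b = cross3 n a"
  have "\<gamma> 0 z \<noteq> 0" using w by auto
  then have n: "n \<noteq> 0" using w by (simp add: n_def a_def ruling_def ruling'_def cross3_cross3_common)
  then have a: "a \<bullet> a > 0" by (auto simp: n_def)
  have "b \<bullet> ruling' z = n \<bullet> n" unfolding b_def n_def by (simp add: cross3_simps)
  moreover have "b \<bullet> a = 0" by (simp add: b_def dot_cross_self)
  ultimately have s: "(b \<bullet> ruling' z) * (a \<bullet> ruling z) - (b \<bullet> ruling z) * (a \<bullet> ruling' z) > 0"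
    using n a by (simp add: a_def)
  have c: "continuous_on (J \<times> U) ruling" "continuous_on (J \<times> U) ruling'"
    by (intro smooth_on_imp_continuous_on smooth_ruling smooth_ruling')+
  have "open ((J \<times> U) \<inter> (\<lambda>p. a \<bullet> ruling p) -` (- {0}))" (is "open ?X")
    by (rule continuous_open_preimage[OF _ open_JU]) (auto intro!: continuous_intros c)
  moreover have "open ((J \<times> U) \<inter> (\<lambda>p. (b \<bullet> ruling' p) * (a \<bullet> ruling p) - (b \<bullet> ruling p) * (a \<bullet> ruling' p)) -` {0<..})"
    (is "open ?Y")
    by (rule continuous_open_preimage[OF _ open_JU]) (auto intro!: continuous_intros c)
  ultimately have "open (?X \<inter> ?Y)" by (rule open_Int)
  then show ?thesis
    by (rule that[of _ a b]) (use s a z in \<open>auto simp: a_def\<close>)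
qed

text \<open>\<open>V\<close> is chosen in jet space before \<epsilon>, and \<epsilon> then keeps all
  2-jets inside \<open>V\<close>. The convexity condition refers only to the centre
  \<open>P\<^sub>0\<close>, so it handles the balls of all smaller radii at once.\<close>

lemma exists_chart:
  assumes z: "(x\<^sub>0, P\<^sub>0) \<in> J \<times> U"
    and w: "\<gamma> 0 (x\<^sub>0, P\<^sub>0) \<bullet> cross3 (\<gamma> 1 (x\<^sub>0, P\<^sub>0)) (\<gamma> 2 (x\<^sub>0, P\<^sub>0)) \<noteq> 0"
  obtains \<epsilon> V \<Gamma> a b where "\<epsilon> > 0" "{x\<^sub>0 - \<epsilon><..<x\<^sub>0 + \<epsilon>} \<subseteq> J" "ball P\<^sub>0 \<epsilon> \<subseteq> U"
    "\<And>\<delta> r. 0 < \<delta> \<Longrightarrow> \<delta> \<le> \<epsilon> \<Longrightarrow> 0 < r \<Longrightarrow> r \<le> \<epsilon> \<Longrightarrow>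
      solution_chart u {x\<^sub>0 - \<delta><..<x\<^sub>0 + \<delta>} (ball P\<^sub>0 r) V \<Gamma> a b"
proof -
  let ?z = "(x\<^sub>0, P\<^sub>0)" and ?e = "(0, axis 3 1) :: real \<times> (real^3)"
  obtain A N \<Gamma> where A: "open A" "?z \<in> A" "A \<subseteq> J \<times> U" "open N" "smooth_on N \<Gamma>"
    "\<And>z. z \<in> A \<Longrightarrow> (fst z, jet2 z) \<in> N \<and> \<Gamma> (fst z, jet2 z) = snd z"
    "\<And>x y. (x, y) \<in> N \<Longrightarrow> (x, \<Gamma> (x, y)) \<in> A \<and> jet2 (x, \<Gamma> (x, y)) = y"
    by (rule jet2_local_inverse[OF z w]) (rule that)
  obtain Z where Z: "open Z" "?z \<in> Z"
    "\<And>p q r. p \<in> Z \<Longrightarrow> q \<in> Z \<Longrightarrow> r \<in> Z \<Longrightarrow> \<gamma> 0 p \<bullet> cross3 (\<gamma> 1 q) (\<gamma> 2 r) \<noteq> 0"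
    by (rule mixed_wronskian_neighbourhood[OF z w]) (rule that)
  obtain Y a b where Y: "open Y" "?z \<in> Y" "\<And>p. p \<in> Y \<Longrightarrow> a \<bullet> ruling p \<noteq> 0"
    "\<And>p. p \<in> Y \<Longrightarrow> (b \<bullet> ruling' p) * (a \<bullet> ruling p) - (b \<bullet> ruling p) * (a \<bullet> ruling' p) > 0"
    by (rule slope_neighbourhood[OF z w]) (rule that)
  let ?y = "(x\<^sub>0, jet2 ?z)"
  have y: "?y \<in> N" "\<Gamma> ?y = P\<^sub>0" using A(6)[OF A(2)] by simp_all
  define D where "D = (\<lambda>z. frechet_derivative \<Gamma> (at z) ?e)"
  \<comment> \<open>Half the second derivative, along the y'' direction \<open>?e\<close>, of the
    squared distance from \<Gamma> to \<open>P\<^sub>0\<close>. At \<open>?y\<close> the second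
    summand is 0 because \<open>\<Gamma> ?y = P\<^sub>0\<close>, so nonzero velocity
    \<open>D ?y\<close> already makes \<open>c\<close> positive.\<close>
  define c where "c = (\<lambda>z. D z \<bullet> D z + (\<Gamma> z - P\<^sub>0) \<bullet> frechet_derivative D (at z) ?e)"
  have sD: "smooth_on N D" unfolding D_def by (rule smooth_on_frechet_derivative[OF A(5)])
  \<comment> \<open>The value of \<open>u 2\<close> on the moving solution is
    \<open>u 2 ?z + t\<close>, of derivative 1; zero velocity would make it stationary.\<close>
  have "D ?y \<noteq> 0"
  proof
    assume D0: "D ?y = 0"
    have d: "((\<lambda>t. \<Gamma> (?y + t *\<^sub>R ?e)) has_derivative (\<lambda>h. h *\<^sub>R D ?y)) (at 0)"
      using has_vector_derivative_along_line[of \<Gamma> "frechet_derivative \<Gamma> (at ?y)" ?y 0 ?e]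
        smooth_on_has_derivative[OF A(5) y(1)] by (simp add: D_def has_vector_derivative_def)
    have "((\<lambda>t::real. u 2 (x\<^sub>0, \<Gamma> (?y + t *\<^sub>R ?e))) has_derivative
        (\<lambda>v. 0 * u (Suc 2) (x\<^sub>0, \<Gamma> (?y + 0 *\<^sub>R ?e)) + \<gamma> 2 (x\<^sub>0, \<Gamma> (?y + 0 *\<^sub>R ?e)) \<bullet> (v *\<^sub>R D ?y))) (at 0)"
      by (rule has_derivative_u_compose[OF has_derivative_const d]) (use z y in auto)
    then have 1: "((\<lambda>t::real. u 2 (x\<^sub>0, \<Gamma> (?y + t *\<^sub>R ?e))) has_derivative (\<lambda>v. 0)) (at 0)"
      using D0 by simp
    have "open ((\<lambda>t::real. ?y + t *\<^sub>R ?e) -` N)"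
      by (intro open_vimage A continuous_intros)
    then have "((\<lambda>t::real. u 2 ?z + t) has_derivative (\<lambda>v. 0)) (at 0)"
    proof (rule has_derivative_transform_within_open[OF 1])
      fix t :: real assume "t \<in> (\<lambda>t. ?y + t *\<^sub>R ?e) -` N"
      then have "(x\<^sub>0, jet2 ?z + t *\<^sub>R axis 3 1) \<in> N" by simp
      from A(7)[OF this] have "jet2 (x\<^sub>0, \<Gamma> (?y + t *\<^sub>R ?e)) $ 3 = (jet2 ?z + t *\<^sub>R axis 3 1) $ 3" by simp
      then show "u 2 (x\<^sub>0, \<Gamma> (?y + t *\<^sub>R ?e)) = u 2 ?z + t" by (simp add: jet2_def)
    qed (use y in auto)
    moreover have "((\<lambda>t::real. u 2 ?z + t) has_derivative (\<lambda>v. v)) (at 0)"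
      by (auto intro!: derivative_eq_intros)
    ultimately have "(\<lambda>v::real. 0::real) = (\<lambda>v. v)" by (rule has_derivative_unique)
    then show False by (metis zero_neq_one)
  qed
  then have cy: "c ?y > 0" using y by (simp add: c_def)
  have "continuous_on N c"
    unfolding c_def
    by (intro continuous_intros smooth_on_imp_continuous_on A(5) sD smooth_on_frechet_derivative[OF sD])
  then have "open (N \<inter> c -` {0<..})" by (intro continuous_open_preimage A) auto
  moreover have "?y \<in> N \<inter> c -` {0<..}" using y cy by simp
  ultimately obtain \<rho> where \<rho>: "\<rho> > 0" "ball ?y \<rho> \<subseteq> N \<inter> c -` {0<..}"
    using open_contains_ball by meson
  \<comment> \<open>A ball, because the interval argument needs lines to meet \<open>V\<close> in
    intervals.\<close>
  define V where "V = ball ?y \<rho>"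
  have V: "open V" "V \<subseteq> N" "convex V" "?y \<in> V" "\<And>z. z \<in> V \<Longrightarrow> c z > 0"
    using \<rho> by (auto simp: V_def convex_ball)
  let ?H = "\<lambda>z. (fst z, jet2 z)"
  have H: "smooth_on (J \<times> U) ?H"
    by (intro smooth_on_Pair open_JU smooth_on_linear smooth_jet2 bounded_linear_fst)
  have "open ((J \<times> U) \<inter> ?H -` V)"
    by (rule continuous_open_preimage[OF smooth_on_imp_continuous_on[OF H] open_JU V(1)])
  then have G: "open (((J \<times> U) \<inter> ?H -` V) \<inter> (A \<inter> (Z \<inter> Y)))" (is "open ?G")
    by (rule open_Int) (intro open_Int A(1) Z(1) Y(1))
  have zG: "?z \<in> ?G" using z V(4) A(2) Z(2) Y(2) by simp
  obtain \<epsilon> where \<epsilon>: "\<epsilon> > 0" "{x\<^sub>0 - \<epsilon><..<x\<^sub>0 + \<epsilon>} \<times> ball P\<^sub>0 \<epsilon> \<subseteq> ?G"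
    by (rule open_product_neighbourhood[OF G zG]) (rule that)
  show ?thesis
  proof (rule that[OF \<epsilon>(1)])
    have "x\<^sub>0 \<in> {x\<^sub>0 - \<epsilon><..<x\<^sub>0 + \<epsilon>}" "P\<^sub>0 \<in> ball P\<^sub>0 \<epsilon>" using \<epsilon>(1) by auto
    then show "{x\<^sub>0 - \<epsilon><..<x\<^sub>0 + \<epsilon>} \<subseteq> J" "ball P\<^sub>0 \<epsilon> \<subseteq> U" using \<epsilon>(2) by blast+
    fix \<delta> r :: real assume dr: "0 < \<delta>" "\<delta> \<le> \<epsilon>" "0 < r" "r \<le> \<epsilon>"
    let ?J = "{x\<^sub>0 - \<delta><..<x\<^sub>0 + \<delta>}" and ?U = "ball P\<^sub>0 r"
    have sub: "?J \<times> ?U \<subseteq> ?G"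
      using dr by (intro order_trans[OF _ \<epsilon>(2)] Sigma_mono) auto
    have G: "(x, P) \<in> ?G" if "x \<in> ?J" "P \<in> ?U" for x P using sub that by blast
    have "x\<^sub>0 \<in> ?J" "P\<^sub>0 \<in> ?U" using dr by auto
    then have JU: "?J \<subseteq> J" "?U \<subseteq> U" using sub by blast+
    interpret loc: solution_family u ?J ?U
      by (rule restrict[OF _ _ JU]) auto
    show "solution_chart u ?J ?U V \<Gamma> a b"
    proof
      show "is_interval ?J" by (simp add: is_interval_convex_1 convex_real_interval)
      show "?J \<noteq> {}" using dr by simp
      show "convex ?U" by (rule convex_ball)
      show "\<gamma> 0 (x\<^sub>1, P\<^sub>1) \<bullet> cross3 (\<gamma> 1 (x\<^sub>2, P\<^sub>2)) (\<gamma> 2 (x\<^sub>3, P\<^sub>3)) \<noteq> 0"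
        if "x\<^sub>1 \<in> ?J" "x\<^sub>2 \<in> ?J" "x\<^sub>3 \<in> ?J" "P\<^sub>1 \<in> ?U" "P\<^sub>2 \<in> ?U" "P\<^sub>3 \<in> ?U" for x\<^sub>1 x\<^sub>2 x\<^sub>3 P\<^sub>1 P\<^sub>2 P\<^sub>3
        using Z(3) G[OF that(1,4)] G[OF that(2,5)] G[OF that(3,6)] by blast
      show "open V" "smooth_on V \<Gamma>" using V smooth_on_subset[OF A(5)] by blast+
      show "(x, loc.jet2 (x, P)) \<in> V \<and> \<Gamma> (x, loc.jet2 (x, P)) = P" if "x \<in> ?J" "P \<in> ?U" for x P
        using G[OF that] A(6)[of "(x, P)"] by simp
      show "loc.jet2 (x, \<Gamma> (x, y)) = y" if "x \<in> ?J" "(x, y) \<in> V" "\<Gamma> (x, y) \<in> ?U" for x y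
        using A(7)[of x y] that V(2) by blast
      show "is_interval {t. (x, vector [p, q, t]) \<in> V \<and> \<Gamma> (x, vector [p, q, t]) \<in> ?U}" if "x \<in> ?J" for x p q
      proof -
        have "is_interval {t. (x, vector [p, q, 0]) + t *\<^sub>R ?e \<in> V \<and> \<Gamma> ((x, vector [p, q, 0]) + t *\<^sub>R ?e) \<in> ?U}"
          using V(5) by (intro curve_meets_ball_in_interval[OF A(5) V(2,3)]) (auto simp: c_def D_def less_imp_le)
        moreover have "(x, vector [p, q, 0]) + t *\<^sub>R ?e = (x, vector [p, q, t])" for t :: real
          by (simp add: vec_eq_iff forall_3 axis_def)
        ultimately show ?thesis by simp
      qed
      show "a \<bullet> loc.ruling z \<noteq> 0" if "z \<in> ?J \<times> ?U" for z
        using Y(3) sub that by blast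
      show "0 < (b \<bullet> loc.ruling' z) * (a \<bullet> loc.ruling z) - (b \<bullet> loc.ruling z) * (a \<bullet> loc.ruling' z)"
        if "z \<in> ?J \<times> ?U" for z
        using Y(4) sub that by blast
    qed
  qed
qed

end

section \<open>Application to the given solutions\<close>

primrec x_iterate :: "(real \<times> (real^3) \<Rightarrow> real) \<Rightarrow> nat \<Rightarrow> real \<times> (real^3) \<Rightarrow> real" where
  "x_iterate g 0 = g"
| "x_iterate g (Suc k) = (\<lambda>z. frechet_derivative (x_iterate g k) (at z) (1, 0))"

text \<open>Each iterate is the Frechet derivative of a joint map in the fixed direction
  \<open>(1, 0)\<close>, so joint smoothness is inherited at once; agreement with the pointwise
  \<open>xderiv\<close> is the separate matter of \<open>xderiv_eq\<close>.\<close>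

lemma solution_family_x_iterate:
  assumes "open I" "open M" "smooth_on (I \<times> M) g"
  shows "solution_family (x_iterate g) I M"
proof
  show "smooth_on (I \<times> M) (x_iterate g k)" for k
    by (induction k) (simp_all add: assms(3) smooth_on_frechet_derivative)
qed (simp_all add: assms)

theorem theorem5:
  fixes F :: "real \<times> real \<times> real \<times> real \<Rightarrow> real"
    and \<Omega> :: "(real \<times> real \<times> real \<times> real) set"
    and f :: "real \<Rightarrow> real^3 \<Rightarrow> real"
    and I :: "real set" and M :: "(real^3) set"
    and x\<^sub>0 :: real and P\<^sub>0 :: "real^3"
  assumes "open \<Omega>" and "smooth_on \<Omega> F"
    and "open I" and "is_interval I" and "open M"
    and "smooth_on (I \<times> M) (\<lambda>(x, P). f x P)"
    and "\<And>x P. x \<in> I \<Longrightarrow> P \<in> M \<Longrightarrow>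
           (x, f x P, xderiv 1 f x P, xderiv 2 f x P) \<in> \<Omega> \<and>
           xderiv 3 f x P = F (x, f x P, xderiv 1 f x P, xderiv 2 f x P)"
    and "\<And>x P. x \<in> I \<Longrightarrow> P \<in> M \<Longrightarrow> wronskian f x P \<noteq> 0"
    and "x\<^sub>0 \<in> I" and "P\<^sub>0 \<in> M"
  shows "\<exists>\<epsilon>>0. {x\<^sub>0 - \<epsilon><..<x\<^sub>0 + \<epsilon>} \<subseteq> I \<and> ball P\<^sub>0 \<epsilon> \<subseteq> M \<and>
           (\<forall>\<delta> r. 0 < \<delta> \<and> \<delta> \<le> \<epsilon> \<and> 0 < r \<and> r \<le> \<epsilon> \<longrightarrow>
              (let J = {x\<^sub>0 - \<delta><..<x\<^sub>0 + \<delta>}; U = ball P\<^sub>0 r in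
                 incident_at_most_once f J U \<and>
                 causal_geometry U (incidence_cone f J U) (incidence_curve f J U)))"
proof -
  let ?u = "x_iterate (\<lambda>(x, P). f x P)"
  interpret fam: solution_family ?u I M
    by (rule solution_family_x_iterate[OF assms(3,5,6)])
  have f: "f x P = ?u 0 (x, P)" for x P by simp
  have z: "(x\<^sub>0, P\<^sub>0) \<in> I \<times> M" using assms(9,10) by simp
  have w: "fam.\<gamma> 0 (x\<^sub>0, P\<^sub>0) \<bullet> cross3 (fam.\<gamma> 1 (x\<^sub>0, P\<^sub>0)) (fam.\<gamma> 2 (x\<^sub>0, P\<^sub>0)) \<noteq> 0"
    using assms(8)[OF assms(9,10)] fam.wronskian_eq[OF f assms(9,10)] by metis
  obtain \<epsilon> V \<Gamma> a b where \<epsilon>: "\<epsilon> > 0" "{x\<^sub>0 - \<epsilon><..<x\<^sub>0 + \<epsilon>} \<subseteq> I" "ball P\<^sub>0 \<epsilon> \<subseteq> M"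
    "\<And>\<delta> r. 0 < \<delta> \<Longrightarrow> \<delta> \<le> \<epsilon> \<Longrightarrow> 0 < r \<Longrightarrow> r \<le> \<epsilon> \<Longrightarrow>
      solution_chart ?u {x\<^sub>0 - \<delta><..<x\<^sub>0 + \<delta>} (ball P\<^sub>0 r) V \<Gamma> a b"
    by (rule fam.exists_chart[OF z w]) (rule that)
  have "incident_at_most_once f J U \<and> causal_geometry U (incidence_cone f J U) (incidence_curve f J U)"
    if h: "0 < \<delta>" "\<delta> \<le> \<epsilon>" "0 < r" "r \<le> \<epsilon>" "J = {x\<^sub>0 - \<delta><..<x\<^sub>0 + \<delta>}" "U = ball P\<^sub>0 r" for \<delta> r J U
  proof -
    interpret chart: solution_chart ?u J U V \<Gamma> a b using \<epsilon>(4)[OF h(1-4)] h(5,6) by simp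
    have "f x P = ?u 0 (x, P) \<and> xderiv 1 f x P = ?u 1 (x, P)" if "x \<in> J" "P \<in> U" for x P
    proof -
      have "x \<in> {x\<^sub>0 - \<epsilon><..<x\<^sub>0 + \<epsilon>}" "P \<in> ball P\<^sub>0 \<epsilon>" using that h by auto
      then have "x \<in> I" "P \<in> M" using \<epsilon>(2,3) by blast+
      then show ?thesis using fam.xderiv_eq[OF f, of x P 1] by simp
    qed
    then show ?thesis using chart.causal_geometry_of_chart by blast
  qed
  then show ?thesis using \<epsilon>(1-3) by (intro exI[of _ \<epsilon>]) (simp add: Let_def)
qed

end
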